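(* Let $U \ge 0$ be a constant. There exists a shear flow $u_s = u_s(y)$, with $u_s(0)=0$, $\lim_{y\to+\infty}u_s(y)=U$ and $u_s - U \in C^\infty_c(\mathbb{R}_+)$, such that for all $T>0$ there exists an initial data $u_0=u_0(x,y)$ satisfying: (i) $e^{y} u_0 \in H^\infty(\mathbb{T}\times\mathbb{R}_+)$; (ii) the initial value problem $$\left\{\begin{array}{l} \partial_t u + u_s \,\partial_x u + u_s'\, v - \partial_y^2 u = 0, \quad y>0,\\ \partial_x u + \partial_y v = 0, \quad y>0,\\ u = v = 0, \quad y=0,\end{array}\right. \qquad (t,x,y)\in[0,T)\times\mathbb{T}\times\mathbb{R}_+, \qquad u|_{t=0}=u_0,$$ has no distributional solution $u$ with $$u\in L^\infty(]0,T[; L^2(\mathbb{T}\times\mathbb{R}_+)), \qquad \partial_y u \in L^2(]0,T[\times\mathbb{T}\times\mathbb{R}_+).$$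
   Context: $\mathbb{T}$ denotes the one-dimensional torus (variable $x$) and $\mathbb{R}_+$ the half-line of variables $y$; $C^\infty_c(\mathbb{R}_+)$ denotes smooth functions on $[0,+\infty)$ (up to $y=0$) with compact support in $[0,+\infty)$. $H^\infty=\bigcap_{m\ge 0}H^m$. A shear flow is a smooth function $u_s(y)$ with $u_s(0)=0$ and $\lim_{y\to+\infty}u_s=U$; primes denote $y$-derivatives. The system is the linearization of the Prandtl equation around $(u_s(y),0)$; in it, $v$ is determined by $u$ through $v = -\int_0^y \partial_x u\,dy'$. The condition $\lim_{y\to+\infty}u=0$ is encoded in the functional spaces. A solution $u$ with the regularity $u\in L^\infty(]0,T[; L^2(\mathbb{T}\times\mathbb{R}_+))$, $\partial_y u \in L^2(]0,T[\times\mathbb{T}\times\mathbb{R}_+)$ satisfies $\partial_t u\in L^2(]0,T[;H^{-1}(\mathbb{T}\times\mathbb{R}_+))$, hence $u\in C([0,T];H^{-1}(\mathbb{T}\times\mathbb{R}_+))\cap C_w([0,T];L^2(\mathbb{T}\times\mathbb{R}_+))$ ($C_w$: weakly continuous), which gives a meaning to the initial condition. *)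

theory Defs
  imports "HOL-Analysis.Analysis"
begin

text \<open>
  Points of \<open>T \<times> R\<^sub>+\<close> are pairs \<open>(x, y)\<close> and points of \<open>]0,T[ \<times> T \<times> R\<^sub>+\<close> are triples
  \<open>(t, x, y)\<close>.  The torus is \<open>R / 2 \<pi> Z\<close>: a function (class) on it is represented by its values
  on the fundamental domain \<open>{0..<2*pi}\<close>, values elsewhere being irrelevant, whereas test
  functions, which have to be smooth on the torus, are \<open>2 \<pi>\<close>-periodic functions on the line.
\<close>

definition torus :: "real measure" where
  "torus = restrict_space lborel {0..<2*pi}"

definition halfline :: "real measure" where
  "halfline = restrict_space lborel {0<..}"

definition time :: "real \<Rightarrow> real measure" where
  "time T = restrict_space lborel {0<..<T}"

definition half_cylinder :: "(real \<times> real) measure" where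
  "half_cylinder = torus \<Otimes>\<^sub>M halfline"

definition space_time :: "real \<Rightarrow> (real \<times> real \<times> real) measure" where
  "space_time T = time T \<Otimes>\<^sub>M half_cylinder"

definition L2 :: "'a measure \<Rightarrow> ('a \<Rightarrow> real) set" where
  "L2 M = {f. f \<in> borel_measurable M \<and> integrable M (\<lambda>z. (f z)\<^sup>2)}"

definition dir_deriv :: "'a::euclidean_space \<Rightarrow> ('a \<Rightarrow> real) \<Rightarrow> 'a \<Rightarrow> real" where
  "dir_deriv e f = (\<lambda>z. frechet_derivative f (at z) e)"

primrec Ck :: "nat \<Rightarrow> ('a::euclidean_space \<Rightarrow> real) \<Rightarrow> bool" where
  "Ck 0 f \<longleftrightarrow> continuous_on UNIV f"
| "Ck (Suc n) f \<longleftrightarrow> (\<forall>z. f differentiable (at z)) \<and> (\<forall>e. Ck n (dir_deriv e f))"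

definition smooth :: "('a::euclidean_space \<Rightarrow> real) \<Rightarrow> bool" where
  "smooth f \<longleftrightarrow> (\<forall>n. Ck n f)"

text \<open>
  Functions that are smooth up to the endpoint of \<open>[0,\<infinity>[\<close> (\<open>D n\<close> is the \<open>n\<close>-th derivative,
  one-sided at \<open>0\<close>), with compact support in \<open>[0,\<infinity>[\<close>; the support may contain \<open>0\<close>.
\<close>

definition Cc_inf_halfline :: "(real \<Rightarrow> real) set" where
  "Cc_inf_halfline = {f.
     (\<exists>D. D 0 = f \<and>
        (\<forall>n. \<forall>y\<ge>0. (D n has_real_derivative D (Suc n) y) (at y within {0..}))) \<and>
     (\<exists>R. \<forall>y\<ge>R. f y = 0)}"

text \<open>
  Test functions on the open sets \<open>T \<times> ]0,\<infinity>[\<close> and \<open>]0,T[ \<times> T \<times> ]0,\<infinity>[\<close>.  As the torus is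
  compact, compactness of the support only restricts the variables \<open>t\<close> and \<open>y\<close>.
\<close>

definition test_xy :: "(real \<times> real \<Rightarrow> real) set" where
  "test_xy = {\<phi>. smooth \<phi> \<and> (\<forall>x y. \<phi> (x + 2*pi, y) = \<phi> (x, y)) \<and>
     (\<exists>c d. 0 < c \<and> (\<forall>x y. \<phi> (x, y) \<noteq> 0 \<longrightarrow> y \<in> {c..d}))}"

definition test_txy :: "real \<Rightarrow> (real \<times> real \<times> real \<Rightarrow> real) set" where
  "test_txy T = {\<phi>. smooth \<phi> \<and> (\<forall>t x y. \<phi> (t, x + 2*pi, y) = \<phi> (t, x, y)) \<and>
     (\<exists>a b c d. 0 < a \<and> b < T \<and> 0 < c \<and>
        (\<forall>t x y. \<phi> (t, x, y) \<noteq> 0 \<longrightarrow> t \<in> {a..b} \<and> y \<in> {c..d}))}"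

text \<open>
  Distributions are represented by functionals that are only ever evaluated on test functions;
  identities between distributions mean equality on all test functions.
\<close>

type_synonym 'a distribution = "('a \<Rightarrow> real) \<Rightarrow> real"

definition dist_of :: "'a measure \<Rightarrow> ('a \<Rightarrow> real) \<Rightarrow> 'a distribution" where
  "dist_of M f = (\<lambda>\<phi>. \<integral>z. f z * \<phi> z \<partial>M)"

definition ddist :: "'a::euclidean_space \<Rightarrow> 'a distribution \<Rightarrow> 'a distribution" where
  "ddist e F = (\<lambda>\<phi>. - F (dir_deriv e \<phi>))"

text \<open>Product of a distribution with a function of \<open>y\<close> that is smooth on \<open>]0,\<infinity>[\<close>.\<close>

definition mult_y ::
  "(real \<Rightarrow> real) \<Rightarrow> (real \<times> real \<times> real) distribution \<Rightarrow> (real \<times> real \<times> real) distribution" where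
  "mult_y a F = (\<lambda>\<phi>. F (\<lambda>(t, x, y). a y * \<phi> (t, x, y)))"

definition Sobolev :: "nat \<Rightarrow> (real \<times> real \<Rightarrow> real) set" where
  "Sobolev m = {f \<in> L2 half_cylinder. \<forall>i j. i + j \<le> m \<longrightarrow>
     (\<exists>g \<in> L2 half_cylinder. \<forall>\<phi> \<in> test_xy.
        (ddist (1, 0) ^^ i) ((ddist (0, 1) ^^ j) (dist_of half_cylinder f)) \<phi>
          = dist_of half_cylinder g \<phi>)}"

definition Sobolev_inf :: "(real \<times> real \<Rightarrow> real) set" where
  "Sobolev_inf = (\<Inter>m. Sobolev m)"

definition Linf_L2 :: "real \<Rightarrow> (real \<times> real \<times> real \<Rightarrow> real) set" where
  "Linf_L2 T = {u. u \<in> borel_measurable (space_time T) \<and>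
     (\<exists>C. AE t in time T. (\<lambda>z. u (t, z)) \<in> L2 half_cylinder \<and>
        (\<integral>z. (u (t, z))\<^sup>2 \<partial>half_cylinder) \<le> C)}"

definition dy_in_L2 :: "real \<Rightarrow> (real \<times> real \<times> real \<Rightarrow> real) \<Rightarrow> bool" where
  "dy_in_L2 T u \<longleftrightarrow> (\<exists>g \<in> L2 (space_time T). \<forall>\<phi> \<in> test_txy T.
     ddist (0, 0, 1) (dist_of (space_time T) u) \<phi> = dist_of (space_time T) g \<phi>)"

text \<open>
  The distribution \<open>v = - \<integral>\<^sub>0\<^sup>y \<partial>\<^sub>x u dy'\<close>, that is \<open>- \<partial>\<^sub>x\<close> of the locally integrable function
  \<open>\<integral>\<^sub>0\<^sup>y u dy'\<close>.
\<close>

definition normal_velocity ::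
  "real \<Rightarrow> (real \<times> real \<times> real \<Rightarrow> real) \<Rightarrow> (real \<times> real \<times> real) distribution" where
  "normal_velocity T u = (\<lambda>\<phi>. - ddist (0, 1, 0)
     (dist_of (space_time T) (\<lambda>(t, x, y). LINT z:{0<..y}|lborel. u (t, x, z))) \<phi>)"

definition linearized_Prandtl ::
  "(real \<Rightarrow> real) \<Rightarrow> real \<Rightarrow> (real \<times> real \<times> real \<Rightarrow> real) \<Rightarrow> bool" where
  "linearized_Prandtl us T u \<longleftrightarrow>
     (let u' = dist_of (space_time T) u; v = normal_velocity T u in
      \<forall>\<phi> \<in> test_txy T.
        ddist (1, 0, 0) u' \<phi> + mult_y us (ddist (0, 1, 0) u') \<phi> + mult_y (deriv us) v \<phi>
          - ddist (0, 0, 1) (ddist (0, 0, 1) u') \<phi> = 0)"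

text \<open>
  Boundary condition \<open>u = 0\<close> at \<open>y = 0\<close>.  If \<open>u\<close> and \<open>\<partial>\<^sub>y u\<close> are in \<open>L\<^sup>2\<close>, then for almost all
  \<open>(t, x)\<close> the class of \<open>u (t, x, _)\<close> has a representative that is continuous up to \<open>y = 0\<close>;
  its value there is the trace of \<open>u\<close>.
\<close>

definition zero_trace :: "real \<Rightarrow> (real \<times> real \<times> real \<Rightarrow> real) \<Rightarrow> bool" where
  "zero_trace T u \<longleftrightarrow> (AE (t, x) in time T \<Otimes>\<^sub>M torus.
     \<exists>w. continuous_on {0..} w \<and> w 0 = 0 \<and> (AE y in halfline. u (t, x, y) = w y))"

text \<open>
  Initial condition: the class of \<open>u\<close> has a representative \<open>w\<close> in \<open>C\<^sub>w([0,T]; L\<^sup>2)\<close>, which is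
  automatic for solutions in the present regularity class, and \<open>w\<close> takes the value \<open>u\<^sub>0\<close> at time \<open>0\<close>.
\<close>

definition initial_value ::
  "real \<Rightarrow> (real \<times> real \<times> real \<Rightarrow> real) \<Rightarrow> (real \<times> real \<Rightarrow> real) \<Rightarrow> bool" where
  "initial_value T u u0 \<longleftrightarrow>
     (\<exists>w. (\<forall>t\<in>{0..T}. w t \<in> L2 half_cylinder) \<and>
        (\<forall>\<psi> \<in> L2 half_cylinder. continuous_on {0..T} (\<lambda>t. \<integral>z. w t z * \<psi> z \<partial>half_cylinder)) \<and>
        (AE t in time T. AE z in half_cylinder. u (t, z) = w t z) \<and>
        (AE z in half_cylinder. w 0 z = u0 z))"

definition Prandtl_solution ::
  "(real \<Rightarrow> real) \<Rightarrow> real \<Rightarrow> (real \<times> real \<Rightarrow> real) \<Rightarrow> (real \<times> real \<times> real \<Rightarrow> real) \<Rightarrow> bool" where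
  "Prandtl_solution us T u0 u \<longleftrightarrow>
     linearized_Prandtl us T u \<and> zero_trace T u \<and> initial_value T u u0"

end

(*
  The shear flow is chosen to be exactly -(y - 3)^2 near its critical point y = 3.  On the Fourier
  mode exp(i k x) the adjoint of the linearized operator then has the explicit Gaussian eigenfunction
  exp(- mu (y - 3)^2 / 2) with eigenvalue mu, where mu^2 = - i k and Re mu = sqrt(k / 2) > 0.
  Cutting it off around the critical point makes it a legitimate test function, at the price of a
  residual that is exponentially small in sqrt k.

  Tested against exp(- mu t) times this quasimode, a solution u that is bounded in L^2 yields
      |<u_0, quasimode>| <= C (k^(1/2) exp(- c k^(1/2) T) + T k exp(- c k^(1/2))),
  so the datum would have to be exponentially small, in sqrt k, along the quasimodes.  The datum is a
  series over k = 2 n^2 whose amplitudes exp(- sqrt n) decay faster than every power of n, which makes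
  it smooth, but too slowly for this bound.
*)
theory Submission
  imports Defs "HOL-Real_Asymp.Real_Asymp"
begin

section \<open>Smooth functions\<close>

text \<open>The nonlocal term shapes the test profile. In the weak equation \<open>v\<close> is a
  primitive of \<open>u\<close> from the wall, and its transpose is a primitive from infinity: a
  profile \<open>Q\<close> enters together with a \<open>P\<close> such that
  \<open>P' = us' Q\<close>, and both must vanish for large y. So \<open>P\<close> is chosen first,
  as a cut-off Gaussian in s = (y - 3)^2, and \<open>Q\<close> is minus its derivative in s. Then
  \<open>P' = us' Q\<close> because the flow is -s near y = 3, and both functions stay explicit. For
  the uncut pair, Q'' = (mu^2 s - mu) Q and mu^2 P = 2 mu Q, whence mu^2 (- s Q + P) + Q'' = mu Q.
  Frequencies 2 n^2 make mu = n (1 - i) explicit and exp (mu^2 x) periodic on the torus. The datum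
  must not cancel against the oscillating phase n (y - 3)^2 / 2 of the Gaussian. Its n-th profile is
  therefore a bump of width 1/n, where \<open>Q\<close> is almost the constant mu/2; the powers of n
  that this costs in the derivatives are absorbed by the amplitudes. Test functions vanish near t =
  0, so the datum is reached only in a limit, through the weak continuity in time.\<close>

lemma dir_deriv_eqI:
  assumes "(f has_derivative D) (at z)"
  shows "dir_deriv e f z = D e"
  using frechet_derivative_at[OF assms] by (simp add: dir_deriv_def)

lemma Ck_Suc_D: "Ck (Suc n) f \<Longrightarrow> Ck n f"
proof (induction n arbitrary: f)
  case 0
  then show ?case
    by (auto intro!: differentiable_imp_continuous_on simp: differentiable_on_def
        intro: differentiable_at_withinI)
next
  case (Suc n)
  then show ?case by (metis Ck.simps(2))
qed

lemma Ck_const: "Ck n (\<lambda>_. c)"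
proof (induction n arbitrary: c)
  case (Suc n)
  have "dir_deriv e (\<lambda>_. c) = (\<lambda>_. 0)" for e :: 'a
    by (simp add: dir_deriv_def)
  then show ?case using Suc by simp
qed simp

lemma Ck_bounded_linear:
  assumes "bounded_linear f"
  shows "Ck n f"
proof (cases n)
  case 0
  then show ?thesis using assms by (simp add: linear_continuous_on)
next
  case (Suc m)
  have "dir_deriv e f = (\<lambda>_. f e)" for e
    using dir_deriv_eqI[OF bounded_linear_imp_has_derivative[OF assms]] by auto
  then show ?thesis
    using assms by (simp add: Suc Ck_const bounded_linear_imp_differentiable)
qed

lemma Ck_add:
  assumes "Ck n f" "Ck n g"
  shows "Ck n (\<lambda>z. f z + g z)"
  using assms
proof (induction n arbitrary: f g)
  case 0
  then show ?case by (simp add: continuous_on_add)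
next
  case (Suc n)
  have "dir_deriv e (\<lambda>z. f z + g z) = (\<lambda>z. dir_deriv e f z + dir_deriv e g z)" for e
  proof
    fix z
    show "dir_deriv e (\<lambda>z. f z + g z) z = dir_deriv e f z + dir_deriv e g z"
      using Suc.prems
      by (subst dir_deriv_eqI[OF has_derivative_add])
        (auto simp: dir_deriv_def simp flip: frechet_derivative_works)
  qed
  then show ?case using Suc by simp
qed

lemma Ck_mult:
  fixes f g :: "'a::euclidean_space \<Rightarrow> real"
  assumes "Ck n f" "Ck n g"
  shows "Ck n (\<lambda>z. f z * g z)"
  using assms
proof (induction n arbitrary: f g)
  case 0
  then show ?case by (simp add: continuous_on_mult)
next
  case (Suc n)
  have "dir_deriv e (\<lambda>z. f z * g z) = (\<lambda>z. f z * dir_deriv e g z + dir_deriv e f z * g z)"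
    for e
  proof
    fix z
    show "dir_deriv e (\<lambda>z. f z * g z) z = f z * dir_deriv e g z + dir_deriv e f z * g z"
      using Suc.prems
      by (subst dir_deriv_eqI[OF has_derivative_mult])
        (auto simp: dir_deriv_def simp flip: frechet_derivative_works)
  qed
  moreover have "Ck n f" "Ck n g" using Suc.prems Ck_Suc_D by blast+
  ultimately show ?case using Suc by (auto intro!: Ck_add)
qed

text \<open>With a real-valued inner function the chain rule gives a product of two functions of
  class \<open>Ck n\<close>, so \<open>Ck_mult\<close> closes the induction.\<close>

lemma Ck_compose:
  fixes f :: "real \<Rightarrow> real" and g :: "'a::euclidean_space \<Rightarrow> real"
  assumes "Ck n f" "Ck n g"
  shows "Ck n (\<lambda>z. f (g z))"
  using assms
proof (induction n arbitrary: f g)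
  case 0
  then show ?case
    by (auto intro!: continuous_on_compose2[of UNIV f])
next
  case (Suc n)
  have d: "(\<lambda>z. f (g z)) differentiable (at z)" for z
    using Suc.prems differentiable_chain_at[of g z f] by (simp add: o_def)
  have "dir_deriv e (\<lambda>z. f (g z)) = (\<lambda>z. dir_deriv 1 f (g z) * dir_deriv e g z)" for e
  proof
    fix z
    have gz: "(g has_derivative frechet_derivative g (at z)) (at z)"
      and fz: "(f has_derivative frechet_derivative f (at (g z))) (at (g z))"
      using Suc.prems by (auto simp flip: frechet_derivative_works)
    have "linear (frechet_derivative f (at (g z)))"
      using fz has_derivative_linear by blast
    then have "frechet_derivative f (at (g z)) r = r * frechet_derivative f (at (g z)) 1" for r
      using linear_scale[of _ r 1] by fastforce
    moreover have "dir_deriv e (\<lambda>z. f (g z)) z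
        = frechet_derivative f (at (g z)) (frechet_derivative g (at z) e)"
      using dir_deriv_eqI[OF diff_chain_at[OF gz fz]] by (simp add: o_def)
    ultimately show "dir_deriv e (\<lambda>z. f (g z)) z = dir_deriv 1 f (g z) * dir_deriv e g z"
      by (metis dir_deriv_def mult.commute)
  qed
  moreover have "Ck n g" using Suc.prems Ck_Suc_D by blast
  ultimately show ?case using Suc d by (auto intro!: Ck_mult)
qed

lemma dir_deriv_real:
  assumes "(f has_real_derivative d) (at y)"
  shows "dir_deriv e f y = d * e"
  using dir_deriv_eqI[of f "(*) d" y e] assms by (simp add: has_field_derivative_def)

lemma Ck_Suc_realI:
  fixes f :: "real \<Rightarrow> real"
  assumes "\<And>y. (f has_real_derivative f' y) (at y)" "Ck n f'"
  shows "Ck (Suc n) f"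
proof -
  have "dir_deriv e f = (\<lambda>y. f' y * e)" for e
    using dir_deriv_real[OF assms(1)] by auto
  then show ?thesis
    using assms by (auto intro!: Ck_mult Ck_const simp: real_differentiable_def)
qed

lemma smooth_add: "smooth f \<Longrightarrow> smooth g \<Longrightarrow> smooth (\<lambda>z. f z + g z)"
  and smooth_mult: "smooth f \<Longrightarrow> smooth g \<Longrightarrow> smooth (\<lambda>z. f z * g z)"
  and smooth_const: "smooth (\<lambda>_. c)"
  by (simp_all add: smooth_def Ck_add Ck_mult Ck_const)

lemma smooth_compose: "smooth f \<Longrightarrow> smooth g \<Longrightarrow> smooth (\<lambda>z. f (g z))"
  by (simp add: smooth_def Ck_compose)

lemma smooth_bounded_linear: "bounded_linear f \<Longrightarrow> smooth f"
  by (simp add: smooth_def Ck_bounded_linear)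

lemma smooth_ident: "smooth (\<lambda>y::real. y)"
  by (rule smooth_bounded_linear) (rule bounded_linear_ident)

lemma smooth_uminus: "smooth f \<Longrightarrow> smooth (\<lambda>z. - f z)"
  using smooth_mult[OF smooth_const[of "-1"]] by simp

lemma smooth_diff: "smooth f \<Longrightarrow> smooth g \<Longrightarrow> smooth (\<lambda>z. f z - g z)"
  using smooth_add[OF _ smooth_uminus] by simp

lemma smooth_power: "smooth f \<Longrightarrow> smooth (\<lambda>z. f z ^ n)"
  by (induction n) (simp_all add: smooth_const smooth_mult)

lemma smooth_divide_const: "smooth f \<Longrightarrow> smooth (\<lambda>z. f z / c)"
  using smooth_mult[OF _ smooth_const[of "1/c"]] by simp

text \<open>The induction on the order runs over all of \<open>F\<close> at once, since the
  derivative of a member is another member. It yields smoothness of \<open>exp\<close>, of the sine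
  and cosine cycle and of \<open>flat\<close> without formulas for higher derivatives.\<close>

lemma smooth_family:
  fixes F :: "(real \<Rightarrow> real) set"
  assumes "\<And>f. f \<in> F \<Longrightarrow> \<exists>f'\<in>F. \<forall>y. (f has_real_derivative f' y) (at y)"
  shows "f \<in> F \<Longrightarrow> smooth f"
proof -
  have "\<forall>f\<in>F. Ck n f" for n
  proof (induction n)
    case 0
    then show ?case
      using assms DERIV_isCont by (auto simp: continuous_on_eq_continuous_at) blast
  next
    case (Suc n)
    then show ?case using assms Ck_Suc_realI by metis
  qed
  then show "f \<in> F \<Longrightarrow> smooth f" by (auto simp: smooth_def)
qed

lemma smooth_exp: "smooth (exp :: real \<Rightarrow> real)"
  by (rule smooth_family[of "{exp}"]) (auto intro: DERIV_exp)

lemma smooth_sin: "smooth (sin :: real \<Rightarrow> real)"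
  and smooth_cos: "smooth (cos :: real \<Rightarrow> real)"
proof -
  let ?F = "{sin, cos, \<lambda>y. - sin y, \<lambda>y. - cos y} :: (real \<Rightarrow> real) set"
  have *: "\<exists>f'\<in>?F. \<forall>y. (f has_real_derivative f' y) (at y)" if "f \<in> ?F" for f
    using that by (auto intro!: derivative_eq_intros)
  show "smooth (sin :: real \<Rightarrow> real)" "smooth (cos :: real \<Rightarrow> real)"
    by (rule smooth_family[OF *]; simp)+
qed

lemma smooth_inverse:
  fixes f :: "real \<Rightarrow> real"
  assumes "smooth f" "\<And>y. f y \<noteq> 0"
  shows "smooth (\<lambda>y. inverse (f y))"
proof -
  have "Ck n (\<lambda>y. inverse (f y))" for n
  proof (induction n)
    case 0
    then show ?case using assms by (auto simp: smooth_def intro!: continuous_on_inverse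
      dest: spec[of _ 0])
  next
    case (Suc n)
    have f1: "Ck (Suc n) f" using assms by (simp add: smooth_def)
    have fd: "(f has_real_derivative deriv f y) (at y)" for y
      using f1 by (auto simp: DERIV_deriv_iff_real_differentiable)
    have "deriv f = dir_deriv 1 f" using dir_deriv_real[OF fd, of 1] by auto
    then have "Ck n (deriv f)" using f1 by simp
    \<comment> \<open>The derivative - f' (1/f)^2 contains 1/f undifferentiated, which is
      \<open>Ck n\<close> by induction.\<close>
    with Suc show ?case
      by (intro Ck_Suc_realI[where f'="\<lambda>y. - 1 * (deriv f y * (inverse (f y) * inverse (f y)))"]
          Ck_mult Ck_const)
        (auto intro!: derivative_eq_intros fd simp: assms)
  qed
  then show ?thesis by (simp add: smooth_def)
qed

lemmas smooth_intros = smooth_add smooth_mult smooth_const smooth_ident smooth_uminus smooth_diff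
  smooth_power smooth_divide_const smooth_compose[OF smooth_exp] smooth_compose[OF smooth_sin]
  smooth_compose[OF smooth_cos]

lemma smooth_DERIV:
  fixes f :: "real \<Rightarrow> real"
  assumes "smooth f"
  shows "(f has_real_derivative deriv f y) (at y)"
proof -
  have "Ck 1 f" using assms smooth_def by blast
  then show ?thesis by (simp add: DERIV_deriv_iff_real_differentiable)
qed

lemma smooth_deriv:
  fixes f :: "real \<Rightarrow> real"
  assumes "smooth f"
  shows "smooth (deriv f)"
proof -
  have "deriv f = dir_deriv 1 f"
    using dir_deriv_real[OF smooth_DERIV[OF assms], of 1] by auto
  then show ?thesis using assms by (metis Ck.simps(2) smooth_def)
qed

lemma smooth_deriv_iter: "smooth f \<Longrightarrow> smooth ((deriv ^^ n) f)" for f :: "real \<Rightarrow> real"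
  by (induction n) (auto intro: smooth_deriv)

lemma smooth_dir_deriv: "smooth f \<Longrightarrow> smooth (dir_deriv e f)"
  by (metis Ck.simps(2) smooth_def)

lemma smooth_continuous_on: "smooth f \<Longrightarrow> continuous_on S f"
  by (metis Ck.simps(1) continuous_on_subset smooth_def subset_UNIV)

lemma smooth_differentiable: "smooth f \<Longrightarrow> f differentiable (at z)"
  by (metis Ck.simps(2) smooth_def)

section \<open>A smooth cutoff\<close>

lemma poly_times_exp_tendsto_0:
  "((\<lambda>x. poly p (1/x) * exp (-1/x)) \<longlongrightarrow> 0) (at_right (0::real))"
proof -
  have pow: "((\<lambda>x::real. (1/x)^k * exp (-1/x)) \<longlongrightarrow> 0) (at_right 0)" for k
    using filterlim_compose[OF tendsto_power_div_exp_0[of k] filterlim_inverse_at_top_right]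
    by (simp add: exp_minus field_simps)
  have "((\<lambda>x. \<Sum>i\<le>degree p. coeff p i * ((1/x)^i * exp (-1/x))) \<longlongrightarrow> (\<Sum>i\<le>degree p. coeff p i * 0))
      (at_right (0::real))"
    by (intro tendsto_sum tendsto_mult tendsto_const pow)
  then show ?thesis by (simp add: poly_altdef sum_distrib_right mult.assoc)
qed

text \<open>The classical function exp (-1/x), with a polynomial in 1/x as parameter so that
  \<open>range flat\<close> is closed under differentiation.\<close>

definition flat :: "real poly \<Rightarrow> real \<Rightarrow> real" where
  "flat p x = (if x \<le> 0 then 0 else poly p (1/x) * exp (-1/x))"

text \<open>For x > 0 the derivative of p (1/x) exp (-1/x) is (1/x)^2 (p - p') (1/x) exp (-1/x);
  \<open>[:0, 0, 1:]\<close> is the square of the variable.\<close>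

lemma flat_has_derivative:
  "(flat p has_real_derivative flat ([:0, 0, 1:] * (p - pderiv p)) x) (at x)"
proof (cases x "0 :: real" rule: linorder_cases)
  case less
  have "(flat p has_real_derivative 0) (at x)"
    by (rule DERIV_cong_ev[THEN iffD2, OF refl _ refl, of _ "\<lambda>_. 0"])
      (use eventually_nhds_in_open[of "{..<0}" x] less in
        \<open>auto simp: flat_def elim!: eventually_mono\<close>)
  then show ?thesis using less by (simp add: flat_def)
next
  case greater
  have d: "((\<lambda>x. poly p (1/x) * exp (-1/x)) has_real_derivative
      flat ([:0, 0, 1:] * (p - pderiv p)) x) (at x)"
    using greater
    by (auto intro!: derivative_eq_intros poly_DERIV[THEN DERIV_chain2]
        simp: flat_def field_simps power2_eq_square)
  have "\<forall>\<^sub>F x in nhds x. flat p x = poly p (1/x) * exp (-1/x)"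
    using eventually_nhds_in_open[of "{0<..}" x] greater
    by (auto simp: flat_def elim!: eventually_mono)
  from DERIV_cong_ev[OF refl this refl] show ?thesis using d by blast
next
  case equal
  \<comment> \<open>Dividing by h multiplies the polynomial in 1/h by its variable, so the
    difference quotient at 0 has the decaying form again, with \<open>pCons 0 p\<close>.\<close>
  have "((\<lambda>h. flat p h / h) \<longlongrightarrow> 0) (at_right 0)"
    by (rule Lim_transform_eventually[OF poly_times_exp_tendsto_0[of "pCons 0 p"]])
      (auto simp: eventually_at_filter flat_def)
  moreover have "((\<lambda>h. flat p h / h) \<longlongrightarrow> 0) (at_left 0)"
    by (rule Lim_transform_eventually[OF tendsto_const])
      (auto simp: eventually_at_filter flat_def)
  ultimately have "((\<lambda>h. flat p h / h) \<longlongrightarrow> 0) (at 0)"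
    using filterlim_split_at by blast
  then show ?thesis by (simp add: equal DERIV_def flat_def)
qed

lemma smooth_flat: "smooth (flat p)"
  by (rule smooth_family[of "range flat"]) (use flat_has_derivative in blast)+

text \<open>The usual quotient of flat functions. It is 1 for all s up to 1/4, negative s included,
  and 0 from 1 on. Composed with a square it is a bump, composed with t / \<tau> a descent in
  time.\<close>

definition cutoff :: "real \<Rightarrow> real" where
  "cutoff s = flat 1 (1 - s) * inverse (flat 1 (1 - s) + flat 1 (s - 1/4))"

lemma flat_1_nonneg: "flat 1 x \<ge> 0" and flat_1_pos: "x > 0 \<Longrightarrow> flat 1 x > 0"
  by (simp_all add: flat_def)

lemma cutoff_denominator_pos: "flat 1 (1 - s) + flat 1 (s - 1/4) > 0"
proof (cases "s < 1")
  case True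
  then show ?thesis by (intro add_pos_nonneg flat_1_nonneg flat_1_pos) auto
next
  case False
  then show ?thesis by (intro add_nonneg_pos flat_1_nonneg flat_1_pos) auto
qed

lemma smooth_cutoff: "smooth cutoff"
  unfolding cutoff_def using cutoff_denominator_pos
  by (intro smooth_mult smooth_inverse smooth_add smooth_compose[OF smooth_flat] smooth_diff
      smooth_const smooth_ident) (metis less_irrefl)

lemma cutoff_eq_1: "s \<le> 1/4 \<Longrightarrow> cutoff s = 1"
  using cutoff_denominator_pos[of s] by (simp add: cutoff_def flat_def)

lemma cutoff_eq_0: "s \<ge> 1 \<Longrightarrow> cutoff s = 0"
  by (simp add: cutoff_def flat_def)

lemma cutoff_nonneg: "cutoff s \<ge> 0"
  using cutoff_denominator_pos[of s] flat_1_nonneg by (simp add: cutoff_def)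

lemma cutoff_le_1: "cutoff s \<le> 1"
  using cutoff_denominator_pos[of s] flat_1_nonneg[of "s - 1/4"]
  by (simp add: cutoff_def divide_simps flip: divide_inverse)

lemma deriv_iter_eq_0_open:
  fixes f :: "real \<Rightarrow> real"
  assumes "open S" "\<And>x. x \<in> S \<Longrightarrow> f x = 0" "x \<in> S"
  shows "(deriv ^^ n) f x = 0"
  using assms(3)
proof (induction n arbitrary: x)
  case 0
  then show ?case using assms by simp
next
  case (Suc n)
  have "\<forall>\<^sub>F y in nhds x. (deriv ^^ n) f y = 0"
    using eventually_nhds_in_open[OF assms(1) Suc.prems] by eventually_elim (rule Suc.IH)
  from DERIV_cong_ev[OF refl this refl] have "((deriv ^^ n) f has_real_derivative 0) (at x)"
    using DERIV_const by blast
  then show ?case by (simp add: DERIV_imp_deriv)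
qed

text \<open>\<open>cutoff\<close> is locally constant on both open sets. The order is
  \<open>Suc n\<close> because the constant on the left is 1.\<close>

lemma deriv_iter_cutoff_eq_0:
  assumes "s < 1/4 \<or> s > 1"
  shows "(deriv ^^ Suc n) cutoff s = 0"
proof -
  let ?S = "{..<1/4} \<union> {1<..} :: real set"
  have "deriv cutoff s = 0" if "s \<in> ?S" for s
  proof -
    from that have "\<exists>c. \<forall>\<^sub>F x in nhds s. cutoff x = c"
    proof
      assume "s \<in> {..<1/4}"
      from eventually_nhds_in_open[OF open_lessThan this] show ?thesis
        by (intro exI[of _ 1]) (auto elim!: eventually_mono simp: cutoff_eq_1)
    next
      assume "s \<in> {1<..}"
      from eventually_nhds_in_open[OF open_greaterThan this] show ?thesis
        by (intro exI[of _ 0]) (auto elim!: eventually_mono simp: cutoff_eq_0)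
    qed
    then obtain c where "\<forall>\<^sub>F x in nhds s. cutoff x = c" by blast
    from DERIV_cong_ev[OF refl this refl] have "(cutoff has_real_derivative 0) (at s)"
      using DERIV_const by blast
    then show ?thesis by (rule DERIV_imp_deriv)
  qed
  then have "(deriv ^^ n) (deriv cutoff) s = 0"
    using assms by (intro deriv_iter_eq_0_open[of ?S]) auto
  then show ?thesis by (simp add: funpow_swap1)
qed

lemma continuous_bounded_of_support:
  fixes f :: "real \<Rightarrow> real"
  assumes "continuous_on UNIV f" "\<And>x. f x \<noteq> 0 \<Longrightarrow> x \<in> {a..b}"
  obtains B where "B \<ge> 0" "\<And>x. \<bar>f x\<bar> \<le> B"
proof -
  have "compact (f ` {a..b})"
    using assms(1) by (intro compact_continuous_image) (auto intro: continuous_on_subset)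
  then obtain B where B: "\<And>x. x \<in> {a..b} \<Longrightarrow> \<bar>f x\<bar> \<le> B"
    using compact_imp_bounded bounded_iff by (metis imageI real_norm_def)
  show thesis
  proof (rule that[of "max B 0"])
    show "\<bar>f x\<bar> \<le> max B 0" for x using B[of x] assms(2)[of x] by fastforce
  qed simp
qed

lemma deriv_iter_cutoff_bounded:
  obtains B where "B \<ge> 0" "\<And>s. \<bar>(deriv ^^ Suc n) cutoff s\<bar> \<le> B"
proof (rule continuous_bounded_of_support)
  show "continuous_on UNIV ((deriv ^^ Suc n) cutoff)"
    using smooth_cutoff smooth_continuous_on smooth_deriv_iter by blast
  show "s \<in> {1/4..1}" if "(deriv ^^ Suc n) cutoff s \<noteq> 0" for s
  proof -
    from that have "\<not> (s < 1/4 \<or> s > 1)" using deriv_iter_cutoff_eq_0 by blast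
    then show ?thesis by auto
  qed
qed (use that in blast)

section \<open>Directional derivatives by one-variable calculus, and periodic test functions\<close>

lemma dir_deriv_along:
  assumes "f differentiable (at z)"
  shows "((\<lambda>r. f (z + r *\<^sub>R e)) has_real_derivative dir_deriv e f z) (at 0)"
proof -
  let ?D = "frechet_derivative f (at z)"
  have D: "(f has_derivative ?D) (at (z + 0 *\<^sub>R e))"
    using assms(1) by (simp flip: frechet_derivative_works)
  have "((\<lambda>r. z + r *\<^sub>R e) has_derivative (\<lambda>r. r *\<^sub>R e)) (at 0)"
    by (auto intro!: derivative_eq_intros)
  from diff_chain_at[OF this D]
  have "((\<lambda>r. f (z + r *\<^sub>R e)) has_derivative (\<lambda>r. ?D (r *\<^sub>R e))) (at 0)"
    by (simp add: o_def)
  moreover have "?D (r *\<^sub>R e) = ?D e * r" for r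
    using D has_derivative_linear linear_scale by fastforce
  ultimately show ?thesis
    by (simp add: has_field_derivative_def dir_deriv_def)
qed

text \<open>Once smoothness provides differentiability, uniqueness of derivatives reduces a
  directional derivative to a one-variable computation.\<close>

lemma dir_deriv_partial:
  assumes "f differentiable (at z)"
    and "((\<lambda>r. f (z + r *\<^sub>R e)) has_real_derivative d) (at 0)"
  shows "dir_deriv e f z = d"
  using dir_deriv_along[OF assms(1)] assms(2) DERIV_unique by blast

lemma dir_deriv_eq_0_open:
  assumes "open S" "z \<in> S" "\<And>w. w \<in> S \<Longrightarrow> f w = 0"
  shows "dir_deriv e f z = 0"
proof -
  have "(f has_derivative (\<lambda>_. 0)) (at z)"
    using has_derivative_transform_within_open[OF has_derivative_const assms(1,2), of 0 f] assms(3)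
    by simp
  then show ?thesis using dir_deriv_eqI by blast
qed

lemma shift_DERIV:
  "((\<lambda>r. f (a + r)) has_real_derivative d) (at 0) \<longleftrightarrow> (f has_real_derivative d) (at (a::real))"
  using DERIV_shift[of f d 0 a] by (simp add: add.commute)

lemma DERIV_fst_xy:
  "smooth f \<Longrightarrow> ((\<lambda>x. f (x, y)) has_real_derivative dir_deriv (1, 0) f (x, y)) (at x)"
  and DERIV_snd_xy:
  "smooth f \<Longrightarrow> ((\<lambda>y. f (x, y)) has_real_derivative dir_deriv (0, 1) f (x, y)) (at y)"
  for f :: "real \<times> real \<Rightarrow> real"
  using dir_deriv_along[OF smooth_differentiable, of f "(x, y)" "(1, 0)"]
    dir_deriv_along[OF smooth_differentiable, of f "(x, y)" "(0, 1)"]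
    shift_DERIV[of "\<lambda>x. f (x, y)" x] shift_DERIV[of "\<lambda>y. f (x, y)" y]
  by auto

lemma dir_deriv_txy:
  fixes f :: "real \<times> real \<times> real \<Rightarrow> real"
  assumes "smooth f"
  shows "((\<lambda>t. f (t, x, y)) has_real_derivative d) (at t) \<Longrightarrow> dir_deriv (1, 0, 0) f (t, x, y) = d"
    and "((\<lambda>x. f (t, x, y)) has_real_derivative d) (at x) \<Longrightarrow> dir_deriv (0, 1, 0) f (t, x, y) = d"
    and "((\<lambda>y. f (t, x, y)) has_real_derivative d) (at y) \<Longrightarrow> dir_deriv (0, 0, 1) f (t, x, y) = d"
  using assms
  by (auto intro!: dir_deriv_partial smooth_differentiable simp: shift_DERIV
      shift_DERIV[of "\<lambda>t. f (t, x, y)"] shift_DERIV[of "\<lambda>x. f (t, x, y)"]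
      shift_DERIV[of "\<lambda>y. f (t, x, y)"])

text \<open>A factor for test functions: the support condition is left to the function that it
  multiplies.\<close>

definition x_periodic :: "(real \<times> real \<Rightarrow> real) \<Rightarrow> bool" where
  "x_periodic f \<longleftrightarrow> smooth f \<and> (\<forall>x y. f (x + 2*pi, y) = f (x, y))"

lemma x_periodic_dir_deriv:
  assumes "x_periodic f"
  shows "x_periodic (dir_deriv e f)"
proof -
  have s: "smooth f" and p: "\<And>x y. f (x + 2*pi, y) = f (x, y)"
    using assms by (auto simp: x_periodic_def)
  have D: "((\<lambda>r. f (z + r *\<^sub>R e)) has_real_derivative dir_deriv e f z) (at 0)" for z
    by (rule dir_deriv_along[OF smooth_differentiable[OF s]])
  have "f ((x + 2*pi, y) + r *\<^sub>R e) = f ((x, y) + r *\<^sub>R e)" for x y r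
    using p[of "x + r * fst e" "y + r * snd e"] by (cases e) (simp add: algebra_simps)
  then have "dir_deriv e f (x + 2*pi, y) = dir_deriv e f (x, y)" for x y
    using D[of "(x + 2*pi, y)"] D[of "(x, y)"] DERIV_unique by auto
  then show ?thesis using s by (simp add: x_periodic_def smooth_dir_deriv)
qed

lemma test_xy_dir_deriv:
  assumes "\<phi> \<in> test_xy"
  shows "dir_deriv e \<phi> \<in> test_xy"
proof -
  obtain c d where c: "0 < c" and cd: "\<And>x y. \<phi> (x, y) \<noteq> 0 \<Longrightarrow> y \<in> {c..d}"
    using assms by (auto simp: test_xy_def)
  have "x_periodic \<phi>" using assms by (simp add: test_xy_def x_periodic_def)
  then have "x_periodic (dir_deriv e \<phi>)" by (rule x_periodic_dir_deriv)
  moreover have "y \<in> {c..d}" if "dir_deriv e \<phi> (x, y) \<noteq> 0" for x y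
  proof (rule ccontr)
    assume "y \<notin> {c..d}"
    moreover have "open (UNIV \<times> (- {c..d}))" by (intro open_Times) auto
    ultimately have "dir_deriv e \<phi> (x, y) = 0"
      by (intro dir_deriv_eq_0_open[of "UNIV \<times> (- {c..d})"]) (use cd in fastforce)+
    with that show False by simp
  qed
  ultimately show ?thesis using c by (auto simp: test_xy_def x_periodic_def)
qed

section \<open>Integration on the half cylinder\<close>

lemma sets_torus [measurable_cong]: "sets torus = sets (restrict_space borel {0..<2*pi})"
  and sets_halfline [measurable_cong]: "sets halfline = sets (restrict_space borel {0<..})"
  and sets_time [measurable_cong]: "sets (time T) = sets (restrict_space borel {0<..<T})"
  by (simp_all add: torus_def halfline_def time_def sets_restrict_space)

lemma space_torus: "space torus = {0..<2*pi}"
  and space_halfline: "space halfline = {0<..}"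
  and space_time_interval: "space (time T) = {0<..<T}"
  by (simp_all add: torus_def halfline_def time_def space_restrict_space)

lemma sets_half_cylinder [measurable_cong]: "sets half_cylinder = sets (torus \<Otimes>\<^sub>M halfline)"
  and sets_space_time [measurable_cong]: "sets (space_time T) = sets (time T \<Otimes>\<^sub>M (torus \<Otimes>\<^sub>M halfline))"
  by (simp_all add: half_cylinder_def space_time_def)

lemma id_measurable_interval:
  "(\<lambda>x. x) \<in> borel_measurable torus" "(\<lambda>y. y) \<in> borel_measurable halfline"
  "(\<lambda>t. t) \<in> borel_measurable (time T)"
  by (simp_all add: torus_def halfline_def time_def measurable_restrict_space1)

lemma emeasure_torus: "emeasure torus (space torus) = ennreal (2*pi)"
  and emeasure_time: "T > 0 \<Longrightarrow> emeasure (time T) (space (time T)) = ennreal T"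
  by (simp_all add: torus_def time_def space_restrict_space emeasure_restrict_space)

interpretation torus: finite_measure torus
  by standard (simp add: emeasure_torus)

interpretation halfline: sigma_finite_measure halfline
  unfolding halfline_def
  by (rule sigma_finite_measure_restrict_space) (auto intro: lborel.sigma_finite_measure_axioms)

interpretation half_cylinder: pair_sigma_finite torus halfline ..

interpretation hc: sigma_finite_measure half_cylinder
  unfolding half_cylinder_def
  by (rule half_cylinder.sigma_finite_measure_axioms)

lemma time_finite: "finite_measure (time T)"
  by standard (cases "0 \<le> T"; simp add: time_def space_restrict_space emeasure_restrict_space)

interpretation time: finite_measure "time T" for T
  by (rule time_finite)

interpretation space_time: pair_sigma_finite "time T" half_cylinder for T ..

text \<open>\<open>half_cylinder\<close> carries a product of restricted sigma-algebras, not the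
  Borel sets of the plane. Measurability of the identity between the two transfers Borel
  functions.\<close>

lemma continuous_borel_measurable:
  fixes f :: "real \<times> real \<Rightarrow> 'b::topological_space"
  assumes "continuous_on UNIV f"
  shows "f \<in> borel_measurable half_cylinder"
proof -
  have "f \<in> borel_measurable borel" using assms by (rule borel_measurable_continuous_onI)
  moreover have "(\<lambda>z. z) \<in> measurable half_cylinder borel"
  proof -
    have "(\<lambda>z. (fst z, snd z)) \<in> measurable half_cylinder (borel \<Otimes>\<^sub>M borel)"
      unfolding half_cylinder_def
      by (intro measurable_Pair measurable_compose[OF measurable_fst id_measurable_interval(1)]
          measurable_compose[OF measurable_snd id_measurable_interval(2)])
    then show ?thesis by (simp add: borel_prod)
  qed
  ultimately show ?thesis by (rule measurable_compose_rev)
qed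

lemma continuous_borel_measurable_txy:
  fixes f :: "real \<times> real \<times> real \<Rightarrow> 'b::topological_space"
  assumes "continuous_on UNIV f"
  shows "f \<in> borel_measurable (space_time T)"
proof -
  have "f \<in> borel_measurable borel" using assms by (rule borel_measurable_continuous_onI)
  moreover have "(\<lambda>z. z) \<in> measurable (space_time T) borel"
  proof -
    have "(\<lambda>z. (fst z, snd z)) \<in> measurable (space_time T) (borel \<Otimes>\<^sub>M borel)"
      unfolding space_time_def
      by (intro measurable_Pair measurable_compose[OF measurable_fst id_measurable_interval(3)]
          measurable_compose[OF measurable_snd continuous_borel_measurable] continuous_on_id)
    then show ?thesis by (simp add: borel_prod)
  qed
  ultimately show ?thesis by (rule measurable_compose_rev)
qed

text \<open>The torus being bounded, a bound on y alone gives finite measure. The functions that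
  \<open>u\<close> and the datum are paired with vanish for large y, hence off a strip.\<close>

definition strip :: "real \<Rightarrow> (real \<times> real) set" where
  "strip d = {0..<2*pi} \<times> {0<..d}"

lemma strip_sets: "strip d \<in> sets half_cylinder" 
  and strip_finite: "emeasure half_cylinder (strip d) < \<infinity>"
proof -
  have t: "{0..<2*pi} \<in> sets torus" using sets.top[of torus] by (simp add: space_torus)
  have h: "{0<..d} \<in> sets halfline" by (auto simp: halfline_def sets_restrict_space_iff)
  show "strip d \<in> sets half_cylinder"
    using t h by (auto simp: strip_def half_cylinder_def)
  have "emeasure half_cylinder (strip d) = emeasure torus {0..<2*pi} * emeasure halfline {0<..d}"
    unfolding half_cylinder_def strip_def by (rule halfline.emeasure_pair_measure_Times[OF t h])
  moreover have "emeasure halfline {0<..d} \<le> ennreal (max d 0)"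
    by (cases "0 \<le> d") (simp_all add: halfline_def emeasure_restrict_space subset_iff max_def)
  ultimately have "emeasure half_cylinder (strip d) \<le> ennreal (2*pi) * ennreal (max d 0)"
    using emeasure_torus by (simp add: space_torus mult_left_mono)
  then show "emeasure half_cylinder (strip d) < \<infinity>"
    by (metis ennreal_less_top ennreal_mult_less_top infinity_ennreal_def order_le_less_trans)
qed

lemma integrable_strip:
  fixes f :: "real \<times> real \<Rightarrow> 'b::{banach, second_countable_topology}"
  assumes "f \<in> borel_measurable half_cylinder"
    and "\<And>x y. x \<in> {0..<2*pi} \<Longrightarrow> y > 0 \<Longrightarrow> norm (f (x, y)) \<le> B"
    and "\<And>x y. x \<in> {0..<2*pi} \<Longrightarrow> y > d \<Longrightarrow> f (x, y) = 0"
  shows "integrable half_cylinder f"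
proof (rule integrableI_bounded_set[where A="strip d" and B=B])
  show "AE z\<in>strip d in half_cylinder. norm (f z) \<le> B"
    by (rule AE_I2) (use assms(2) in \<open>auto simp: strip_def\<close>)
  have "f z = 0" if "z \<in> space half_cylinder" "z \<notin> strip d" for z
    using that assms(3)[of "fst z" "snd z"]
    by (cases z)
      (auto simp: strip_def half_cylinder_def space_pair_measure space_torus space_halfline not_le)
  then show "AE z in half_cylinder. z \<notin> strip d \<longrightarrow> f z = 0" by (auto intro: AE_I2)
qed (use assms strip_sets strip_finite in auto)

lemma ddist_apply: "ddist e F \<phi> = - F (dir_deriv e \<phi>)"
  by (simp add: ddist_def)

lemma test_xy_cylinder:
  assumes "\<phi> \<in> test_xy"
  obtains d where "d > 0" "\<And>x y. y > d \<Longrightarrow> \<phi> (x, y) = 0"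
proof -
  obtain c d where cd: "\<And>x y. \<phi> (x, y) \<noteq> 0 \<Longrightarrow> y \<in> {c..d}"
    using assms by (auto simp: test_xy_def)
  have "\<phi> (x, y) = 0" if "y > max d 1" for x y
    using cd[of x y] that by force
  then show thesis by (intro that[of "max d 1"]) auto
qed

lemma integrable_test_xy:
  assumes "\<phi> \<in> test_xy"
  shows "integrable half_cylinder \<phi>"
proof -
  obtain d where d: "\<And>x y. y > d \<Longrightarrow> \<phi> (x, y) = 0"
    using test_xy_cylinder[OF assms] by metis
  have cont: "continuous_on S \<phi>" for S
    using assms smooth_continuous_on by (auto simp: test_xy_def)
  have "compact (\<phi> ` ({0..2*pi} \<times> {0..d}))"
    by (intro compact_continuous_image cont compact_Times compact_Icc)
  then obtain B where B: "\<And>z. z \<in> {0..2*pi} \<times> {0..d} \<Longrightarrow> norm (\<phi> z) \<le> B"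
    using compact_imp_bounded bounded_iff by (metis imageI)
  show ?thesis
  proof (rule integrable_strip[where B="max B 0" and d=d])
    show "norm (\<phi> (x, y)) \<le> max B 0" if "x \<in> {0..<2*pi}" "y > 0" for x y
      using B[of "(x, y)"] d[of y x] that by (cases "y \<le> d") auto
  qed (use d cont continuous_borel_measurable in auto)
qed

text \<open>\<open>S\<close> and the closed interval may differ at the two endpoints, a null set:
  the torus lacks 2 pi, the half-line and the time interval lack 0.\<close>

lemma integral_restrict_space_FTC:
  assumes G: "\<And>y. (G has_real_derivative g y) (at y)" "continuous_on UNIV g"
    and S: "S \<in> sets borel" "{a<..<b} \<subseteq> S" "a \<le> b"
    and supp: "\<And>y. y \<in> S \<Longrightarrow> y \<notin> {a..b} \<Longrightarrow> g y = 0"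
  shows "(\<integral>y. g y \<partial>restrict_space lborel S) = G b - G a"
proof -
  have "(\<integral>y. g y \<partial>restrict_space lborel S) = (\<integral>y. indicator S y *\<^sub>R g y \<partial>lborel)"
    using S(1) by (simp add: integral_restrict_space)
  also have "\<dots> = (\<integral>y. g y * indicator {a..b} y \<partial>lborel)"
  proof (rule integral_cong_AE)
    have [measurable]: "g \<in> borel_measurable borel" "S \<in> sets borel"
      using G(2) S(1) by (auto intro: borel_measurable_continuous_onI)
    show "(\<lambda>y. indicator S y *\<^sub>R g y) \<in> borel_measurable lborel"
      "(\<lambda>y. g y * indicator {a..b} y) \<in> borel_measurable lborel" by measurable
    show "AE y in lborel. indicator S y *\<^sub>R g y = g y * indicator {a..b} y"
      using AE_lborel_singleton[of a] AE_lborel_singleton[of b]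
    proof eventually_elim
      case (elim y)
      then have "y \<in> S" if "y \<in> {a..b}" using that S(2) by auto
      then show ?case using supp[of y] by (auto simp: indicator_def)
    qed
  qed
  also have "\<dots> = G b - G a"
    using G S(3) by (intro integral_FTC_Icc_real) (auto simp: continuous_on_eq_continuous_at)
  finally show ?thesis .
qed

lemma integral_torus_FTC:
  assumes "\<And>x. (G has_real_derivative g x) (at x)" "continuous_on UNIV g"
  shows "(\<integral>x. g x \<partial>torus) = G (2*pi) - G 0"
  unfolding torus_def by (rule integral_restrict_space_FTC[OF assms]) auto

lemma integral_halfline_FTC:
  assumes "\<And>y. (G has_real_derivative g y) (at y)" "continuous_on UNIV g"
    and "\<And>y. y > d \<Longrightarrow> g y = 0" "0 \<le> d"
  shows "(\<integral>y. g y \<partial>halfline) = G d - G 0"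
  unfolding halfline_def by (rule integral_restrict_space_FTC[OF assms(1,2)]) (use assms in auto)

lemma continuous_on_slice:
  assumes "smooth f"
  shows "continuous_on S (\<lambda>x. f (x, y))" "continuous_on S (\<lambda>y. f (x, y))"
  by (rule continuous_on_compose2[OF smooth_continuous_on[OF assms, of UNIV]];
      auto intro!: continuous_intros)+

text \<open>The endpoint values cancel by periodicity in x; in y they vanish, the support being away
  from the wall and from infinity.\<close>

lemma integral_dir_deriv_test_xy:
  assumes "\<phi> \<in> test_xy" "e \<in> {(1, 0), (0, 1)}"
  shows "(\<integral>z. dir_deriv e \<phi> z \<partial>half_cylinder) = 0"
proof -
  note t = test_xy_dir_deriv[OF assms(1)]
  have s: "smooth \<phi>" using assms by (simp add: test_xy_def)
  have int: "integrable (torus \<Otimes>\<^sub>M halfline) (dir_deriv e \<phi>)"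
    using integrable_test_xy[OF t] by (simp add: half_cylinder_def)
  consider "e = (1, 0)" | "e = (0, 1)" using assms(2) by auto
  then show ?thesis
  proof cases
    case 1
    have "(\<integral>x. dir_deriv (1, 0) \<phi> (x, y) \<partial>torus) = 0" for y
    proof -
      have "\<phi> (2*pi, y) = \<phi> (0, y)" using assms(1) by (auto simp: test_xy_def) (metis add.left_neutral)
      then show ?thesis
        by (subst integral_torus_FTC[OF DERIV_fst_xy[OF s]])
          (auto intro!: continuous_on_slice smooth_dir_deriv s)
    qed
    then show ?thesis
      using half_cylinder.integral_snd[of "\<lambda>x y. dir_deriv e \<phi> (x, y)"] int by (simp add: 1 half_cylinder_def)
  next
    case 2
    obtain d where d: "d > 0" "\<And>x y. y > d \<Longrightarrow> dir_deriv (0, 1) \<phi> (x, y) = 0"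
      using test_xy_cylinder[OF t] 2 by metis
    obtain c where c: "c > 0" "\<And>x y. \<phi> (x, y) \<noteq> 0 \<Longrightarrow> y \<ge> c"
      using assms(1) by (auto simp: test_xy_def)
    obtain d' where d': "d' > 0" "\<And>x y. y > d' \<Longrightarrow> \<phi> (x, y) = 0"
      using test_xy_cylinder[OF assms(1)] by metis
    have "(\<integral>y. dir_deriv (0, 1) \<phi> (x, y) \<partial>halfline) = 0" for x
    proof -
      \<comment> \<open>The upper limit lies beyond the supports of both \<phi> and its derivative;
        the \<open>+ 1\<close> supplies the strict inequality under which \<phi> is known to
        vanish.\<close>
      have "(\<integral>y. dir_deriv (0, 1) \<phi> (x, y) \<partial>halfline) = \<phi> (x, max d (d' + 1)) - \<phi> (x, 0)"
        using d d'(1) by (intro integral_halfline_FTC[OF DERIV_snd_xy[OF s]])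
          (auto intro!: continuous_on_slice smooth_dir_deriv s)
      also have "\<phi> (x, 0) = 0" using c by force
      also have "\<phi> (x, max d (d' + 1)) = 0" using d' by auto
      finally show ?thesis by simp
    qed
    then show ?thesis
      using half_cylinder.integral_fst'[OF int] by (simp add: 2 half_cylinder_def)
  qed
qed

lemma dir_deriv_mult:
  "smooth f \<Longrightarrow> smooth g \<Longrightarrow>
    dir_deriv e (\<lambda>z. f z * g z) z = f z * dir_deriv e g z + dir_deriv e f z * g z"
  by (subst dir_deriv_eqI[OF has_derivative_mult])
    (auto simp: dir_deriv_def smooth_differentiable simp flip: frechet_derivative_works)

lemma test_xy_mult:
  "x_periodic f \<Longrightarrow> \<phi> \<in> test_xy \<Longrightarrow> (\<lambda>z. f z * \<phi> z) \<in> test_xy"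
  unfolding test_xy_def x_periodic_def by (auto intro!: smooth_mult) blast

text \<open>The product of \<open>f\<close> with a test function is a test function, so its
  derivative integrates to zero, and Leibniz splits that derivative.\<close>

lemma integral_by_parts_test_xy:
  assumes f: "x_periodic f" and \<phi>: "\<phi> \<in> test_xy" and e: "e \<in> {(1, 0), (0, 1)}"
    and f': "x_periodic (dir_deriv e f)"
  shows "(\<integral>z. f z * dir_deriv e \<phi> z \<partial>half_cylinder) = - (\<integral>z. dir_deriv e f z * \<phi> z \<partial>half_cylinder)"
proof -
  have "smooth f" "smooth \<phi>" using f \<phi> by (auto simp: x_periodic_def test_xy_def)
  then have "(\<integral>z. f z * dir_deriv e \<phi> z + dir_deriv e f z * \<phi> z \<partial>half_cylinder) = 0"
    using integral_dir_deriv_test_xy[OF test_xy_mult[OF f \<phi>] e] by (simp add: dir_deriv_mult)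
  then show ?thesis
    using integrable_test_xy[OF test_xy_mult[OF f test_xy_dir_deriv[OF \<phi>, of e]]]
      integrable_test_xy[OF test_xy_mult[OF f' \<phi>]] by simp
qed

section \<open>Series of smooth functions as elements of Sobolev spaces\<close>

lemma sums_integral_bounded:
  fixes \<psi> :: "'a \<Rightarrow> 'b::{banach, second_countable_topology}"
  assumes [measurable]: "\<And>n. f n \<in> borel_measurable M" and \<psi>: "integrable M \<psi>"
    and B: "summable B" "\<And>n z. \<bar>f n z\<bar> \<le> B n"
  shows "(\<lambda>n. \<integral>z. f n z *\<^sub>R \<psi> z \<partial>M) sums (\<integral>z. (\<Sum>n. f n z) *\<^sub>R \<psi> z \<partial>M)"
proof -
  have [measurable]: "\<psi> \<in> borel_measurable M" using \<psi> by simp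
  have sf: "summable (\<lambda>n. f n z)" for z
    by (rule summable_rabs_cancel, rule summable_comparison_test'[OF B(1), of 0]) (simp add: B(2))
  have B0: "B n \<ge> 0" for n using B(2)[of n undefined] by linarith
  have int: "integrable M (\<lambda>z. f n z *\<^sub>R \<psi> z)" for n
    by (rule Bochner_Integration.integrable_bound[of M "\<lambda>z. B n *\<^sub>R \<psi> z"])
      (use \<psi> B B0 in \<open>auto intro!: mult_right_mono\<close>)
  have "(\<lambda>n. \<integral>z. f n z *\<^sub>R \<psi> z \<partial>M) sums (\<integral>z. (\<Sum>n. f n z *\<^sub>R \<psi> z) \<partial>M)"
  proof (rule sums_integral[OF int])
    have "summable (\<lambda>n. \<bar>f n z\<bar> * norm (\<psi> z))" for z
      by (rule summable_mult2, rule summable_comparison_test'[OF B(1), of 0]) (simp add: B(2))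
    then show "AE z in M. summable (\<lambda>n. norm (f n z *\<^sub>R \<psi> z))" by simp
    show "summable (\<lambda>n. \<integral>z. norm (f n z *\<^sub>R \<psi> z) \<partial>M)"
    proof (rule summable_comparison_test'[where N=0])
      show "summable (\<lambda>n. B n * (\<integral>z. norm (\<psi> z) \<partial>M))" by (intro summable_mult2 B)
      show "norm (\<integral>z. norm (f n z *\<^sub>R \<psi> z) \<partial>M) \<le> B n * (\<integral>z. norm (\<psi> z) \<partial>M)" for n
      proof -
        have "(\<integral>z. norm (f n z *\<^sub>R \<psi> z) \<partial>M) \<le> (\<integral>z. B n * norm (\<psi> z) \<partial>M)"
          using integrable_norm[OF int[of n]] \<psi> B
          by (intro integral_mono) (auto intro!: mult_right_mono)
        then show ?thesis by (simp add: integral_nonneg_AE)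
      qed
    qed
  qed
  moreover have "(\<Sum>n. f n z) *\<^sub>R \<psi> z = (\<Sum>n. f n z *\<^sub>R \<psi> z)" for z
    by (rule suminf_scaleR_left[OF sf])
  ultimately show ?thesis by simp
qed

text \<open>Integration by parts holds term by term, and the summable uniform bounds let sum and
  integral be exchanged on both sides. Differentiability of the sum itself never enters.\<close>

lemma dist_of_series_dir_deriv:
  assumes F: "\<And>n. x_periodic (F n)" and \<phi>: "\<phi> \<in> test_xy" and e: "e \<in> {(1, 0), (0, 1)}"
    and B: "summable B" "\<And>n z. \<bar>F n z\<bar> \<le> B n"
    and B': "summable B'" "\<And>n z. \<bar>dir_deriv e (F n) z\<bar> \<le> B' n"
  shows "ddist e (dist_of half_cylinder (\<lambda>z. \<Sum>n. F n z)) \<phi>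
    = dist_of half_cylinder (\<lambda>z. \<Sum>n. dir_deriv e (F n) z) \<phi>"
proof -
  have meas: "f \<in> borel_measurable half_cylinder" if "x_periodic f" for f
    using that smooth_continuous_on continuous_borel_measurable by (auto simp: x_periodic_def)
  have 1: "(\<lambda>n. \<integral>z. F n z * dir_deriv e \<phi> z \<partial>half_cylinder)
      sums (\<integral>z. (\<Sum>n. F n z) * dir_deriv e \<phi> z \<partial>half_cylinder)"
    using sums_integral_bounded[OF meas[OF F] integrable_test_xy[OF test_xy_dir_deriv[OF \<phi>]] B]
    by simp
  have 2: "(\<lambda>n. \<integral>z. dir_deriv e (F n) z * \<phi> z \<partial>half_cylinder)
      sums (\<integral>z. (\<Sum>n. dir_deriv e (F n) z) * \<phi> z \<partial>half_cylinder)"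
    using sums_integral_bounded[OF meas[OF x_periodic_dir_deriv[OF F]] integrable_test_xy[OF \<phi>] B']
    by simp
  from sums_minus[OF 2]
  have "(\<lambda>n. \<integral>z. F n z * dir_deriv e \<phi> z \<partial>half_cylinder)
      sums - (\<integral>z. (\<Sum>n. dir_deriv e (F n) z) * \<phi> z \<partial>half_cylinder)"
    by (simp add: integral_by_parts_test_xy[OF F \<phi> e x_periodic_dir_deriv[OF F]])
  from sums_unique2[OF 1 this] show ?thesis
    by (simp add: ddist_def dist_of_def)
qed

text \<open>Each mixed distributional derivative is the series \<open>S i j\<close> of the classical
  ones, which is bounded by \<open>suminf (B i j)\<close> and supported in a strip, hence in
  \<open>L2\<close>.\<close>

lemma Sobolev_inf_series:
  assumes F: "\<And>n. x_periodic (F n)"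
    and supp: "\<And>n i j x y. y > d \<Longrightarrow> (dir_deriv (1, 0) ^^ i) ((dir_deriv (0, 1) ^^ j) (F n)) (x, y) = 0"
    and B: "\<And>i j. summable (B i j)"
      "\<And>i j n z. \<bar>(dir_deriv (1, 0) ^^ i) ((dir_deriv (0, 1) ^^ j) (F n)) z\<bar> \<le> B i j n"
  shows "(\<lambda>z. \<Sum>n. F n z) \<in> Sobolev_inf"
proof -
  define D where "D i j n = (dir_deriv (1, 0) ^^ i) ((dir_deriv (0, 1) ^^ j) (F n))" for i j n
  define S where "S i j z = (\<Sum>n. D i j n z)" for i j z
  have it: "x_periodic ((dir_deriv e ^^ m) f)" if "x_periodic f" for e m f
    using that by (induction m) (auto intro: x_periodic_dir_deriv)
  have Dp: "x_periodic (D i j n)" for i j n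
    by (simp add: D_def it F)
  have [measurable]: "S i j \<in> borel_measurable half_cylinder" for i j
    unfolding S_def
    by (intro borel_measurable_suminf continuous_borel_measurable smooth_continuous_on)
      (use Dp in \<open>auto simp: x_periodic_def\<close>)
  have Sb: "\<bar>S i j z\<bar> \<le> suminf (B i j)" for i j z
  proof -
    have "summable (\<lambda>n. \<bar>D i j n z\<bar>)"
      by (rule summable_comparison_test'[OF B(1)[of i j], of 0]) (simp add: D_def B(2))
    then have "\<bar>S i j z\<bar> \<le> (\<Sum>n. \<bar>D i j n z\<bar>)" unfolding S_def by (rule summable_rabs)
    also have "\<dots> \<le> suminf (B i j)"
      using \<open>summable (\<lambda>n. \<bar>D i j n z\<bar>)\<close> B by (intro suminf_le) (auto simp: D_def)
    finally show ?thesis .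
  qed
  have L2: "S i j \<in> L2 half_cylinder" for i j
  proof -
    have "integrable half_cylinder (\<lambda>z. (S i j z)\<^sup>2)"
    proof (rule integrable_strip[where B="(suminf (B i j))\<^sup>2" and d=d])
      show "norm ((S i j (x, y))\<^sup>2) \<le> (suminf (B i j))\<^sup>2" for x y
        using power_mono[OF Sb[of i j "(x, y)"], of 2] by simp
      show "(S i j (x, y))\<^sup>2 = 0" if "y > d" for x y
        using supp[OF that] by (simp add: S_def D_def)
    qed simp
    then show ?thesis by (simp add: L2_def)
  qed
  \<comment> \<open>The outermost \<open>ddist\<close> lands on the test function, so the induction
    hypothesis is applied to a derivative of \<phi>. The y-derivatives come first because
    \<open>Sobolev\<close> nests them innermost.\<close>
  have y: "(ddist (0, 1) ^^ j) (dist_of half_cylinder (S 0 0)) \<phi> = dist_of half_cylinder (S 0 j) \<phi>"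
    if "\<phi> \<in> test_xy" for j \<phi> using that
  proof (induction j arbitrary: \<phi>)
    case (Suc j)
    have "(ddist (0, 1) ^^ Suc j) (dist_of half_cylinder (S 0 0)) \<phi>
        = ddist (0, 1) (dist_of half_cylinder (S 0 j)) \<phi>"
      using Suc.IH[OF test_xy_dir_deriv[OF Suc.prems]]
      by (simp only: funpow.simps comp_apply
          ddist_apply[of _ "(ddist (0, 1) ^^ j) (dist_of half_cylinder (S 0 0))"]
          ddist_apply[of _ "dist_of half_cylinder (S 0 j)"])
    also have "\<dots> = dist_of half_cylinder (S 0 (Suc j)) \<phi>"
      using dist_of_series_dir_deriv[of "D 0 j" \<phi> "(0, 1)" "B 0 j" "B 0 (Suc j)"]
        Suc.prems Dp[of 0 j] B(1) B(2)[of 0 j] B(2)[of 0 "Suc j"]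
      by (simp add: S_def[abs_def] D_def)
    finally show ?case .
  qed simp
  have xy: "(ddist (1, 0) ^^ i) ((ddist (0, 1) ^^ j) (dist_of half_cylinder (S 0 0))) \<phi>
      = dist_of half_cylinder (S i j) \<phi>" if "\<phi> \<in> test_xy" for i j \<phi> using that
  proof (induction i arbitrary: \<phi>)
    case 0
    then show ?case using y by simp
  next
    case (Suc i)
    have "(ddist (1, 0) ^^ Suc i) ((ddist (0, 1) ^^ j) (dist_of half_cylinder (S 0 0))) \<phi>
        = ddist (1, 0) (dist_of half_cylinder (S i j)) \<phi>"
      using Suc.IH[OF test_xy_dir_deriv[OF Suc.prems]]
      by (simp only: funpow.simps comp_apply
          ddist_apply[of _ "(ddist (1, 0) ^^ i)
            ((ddist (0, 1) ^^ j) (dist_of half_cylinder (S 0 0)))"]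
          ddist_apply[of _ "dist_of half_cylinder (S i j)"])
    also have "\<dots> = dist_of half_cylinder (S (Suc i) j) \<phi>"
      using dist_of_series_dir_deriv[of "D i j" \<phi> "(1, 0)" "B i j" "B (Suc i) j"]
        Suc.prems Dp B(1) B(2)[of i j] B(2)[of "Suc i" j]
      by (simp add: S_def[abs_def] D_def)
    finally show ?case .
  qed
  have "S 0 0 = (\<lambda>z. \<Sum>n. F n z)" by (simp add: S_def[abs_def] D_def)
  moreover have "S 0 0 \<in> Sobolev_inf"
    unfolding Sobolev_inf_def Sobolev_def using L2 xy by blast
  ultimately show ?thesis by simp
qed

section \<open>Weak formulation\<close>

text \<open>On a set of finite measure the inequality |f| <= f^2 + 1 does the work of
  Cauchy-Schwarz. Later only a bound that is uniform in time matters, not its value.\<close>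

lemma L2_strip:
  assumes "f \<in> L2 half_cylinder"
  shows "integrable half_cylinder (\<lambda>z. indicator (strip d) z * f z)"
    and "(\<integral>z. \<bar>indicator (strip d) z * f z\<bar> \<partial>half_cylinder)
      \<le> (\<integral>z. (f z)\<^sup>2 \<partial>half_cylinder) + measure half_cylinder (strip d)"
proof -
  have [measurable]: "f \<in> borel_measurable half_cylinder"
    and f2: "integrable half_cylinder (\<lambda>z. (f z)\<^sup>2)"
    using assms by (auto simp: L2_def)
  note [measurable] = strip_sets[of d]
  have ind: "integrable half_cylinder (indicator (strip d) :: _ \<Rightarrow> real)"
    using strip_sets strip_finite by simp
  have le: "\<bar>indicator (strip d) z * f z\<bar> \<le> (f z)\<^sup>2 + indicator (strip d) z" for z
  proof -
    \<comment> \<open>The square of |f| - 1/2 being nonnegative gives even f^2 + 1/4.\<close>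
    have "\<bar>f z\<bar> \<le> (f z)\<^sup>2 + 1"
      using zero_le_power2[of "\<bar>f z\<bar> - 1/2"] by (simp add: power2_diff power_divide)
    then show ?thesis by (auto simp: indicator_def)
  qed
  show int: "integrable half_cylinder (\<lambda>z. indicator (strip d) z * f z)"
    by (rule Bochner_Integration.integrable_bound[OF Bochner_Integration.integrable_add[OF f2 ind]])
      (use le in \<open>auto intro: order_trans[OF _ abs_ge_self]\<close>)
  have "(\<integral>z. \<bar>indicator (strip d) z * f z\<bar> \<partial>half_cylinder)
      \<le> (\<integral>z. (f z)\<^sup>2 + indicator (strip d) z \<partial>half_cylinder)"
    using int f2 ind le by (intro integral_mono) auto
  also have "\<dots> = (\<integral>z. (f z)\<^sup>2 \<partial>half_cylinder) + measure half_cylinder (strip d)"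
    using f2 ind strip_sets by (simp add: Int_absorb2 sets.sets_into_space)
  finally show "(\<integral>z. \<bar>indicator (strip d) z * f z\<bar> \<partial>half_cylinder)
      \<le> (\<integral>z. (f z)\<^sup>2 \<partial>half_cylinder) + measure half_cylinder (strip d)" .
qed

text \<open>\<open>K\<close> depends on \<open>u\<close>, \<open>d\<close> and \<open>T\<close>, but
  on no test function: one constant serves all frequencies at the end.\<close>

lemma Linf_L2_strip_bound:
  assumes "u \<in> Linf_L2 T"
  obtains K where "K \<ge> 0"
    "AE t in time T. (\<lambda>z. u (t, z)) \<in> L2 half_cylinder \<and>
      (\<integral>z. \<bar>indicator (strip d) z * u (t, z)\<bar> \<partial>half_cylinder) \<le> K"
proof -
  obtain C where "AE t in time T. (\<lambda>z. u (t, z)) \<in> L2 half_cylinder \<and>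
      (\<integral>z. (u (t, z))\<^sup>2 \<partial>half_cylinder) \<le> C"
    using assms by (auto simp: Linf_L2_def)
  then have "AE t in time T. (\<lambda>z. u (t, z)) \<in> L2 half_cylinder \<and>
      (\<integral>z. \<bar>indicator (strip d) z * u (t, z)\<bar> \<partial>half_cylinder)
        \<le> max (C + measure half_cylinder (strip d)) 0"
  proof eventually_elim
    case (elim t)
    then show ?case using L2_strip(2)[of "\<lambda>z. u (t, z)" d] by linarith
  qed
  then show thesis by (rule that[rotated]) simp
qed

lemma integrable_Linf_L2_strip:
  assumes u: "u \<in> Linf_L2 T"
  shows "integrable (space_time T) (\<lambda>p. indicator (strip d) (snd p) * u p)"
proof (rule integrableI_bounded)
  have [measurable]: "u \<in> borel_measurable (time T \<Otimes>\<^sub>M half_cylinder)"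
    using u by (simp add: Linf_L2_def space_time_def)
  note [measurable] = strip_sets[of d]
  show m: "(\<lambda>p. indicator (strip d) (snd p) * u p) \<in> borel_measurable (space_time T)"
    unfolding space_time_def by measurable
  obtain K where K: "AE t in time T. (\<lambda>z. u (t, z)) \<in> L2 half_cylinder \<and>
      (\<integral>z. \<bar>indicator (strip d) z * u (t, z)\<bar> \<partial>half_cylinder) \<le> K"
    by (rule Linf_L2_strip_bound[OF u])
  have "(\<integral>\<^sup>+ p. ennreal (norm (indicator (strip d) (snd p) * u p)) \<partial>space_time T)
      = (\<integral>\<^sup>+ t. \<integral>\<^sup>+ z. ennreal (norm (indicator (strip d) z * u (t, z))) \<partial>half_cylinder \<partial>time T)"
    unfolding space_time_def by (subst hc.nn_integral_fst[symmetric]) auto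
  also have "\<dots> \<le> (\<integral>\<^sup>+ t. ennreal K \<partial>time T)"
  proof (rule nn_integral_mono_AE)
    show "AE t in time T.
        (\<integral>\<^sup>+ z. ennreal (norm (indicator (strip d) z * u (t, z))) \<partial>half_cylinder) \<le> ennreal K"
      using K
    proof eventually_elim
      case (elim t)
      then show ?case
        using L2_strip(1)[of "\<lambda>z. u (t, z)" d]
        by (subst nn_integral_eq_integral) (auto intro: ennreal_leI)
    qed
  qed
  also have "\<dots> < \<infinity>"
  proof -
    have "emeasure (time T) (space (time T)) < top"
      using time.emeasure_finite[of T] by (metis infinity_ennreal_def less_top)
    then show ?thesis by (simp add: ennreal_mult_less_top)
  qed
  finally show "(\<integral>\<^sup>+ p. ennreal (norm (indicator (strip d) (snd p) * u p)) \<partial>space_time T) < \<infinity>" .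
qed

lemma space_space_time:
  "(t, x, y) \<in> space (space_time T) \<longleftrightarrow> t \<in> {0<..<T} \<and> x \<in> {0..<2*pi} \<and> y > 0"
  by (simp add: space_time_def half_cylinder_def space_pair_measure space_torus space_halfline
      space_time_interval)

text \<open>With no support condition in t or x, \<open>f\<close> is bounded on the region of
  integration only, whose part y <= d lies in a compact box.\<close>

lemma continuous_bounded_cylinder:
  fixes f :: "real \<times> real \<times> real \<Rightarrow> 'b::real_normed_vector"
  assumes "continuous_on UNIV f" "\<And>t x y. y > d \<Longrightarrow> f (t, x, y) = 0"
  obtains B where "B \<ge> 0" "\<And>p. p \<in> space (space_time T) \<Longrightarrow> norm (f p) \<le> B"
proof -
  have "compact (f ` ({0..T} \<times> {0..2*pi} \<times> {0..d}))"
    using assms(1)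
    by (intro compact_continuous_image compact_Times compact_Icc) (auto intro: continuous_on_subset)
  then obtain B where B: "\<And>p. p \<in> {0..T} \<times> {0..2*pi} \<times> {0..d} \<Longrightarrow> norm (f p) \<le> B"
    using compact_imp_bounded bounded_iff by (metis imageI)
  show thesis
  proof (rule that[of "max B 0"])
    show "norm (f p) \<le> max B 0" if "p \<in> space (space_time T)" for p
    proof (cases p)
      case (fields t x y)
      then show ?thesis
        using that B[of p] assms(2)[of y t x] by (cases "y \<le> d") (auto simp: space_space_time)
    qed
  qed simp
qed

lemma integrable_Linf_L2_mult:
  fixes f :: "real \<times> real \<times> real \<Rightarrow> 'b::{banach, second_countable_topology}"
  assumes u: "u \<in> Linf_L2 T"
    and f: "continuous_on UNIV f" "\<And>t x y. y > d \<Longrightarrow> f (t, x, y) = 0"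
  shows "integrable (space_time T) (\<lambda>p. u p *\<^sub>R f p)"
proof -
  obtain B where B: "B \<ge> 0" "\<And>p. p \<in> space (space_time T) \<Longrightarrow> norm (f p) \<le> B"
    using continuous_bounded_cylinder[OF f] by metis
  have [measurable]: "u \<in> borel_measurable (space_time T)" "f \<in> borel_measurable (space_time T)"
    using u continuous_borel_measurable_txy[OF f(1)] by (auto simp: Linf_L2_def)
  show ?thesis
  proof (rule Bochner_Integration.integrable_bound
      [OF integrable_mult_right[OF integrable_Linf_L2_strip[OF u, of d], of B]])
    have "norm (u p *\<^sub>R f p) \<le> norm (B * (indicator (strip d) (snd p) * u p))"
      if p: "p \<in> space (space_time T)" for p
    proof (cases p)
      case (fields t x y)
      show ?thesis
      proof (cases "y \<le> d")
        case True
        then have "(x, y) \<in> strip d" using p fields by (auto simp: strip_def space_space_time)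
        then show ?thesis using mult_right_mono[OF B(2)[OF p], of "\<bar>u p\<bar>"] B(1) fields
          by (simp add: abs_mult mult.commute)
      qed (use f(2) fields in auto)
    qed
    then show "AE p in space_time T. norm (u p *\<^sub>R f p) \<le> norm (B * (indicator (strip d) (snd p) * u p))"
      by (rule AE_I2)
  qed measurable
qed

lemma integral_space_time:
  fixes f :: "real \<times> real \<times> real \<Rightarrow> 'b::{banach, second_countable_topology}"
  assumes "integrable (space_time T) f"
  shows "(\<integral>p. f p \<partial>space_time T) = (\<integral>t. \<integral>z. f (t, z) \<partial>half_cylinder \<partial>time T)"
    and "AE t in time T. integrable half_cylinder (\<lambda>z. f (t, z))"
    and "integrable (time T) (\<lambda>t. \<integral>z. f (t, z) \<partial>half_cylinder)"
  using assms space_time.integral_fst'[of T f] space_time.AE_integrable_fst'[of T f]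
    space_time.integrable_fst'[of T f]
  by (auto simp: space_time_def)

lemma integral_half_cylinder:
  fixes f :: "real \<times> real \<Rightarrow> 'b::{banach, second_countable_topology}"
  assumes "integrable half_cylinder f"
  shows "(\<integral>z. f z \<partial>half_cylinder) = (\<integral>x. \<integral>y. f (x, y) \<partial>halfline \<partial>torus)"
    and "AE x in torus. integrable halfline (\<lambda>y. f (x, y))"
  using assms half_cylinder.integral_fst'[of f] half_cylinder.AE_integrable_fst'[of f]
  by (auto simp: half_cylinder_def)

section \<open>Moving the primitive in y from the solution to the test function\<close>

interpretation hh: pair_sigma_finite halfline halfline ..

lemma set_lebesgue_integral_halfline:
  "(LINT z:{0<..y}|lborel. a z) = (\<integral>z. (if z \<le> y then a z else 0) \<partial>halfline)" for a :: "real \<Rightarrow> real"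
  unfolding set_lebesgue_integral_def halfline_def
  by (subst integral_restrict_space) (auto intro!: Bochner_Integration.integral_cong simp: indicator_def)

lemma id_measurable_halfline_fst_snd:
  "(\<lambda>p. fst p) \<in> borel_measurable (halfline \<Otimes>\<^sub>M N)" "(\<lambda>p. snd p) \<in> borel_measurable (N \<Otimes>\<^sub>M halfline)"
  using measurable_compose[OF measurable_fst id_measurable_interval(2)]
    measurable_compose[OF measurable_snd id_measurable_interval(2)] by auto

lemma continuous_measurable_halfline:
  fixes f :: "real \<Rightarrow> 'b::topological_space"
  shows "continuous_on UNIV f \<Longrightarrow> f \<in> borel_measurable halfline"
  using measurable_compose[OF id_measurable_interval(2)] borel_measurable_continuous_onI by blast

text \<open>Fubini on the triangle 0 < z <= y: the inner integral of \<open>g\<close> over y >= z is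
  \<open>- G z\<close>, since \<open>G\<close> vanishes from \<open>d\<close> on. A primitive from
  the wall becomes one from infinity.\<close>

lemma integral_antiderivative_by_parts:
  assumes a: "integrable halfline (\<lambda>y. if y \<le> d then a y else 0)"
    and am: "a \<in> borel_measurable halfline"
    and G: "\<And>y. (G has_real_derivative g y) (at y)" "continuous_on UNIV g"
    and supp: "\<And>y. y > d \<Longrightarrow> g y = 0" "\<And>y. y \<ge> d \<Longrightarrow> G y = 0" and "d > 0"
  shows "(\<integral>y. (LINT z:{0<..y}|lborel. a z) * g y \<partial>halfline) = - (\<integral>z. a z * G z \<partial>halfline)"
proof -
  note [measurable] = id_measurable_halfline_fst_snd am continuous_measurable_halfline[OF G(2)]
  define f where "f z y = (if z \<le> y then a z * g y else 0)" for z y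
  have fm [measurable]: "case_prod f \<in> borel_measurable (halfline \<Otimes>\<^sub>M halfline)"
    unfolding f_def split_beta' by measurable
  have "compact (g ` {0..d})"
    using G(2) by (intro compact_continuous_image) (auto intro: continuous_on_subset)
  then obtain B where B0: "\<And>y. y \<in> {0..d} \<Longrightarrow> \<bar>g y\<bar> \<le> B"
    using compact_imp_bounded bounded_iff by (metis imageI real_norm_def)
  then have B: "\<bar>g y\<bar> \<le> B" if "y \<in> space halfline" for y
    using that supp(1)[of y] order_trans[OF abs_ge_zero B0[of 0]] \<open>d > 0\<close>
    by (cases "y \<le> d") (auto simp: space_halfline)
  have Bnn: "B \<ge> 0" using B0[of 0] \<open>d > 0\<close> by force
  have hfin: "emeasure halfline {0<..d} < \<infinity>" "{0<..d} \<in> sets halfline"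
    using \<open>d > 0\<close> by (auto simp: halfline_def emeasure_restrict_space subset_iff sets_restrict_space_iff)
  have gint: "integrable halfline (\<lambda>y. f z y)" for z
  proof (rule integrableI_bounded_set[OF hfin(2) _ hfin(1), where B="\<bar>a z\<bar> * B"])
    have [measurable]: "(indicator {z..} :: real \<Rightarrow> real) \<in> borel_measurable halfline"
      using measurable_compose[OF id_measurable_interval(2), of "indicator {z..}" borel] by simp
    have "(\<lambda>y. indicator {z..} y * (a z * g y)) \<in> borel_measurable halfline" by measurable
    also have "(\<lambda>y. indicator {z..} y * (a z * g y)) = f z" by (auto simp: f_def indicator_def)
    finally show "(\<lambda>y. f z y) \<in> borel_measurable halfline" .
  qed (use B Bnn supp(1) in
      \<open>auto intro!: AE_I2 mult_left_mono simp: f_def abs_mult space_halfline not_le\<close>)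
  have "integrable (halfline \<Otimes>\<^sub>M halfline) (case_prod f)"
  proof (rule hh.Fubini_integrable[OF fm])
    show "AE z in halfline. integrable halfline (\<lambda>y. case_prod f (z, y))" using gint by simp
    \<comment> \<open>For z <= d the inner integral is at most |a z| times the bound on
      \<open>g\<close> times the length of its support, and for z > d it is 0. Integrability of
      \<open>a\<close> up to \<open>d\<close> thus suffices.\<close>
    show "integrable halfline (\<lambda>z. \<integral>y. norm (case_prod f (z, y)) \<partial>halfline)"
    proof (rule Bochner_Integration.integrable_bound[OF integrable_mult_right[OF a, of "B * measure halfline {0<..d}"]])
      have *: "(\<integral>y. norm (f z y) \<partial>halfline) \<le> norm (B * measure halfline {0<..d} * (if z \<le> d then a z else 0))"
        if "z \<in> space halfline" for z
      proof (cases "z \<le> d")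
        case True
        have "(\<integral>y. norm (f z y) \<partial>halfline) \<le> (\<integral>y. indicator {0<..d} y * (\<bar>a z\<bar> * B) \<partial>halfline)"
        proof (rule integral_mono)
          show "integrable halfline (\<lambda>y. indicat_real {0<..d} y * (\<bar>a z\<bar> * B))"
            using hfin by (intro integrable_mult_left) auto
          show "norm (f z y) \<le> indicator {0<..d} y * (\<bar>a z\<bar> * B)" if "y \<in> space halfline" for y
            using B[OF that] that supp(1)[of y] Bnn
            by (auto simp: f_def abs_mult indicator_def space_halfline intro!: mult_left_mono)
        qed (use gint in auto)
        also have "\<dots> = \<bar>a z\<bar> * B * measure halfline {0<..d}"
          using hfin(2) by (simp add: space_halfline Int_absorb2 greaterThanAtMost_def)
        finally show ?thesis using True Bnn by (simp add: abs_mult mult_ac)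
      next
        case False
        then have "f z y = 0" for y using supp(1)[of y] by (auto simp: f_def)
        then show ?thesis by simp
      qed
      show "AE z in halfline. norm (\<integral>y. norm (case_prod f (z, y)) \<partial>halfline)
          \<le> norm (B * measure halfline {0<..d} * (if z \<le> d then a z else 0))"
        by (rule AE_I2) (use * in \<open>simp add: integral_nonneg_AE\<close>)
    qed measurable
  qed
  note sw = hh.Fubini_integral[OF this]
  have "(\<integral>z. f z y \<partial>halfline) = (LINT z:{0<..y}|lborel. a z) * g y" for y
  proof -
    have "(\<integral>z. f z y \<partial>halfline) = (\<integral>z. (if z \<le> y then a z else 0) * g y \<partial>halfline)"
      by (intro Bochner_Integration.integral_cong) (auto simp: f_def)
    then show ?thesis by (simp add: set_lebesgue_integral_halfline)
  qed
  moreover have "(\<integral>y. f z y \<partial>halfline) = - (a z * G z)" if z: "z \<in> space halfline" for z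
  proof (cases "z \<le> d")
    case True
    have "(\<integral>y. f z y \<partial>halfline) = a z * (\<integral>y. g y * indicator {z..d} y \<partial>lborel)"
    proof -
      have "(\<integral>y. f z y \<partial>halfline) = (\<integral>y. indicator {0<..} y *\<^sub>R f z y \<partial>lborel)"
        by (simp add: halfline_def integral_restrict_space)
      also have "\<dots> = (\<integral>y. a z * (g y * indicator {z..d} y) \<partial>lborel)"
        using z supp(1)
        by (intro Bochner_Integration.integral_cong)
          (auto simp: f_def indicator_def space_halfline not_le)
      finally show ?thesis by simp
    qed
    also have "(\<integral>y. g y * indicator {z..d} y \<partial>lborel) = G d - G z"
      using G True by (intro integral_FTC_Icc_real) (auto simp: continuous_on_eq_continuous_at)
    finally show ?thesis using supp(2) by simp
  next
    case False
    then have "f z y = 0" for y using supp(1)[of y] by (auto simp: f_def)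
    then show ?thesis using supp(2)[of z] False by simp
  qed
  then have "(\<integral>z. (\<integral>y. f z y \<partial>halfline) \<partial>halfline) = (\<integral>z. - (a z * G z) \<partial>halfline)"
    by (intro Bochner_Integration.integral_cong) auto
  ultimately show ?thesis using sw by simp
qed

lemma nn_integral_space_time:
  assumes "f \<in> borel_measurable (space_time T)"
  shows "(\<integral>\<^sup>+ p. f p \<partial>space_time T) = (\<integral>\<^sup>+ t. \<integral>\<^sup>+ x. \<integral>\<^sup>+ y. f (t, x, y) \<partial>halfline \<partial>torus \<partial>time T)"
proof -
  have m: "f \<in> borel_measurable (time T \<Otimes>\<^sub>M half_cylinder)"
    using assms by (simp add: space_time_def)
  have "(\<integral>\<^sup>+ z. f (t, z) \<partial>half_cylinder) = (\<integral>\<^sup>+ x. \<integral>\<^sup>+ y. f (t, x, y) \<partial>halfline \<partial>torus)"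
    if "t \<in> space (time T)" for t
    using halfline.nn_integral_fst[of "\<lambda>z. f (t, z)" torus] measurable_compose_Pair1[OF that m]
    by (simp add: half_cylinder_def)
  then have "(\<integral>\<^sup>+ t. \<integral>\<^sup>+ z. f (t, z) \<partial>half_cylinder \<partial>time T)
      = (\<integral>\<^sup>+ t. \<integral>\<^sup>+ x. \<integral>\<^sup>+ y. f (t, x, y) \<partial>halfline \<partial>torus \<partial>time T)"
    by (rule nn_integral_cong)
  then show ?thesis
    using hc.nn_integral_fst[OF m] by (simp add: space_time_def)
qed

definition primitive_y :: "(real \<times> real \<times> real \<Rightarrow> real) \<Rightarrow> real \<times> real \<times> real \<Rightarrow> real" where
  "primitive_y u = (\<lambda>(t, x, y). LINT z:{0<..y}|lborel. u (t, x, z))"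

text \<open>Tonelli with a majorant that separates y from (t, x): for y <= d the primitive is at
  most the integral of |u| over the whole of {0<..d}, which is independent of y.\<close>

lemma primitive_y_integrable:
  assumes u: "u \<in> Linf_L2 T" and F: "continuous_on UNIV F"
    and supp: "\<And>t x y. y > d \<Longrightarrow> F (t, x, y) = 0"
  shows "integrable (space_time T) (\<lambda>p. primitive_y u p * F p)"
proof (rule integrableI_bounded)
  have um [measurable]: "u \<in> borel_measurable (time T \<Otimes>\<^sub>M (torus \<Otimes>\<^sub>M halfline))"
    using u by (simp add: Linf_L2_def space_time_def half_cylinder_def)
  define N where "N = time T \<Otimes>\<^sub>M (torus \<Otimes>\<^sub>M halfline)"
  \<comment> \<open>Joint measurability of the truncated integrand in (t, x, y) and z; the integral
    over z inherits measurability in the parameters.\<close>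
  define k where "k q = (if snd q \<le> snd (snd (fst q))
      then u (fst (fst q), fst (snd (fst q)), snd q) else 0)" for q :: "(real \<times> real \<times> real) \<times> real"
  have [measurable]: "(\<lambda>q. snd q) \<in> borel_measurable (N \<Otimes>\<^sub>M halfline)"
    by (rule id_measurable_halfline_fst_snd)
  have "(\<lambda>q. snd (snd (fst q))) \<in> measurable (N \<Otimes>\<^sub>M halfline) halfline"
    unfolding N_def by measurable
  from measurable_compose[OF this id_measurable_interval(2)]
  have [measurable]: "(\<lambda>q. snd (snd (fst q))) \<in> borel_measurable (N \<Otimes>\<^sub>M halfline)" .
  have [measurable]: "(\<lambda>q. (fst (fst q), fst (snd (fst q)), snd q))
      \<in> measurable (N \<Otimes>\<^sub>M halfline) (time T \<Otimes>\<^sub>M (torus \<Otimes>\<^sub>M halfline))"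
    unfolding N_def by measurable
  have "k \<in> borel_measurable (N \<Otimes>\<^sub>M halfline)"
    unfolding k_def by measurable
  from halfline.borel_measurable_lebesgue_integral[of "\<lambda>p z. k (p, z)", simplified, OF this]
  have V [measurable]: "primitive_y u \<in> borel_measurable (space_time T)"
    by (simp add: primitive_y_def set_lebesgue_integral_halfline k_def N_def space_time_def
        half_cylinder_def split_beta' cong: if_cong)
  have Fm [measurable]: "F \<in> borel_measurable (space_time T)"
    by (rule continuous_borel_measurable_txy[OF F])
  show "(\<lambda>p. primitive_y u p * F p) \<in> borel_measurable (space_time T)" by measurable
  obtain B where B: "B \<ge> 0" "\<And>p. p \<in> space (space_time T) \<Longrightarrow> norm (F p) \<le> B"
    using continuous_bounded_cylinder[OF F supp] by metis
  define c where "c y = ennreal (indicator {0<..d} y * B)" for y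
  define Y where "Y t x = (\<integral>\<^sup>+ z. ennreal \<bar>indicator (strip d) (x, z) * u (t, x, z)\<bar> \<partial>halfline)" for t x
  have bound: "ennreal \<bar>primitive_y u (t, x, y) * F (t, x, y)\<bar> \<le> c y * Y t x"
    if "(t, x, y) \<in> space (space_time T)" for t x y
  proof (cases "y \<le> d")
    case True
    define a where "a z = (if z \<le> y then u (t, x, z) else 0)" for z
    have "ennreal \<bar>primitive_y u (t, x, y)\<bar> \<le> (\<integral>\<^sup>+ z. ennreal \<bar>a z\<bar> \<partial>halfline)"
    proof (cases "integrable halfline a")
      case True
      then show ?thesis using integral_norm_bound_ennreal[OF True]
        by (simp add: primitive_y_def set_lebesgue_integral_halfline a_def[abs_def])
    next
      \<comment> \<open>The Bochner integral of a non-integrable slice is 0 by convention, so the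
        bound is trivial.\<close>
      case False
      then show ?thesis
        by (simp add: primitive_y_def set_lebesgue_integral_halfline a_def[abs_def]
            not_integrable_integral_eq)
    qed
    also have "\<dots> \<le> Y t x"
      unfolding Y_def using that True
      by (intro nn_integral_mono ennreal_leI)
        (auto simp: a_def indicator_def strip_def space_space_time space_halfline)
    finally have "ennreal \<bar>primitive_y u (t, x, y)\<bar> \<le> Y t x" .
    moreover have "ennreal \<bar>F (t, x, y)\<bar> \<le> c y"
      using B(2)[OF that] that True by (auto simp: c_def indicator_def space_space_time intro!: ennreal_leI)
    ultimately show ?thesis
      by (simp add: abs_mult ennreal_mult mult.commute mult_mono)
  next
    case False
    then show ?thesis using supp[of y t x] by simp
  qed
  note int = integrable_Linf_L2_strip[OF u, of d]
  have m: "(\<lambda>p. ennreal \<bar>indicator (strip d) (snd p) * u p\<bar>) \<in> borel_measurable (space_time T)"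
    using int by measurable
  have c: "c \<in> borel_measurable halfline"
    unfolding c_def using measurable_compose[OF id_measurable_interval(2), of "indicator {0<..d} :: _ \<Rightarrow> real" borel]
    by (auto simp: o_def)
  note [measurable] = strip_sets[of d, unfolded half_cylinder_def]
  have "(\<lambda>q. ennreal \<bar>indicator (strip d) (snd (fst q), snd q) * u (fst (fst q), snd (fst q), snd q)\<bar>)
      \<in> borel_measurable ((time T \<Otimes>\<^sub>M torus) \<Otimes>\<^sub>M halfline)"
    by measurable
  from halfline.borel_measurable_nn_integral_fst[OF this]
  have Ym: "(\<lambda>q. Y (fst q) (snd q)) \<in> borel_measurable (time T \<Otimes>\<^sub>M torus)"
    by (simp add: Y_def)
  have Y1: "Y t \<in> borel_measurable torus" if "t \<in> space (time T)" for t
    using measurable_compose_Pair1[OF that Ym] by simp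
  have Y2: "(\<lambda>t. \<integral>\<^sup>+ x. Y t x \<partial>torus) \<in> borel_measurable (time T)"
    using torus.borel_measurable_nn_integral_fst[OF Ym] by simp
  have "(\<integral>\<^sup>+ p. ennreal (norm (primitive_y u p * F p)) \<partial>space_time T)
      = (\<integral>\<^sup>+ t. \<integral>\<^sup>+ x. \<integral>\<^sup>+ y. ennreal \<bar>primitive_y u (t, x, y) * F (t, x, y)\<bar> \<partial>halfline \<partial>torus \<partial>time T)"
    by (subst nn_integral_space_time) auto
  also have "\<dots> \<le> (\<integral>\<^sup>+ t. \<integral>\<^sup>+ x. \<integral>\<^sup>+ y. c y * Y t x \<partial>halfline \<partial>torus \<partial>time T)"
    by (intro nn_integral_mono bound)
      (auto simp: space_space_time space_time_interval space_torus space_halfline)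
  also have "\<dots> = (\<integral>\<^sup>+ t. \<integral>\<^sup>+ x. (\<integral>\<^sup>+ y. c y \<partial>halfline) * Y t x \<partial>torus \<partial>time T)"
    using c by (simp add: nn_integral_multc)
  also have "\<dots> = (\<integral>\<^sup>+ y. c y \<partial>halfline) * (\<integral>\<^sup>+ t. \<integral>\<^sup>+ x. Y t x \<partial>torus \<partial>time T)"
    using Y1 by (subst nn_integral_cmult[OF Y2, symmetric])
      (intro nn_integral_cong nn_integral_cmult, simp)
  also have "(\<integral>\<^sup>+ t. \<integral>\<^sup>+ x. Y t x \<partial>torus \<partial>time T)
      = (\<integral>\<^sup>+ p. ennreal \<bar>indicator (strip d) (snd p) * u p\<bar> \<partial>space_time T)"
    unfolding Y_def by (subst nn_integral_space_time[OF m]) simp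
  also have "(\<integral>\<^sup>+ y. c y \<partial>halfline) * \<dots> < \<infinity>"
  proof -
    have "(\<integral>\<^sup>+ y. c y \<partial>halfline) = ennreal B * emeasure halfline {0<..d}"
    proof -
      have "(\<integral>\<^sup>+ y. c y \<partial>halfline) = (\<integral>\<^sup>+ y. ennreal B * indicator {0<..d} y \<partial>halfline)"
        by (intro nn_integral_cong) (auto simp: c_def indicator_def)
      moreover have "{0<..d} \<in> sets halfline" by (auto simp: halfline_def sets_restrict_space_iff)
      ultimately show ?thesis by (simp add: nn_integral_cmult_indicator)
    qed
    moreover have "emeasure halfline {0<..d} < \<infinity>"
      by (cases "0 \<le> d") (auto simp: halfline_def emeasure_restrict_space subset_iff)
    ultimately show ?thesis
      using int by (simp add: ennreal_mult_less_top integrable_iff_bounded)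
  qed
  finally show "(\<integral>\<^sup>+ p. ennreal (norm (primitive_y u p * F p)) \<partial>space_time T) < \<infinity>" .
qed

text \<open>On almost every line with t and x fixed, \<open>u\<close> is integrable up to
  \<open>d\<close> and the one-dimensional identity applies; Fubini integrates it over x and then
  over t.\<close>

lemma integral_primitive_y_by_parts:
  assumes u: "u \<in> Linf_L2 T" and F: "continuous_on UNIV F" and G: "continuous_on UNIV G"
    and D: "\<And>t x y. ((\<lambda>y. G (t, x, y)) has_real_derivative F (t, x, y)) (at y)"
    and supp: "\<And>t x y. y > d \<Longrightarrow> F (t, x, y) = 0" "\<And>t x y. y \<ge> d \<Longrightarrow> G (t, x, y) = 0" "d > 0"
  shows "(\<integral>p. primitive_y u p * F p \<partial>space_time T) = - (\<integral>p. u p * G p \<partial>space_time T)"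
proof -
  note VF = primitive_y_integrable[OF u F supp(1), of d, simplified]
  have uG: "integrable (space_time T) (\<lambda>p. u p * G p)"
    using integrable_Linf_L2_mult[OF u G, of d] supp(2) by simp
  have um: "u \<in> borel_measurable (time T \<Otimes>\<^sub>M half_cylinder)"
    using u by (simp add: Linf_L2_def space_time_def)
  have "AE t in time T. (\<integral>z. primitive_y u (t, z) * F (t, z) \<partial>half_cylinder)
      = - (\<integral>z. u (t, z) * G (t, z) \<partial>half_cylinder)"
    using integral_space_time(2)[OF VF] integral_space_time(2)[OF uG]
      integral_space_time(2)[OF integrable_Linf_L2_strip[OF u, of d]] AE_space
  proof eventually_elim
    case (elim t)
    have utm: "(\<lambda>z. u (t, z)) \<in> borel_measurable half_cylinder"
      using measurable_compose_Pair1[OF elim(4) um] by simp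
    have "AE x in torus. (\<integral>y. primitive_y u (t, x, y) * F (t, x, y) \<partial>halfline)
        = - (\<integral>y. u (t, x, y) * G (t, x, y) \<partial>halfline)"
      using integral_half_cylinder(2)[OF elim(3)[simplified]] AE_space
    proof eventually_elim
      case (elim x)
      have "(\<lambda>y. u (t, x, y)) \<in> borel_measurable halfline"
        using measurable_compose_Pair1[OF elim(2) utm[unfolded half_cylinder_def]] by simp
      moreover have "integrable halfline (\<lambda>y. if y \<le> d then u (t, x, y) else 0)"
        using elim(1)
        by (rule Bochner_Integration.integrable_cong[THEN iffD1, rotated -1])
          (use elim(2) in \<open>auto simp: strip_def space_halfline space_torus\<close>)
      ultimately show ?case
        unfolding primitive_y_def split_conv
        by (intro integral_antiderivative_by_parts[where d=d])
          (use D supp in \<open>auto intro!: continuous_on_compose2[OF F] continuous_intros\<close>)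
    qed
    then have "(\<integral>x. \<integral>y. primitive_y u (t, x, y) * F (t, x, y) \<partial>halfline \<partial>torus)
        = (\<integral>x. - (\<integral>y. u (t, x, y) * G (t, x, y) \<partial>halfline) \<partial>torus)"
      using half_cylinder.integrable_fst'[of "\<lambda>z. primitive_y u (t, z) * F (t, z)"]
        half_cylinder.integrable_fst'[of "\<lambda>z. u (t, z) * G (t, z)"] elim(1,2)
      by (intro integral_cong_AE) (auto simp: half_cylinder_def)
    then show ?case
      by (simp add: integral_half_cylinder[OF elim(1)] integral_half_cylinder[OF elim(2)])
  qed
  then have "(\<integral>t. \<integral>z. primitive_y u (t, z) * F (t, z) \<partial>half_cylinder \<partial>time T)
      = (\<integral>t. - (\<integral>z. u (t, z) * G (t, z) \<partial>half_cylinder) \<partial>time T)"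
    using integral_space_time(3)[OF VF] integral_space_time(3)[OF uG]
    by (intro integral_cong_AE) auto
  then show ?thesis
    by (simp add: integral_space_time[OF VF] integral_space_time[OF uG])
qed

lemma dir_deriv_mult_y:
  fixes \<phi> :: "real \<times> real \<times> real \<Rightarrow> real"
  assumes "smooth a" "smooth \<phi>"
  shows "smooth (\<lambda>(t, x, y). a y * \<phi> (t, x, y))"
    and "dir_deriv (0, 1, 0) (\<lambda>(t, x, y). a y * \<phi> (t, x, y))
      = (\<lambda>(t, x, y). a y * dir_deriv (0, 1, 0) \<phi> (t, x, y))"
proof -
  have "bounded_linear (\<lambda>p::real \<times> real \<times> real. snd (snd p))"
    by (intro bounded_linear_compose[OF bounded_linear_snd] bounded_linear_snd)
  then have s: "smooth (\<lambda>p::real \<times> real \<times> real. a (snd (snd p)))"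
    by (intro smooth_compose[OF assms(1)] smooth_bounded_linear)
  then show sm: "smooth (\<lambda>(t, x, y). a y * \<phi> (t, x, y))"
    using smooth_mult[OF s assms(2)] by (simp add: split_beta')
  have "((\<lambda>x. \<phi> (t, x, y)) has_real_derivative dir_deriv (0, 1, 0) \<phi> (t, x, y)) (at x)" for t x y
    using dir_deriv_along[OF smooth_differentiable[OF assms(2)], of "(t, x, y)" "(0, 1, 0)"]
      shift_DERIV[of "\<lambda>x. \<phi> (t, x, y)" x] by simp
  then show "dir_deriv (0, 1, 0) (\<lambda>(t, x, y). a y * \<phi> (t, x, y))
      = (\<lambda>(t, x, y). a y * dir_deriv (0, 1, 0) \<phi> (t, x, y))"
    by (auto simp: fun_eq_iff intro!: dir_deriv_txy(2)[OF sm] DERIV_cmult)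
qed

text \<open>\<open>G\<close> stands for \<open>- \<integral>\<^sub>y\<^sup>\<infinity> us' \<partial>\<^sub>x \<phi>\<close>, the result of moving the primitive in \<open>us' v\<close> onto \<open>\<phi>\<close>.\<close>

lemma linearized_Prandtl_weak:
  assumes L: "linearized_Prandtl us T u" and u: "u \<in> Linf_L2 T" and us: "smooth us"
    and \<phi>: "\<phi> \<in> test_txy T" and supp: "\<And>t x y. y \<ge> d \<Longrightarrow> \<phi> (t, x, y) = 0" "d > 0"
    and G: "continuous_on UNIV G" "\<And>t x y. y \<ge> d \<Longrightarrow> G (t, x, y) = 0"
    and DG: "\<And>t x y. ((\<lambda>y. G (t, x, y)) has_real_derivative
        deriv us y * dir_deriv (0, 1, 0) \<phi> (t, x, y)) (at y)"
  shows "(\<integral>(t, x, y). u (t, x, y) * (dir_deriv (1, 0, 0) \<phi> (t, x, y)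
      + us y * dir_deriv (0, 1, 0) \<phi> (t, x, y) + G (t, x, y)
      + dir_deriv (0, 0, 1) (dir_deriv (0, 0, 1) \<phi>) (t, x, y)) \<partial>space_time T) = 0"
proof -
  have s: "smooth \<phi>" using \<phi> by (simp add: test_txy_def)
  note [simp] = dir_deriv_mult_y[OF us s] dir_deriv_mult_y[OF smooth_deriv[OF us] s]
  let ?t = "dir_deriv (1, 0, 0) \<phi>" and ?x = "dir_deriv (0, 1, 0) \<phi>"
    and ?yy = "dir_deriv (0, 0, 1) (dir_deriv (0, 0, 1) \<phi>)"
  have far: "dir_deriv e f (t, x, y) = 0"
    if "\<And>t x y. y > d \<Longrightarrow> f (t, x, y) = 0" "y > d" for e t x y and f :: "real \<times> real \<times> real \<Rightarrow> real"
  proof (rule dir_deriv_eq_0_open)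
    show "open (UNIV \<times> (UNIV \<times> {d<..}))" by (intro open_Times) auto
  qed (use that in auto)
  have int: "integrable (space_time T) (\<lambda>p. u p * f p)"
    if "continuous_on UNIV f" "\<And>t x y. y > d \<Longrightarrow> f (t, x, y) = 0" for f
    using integrable_Linf_L2_mult[OF u that] by simp
  have ct: "continuous_on UNIV (dir_deriv e f)" if "smooth f" for e and f :: "real \<times> real \<times> real \<Rightarrow> real"
    using that by (intro smooth_continuous_on smooth_dir_deriv)
  have cy: "continuous_on UNIV (\<lambda>(t, x, y). a y * ?x (t, x, y))" if "smooth a" for a
    using ct[OF dir_deriv_mult_y(1)[OF that s], of "(0, 1, 0)"]
    by (simp only: dir_deriv_mult_y(2)[OF that s])
  have \<phi>0: "\<phi> (t, x, y) = 0" if "y > d" for t x y using supp(1)[of y] that by simp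
  note \<phi>1 = far[where f=\<phi>, OF \<phi>0]
  note \<phi>2 = far[where f="dir_deriv (0, 0, 1) \<phi>", OF \<phi>1]
  have V: "(\<integral>p. primitive_y u p * (case p of (t, x, y) \<Rightarrow> deriv us y * ?x (t, x, y)) \<partial>space_time T)
      = - (\<integral>p. u p * G p \<partial>space_time T)"
    by (rule integral_primitive_y_by_parts[OF u cy G(1), of _ d])
      (use us DG G(2) supp \<phi>1 in \<open>auto intro: smooth_deriv\<close>)
  have i1: "integrable (space_time T) (\<lambda>p. u p * ?t p)"
    and i2: "integrable (space_time T) (\<lambda>p. u p * (case p of (t, x, y) \<Rightarrow> us y * ?x (t, x, y)))"
    and i3: "integrable (space_time T) (\<lambda>p. u p * G p)"
    and i4: "integrable (space_time T) (\<lambda>p. u p * ?yy p)"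
  proof -
    show "integrable (space_time T) (\<lambda>p. u p * ?t p)" by (rule int[OF ct[OF s] \<phi>1])
    show "integrable (space_time T) (\<lambda>p. u p * (case p of (t, x, y) \<Rightarrow> us y * ?x (t, x, y)))"
      by (rule int[OF cy[OF us]]) (simp add: \<phi>1)
    show "integrable (space_time T) (\<lambda>p. u p * G p)" by (rule int[OF G(1)]) (simp add: G(2))
    show "integrable (space_time T) (\<lambda>p. u p * ?yy p)"
      by (rule int[OF ct[OF smooth_dir_deriv[OF s]] \<phi>2])
  qed
  note bspec[OF L[unfolded linearized_Prandtl_def Let_def] \<phi>]
  \<comment> \<open>In \<open>normal_velocity\<close> the minus sign of v and that of
    \<open>ddist\<close> cancel, so the primitive enters with a plus sign. Moving it onto the test
    function by \<open>V\<close> brings a minus sign, and all four terms then agree in sign.\<close>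
  then have "- (\<integral>p. u p * ?t p \<partial>space_time T)
      - (\<integral>p. u p * (case p of (t, x, y) \<Rightarrow> us y * ?x (t, x, y)) \<partial>space_time T)
      + (\<integral>p. primitive_y u p * (case p of (t, x, y) \<Rightarrow> deriv us y * ?x (t, x, y)) \<partial>space_time T)
      - (\<integral>p. u p * ?yy p \<partial>space_time T) = 0"
    by (simp add: ddist_def mult_y_def normal_velocity_def dist_of_def primitive_y_def)
  then have "(\<integral>p. u p * ?t p + u p * (case p of (t, x, y) \<Rightarrow> us y * ?x (t, x, y))
      + u p * G p + u p * ?yy p \<partial>space_time T) = 0"
    using V i1 i2 i3 i4 by simp
  then show ?thesis by (simp add: split_beta' distrib_left)
qed

section \<open>Complex test functions in product form\<close>

definition csmooth :: "('a::euclidean_space \<Rightarrow> complex) \<Rightarrow> bool" where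
  "csmooth f \<longleftrightarrow> smooth (\<lambda>z. Re (f z)) \<and> smooth (\<lambda>z. Im (f z))"

lemma csmooth_of_real: "smooth h \<Longrightarrow> csmooth (\<lambda>z. of_real (h z))"
  and csmooth_const: "csmooth (\<lambda>_. c)"
  and csmooth_add: "csmooth f \<Longrightarrow> csmooth g \<Longrightarrow> csmooth (\<lambda>z. f z + g z)"
  and csmooth_diff: "csmooth f \<Longrightarrow> csmooth g \<Longrightarrow> csmooth (\<lambda>z. f z - g z)"
  and csmooth_mult: "csmooth f \<Longrightarrow> csmooth g \<Longrightarrow> csmooth (\<lambda>z. f z * g z)"
  and csmooth_exp: "csmooth f \<Longrightarrow> csmooth (\<lambda>z. exp (f z))"
  by (auto simp: csmooth_def Re_exp Im_exp intro!: smooth_intros)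

lemma csmooth_continuous_on:
  assumes "csmooth f"
  shows "continuous_on S f"
proof -
  have "continuous_on S (\<lambda>z. Complex (Re (f z)) (Im (f z)))"
    unfolding Complex_eq
    using assms by (intro continuous_intros smooth_continuous_on) (auto simp: csmooth_def)
  then show ?thesis by simp
qed

lemma csmooth_vector_derivative:
  assumes "csmooth f" "\<And>t. (f has_vector_derivative f' t) (at t)"
  shows "csmooth f'"
proof -
  have "Re (f' t) = deriv (\<lambda>t. Re (f t)) t" "Im (f' t) = deriv (\<lambda>t. Im (f t)) t" for t
    using assms(2)[of t] by (auto simp: has_vector_derivative_complex_iff DERIV_imp_deriv)
  then show ?thesis using assms(1) by (auto simp: csmooth_def intro!: smooth_deriv)
qed

lemma smooth_coordinates:
  "smooth f \<Longrightarrow> smooth (\<lambda>p::real \<times> real \<times> real. f (fst p))"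
  "smooth f \<Longrightarrow> smooth (\<lambda>p::real \<times> real \<times> real. f (fst (snd p)))"
  "smooth f \<Longrightarrow> smooth (\<lambda>p::real \<times> real \<times> real. f (snd (snd p)))"
  by (rule smooth_compose, assumption, rule smooth_bounded_linear, rule bounded_linear_fst
      bounded_linear_compose[OF bounded_linear_fst bounded_linear_snd]
      bounded_linear_compose[OF bounded_linear_snd bounded_linear_snd])+

lemma continuous_on_coordinates:
  fixes h :: "real \<Rightarrow> 'c::topological_space"
  assumes "continuous_on UNIV h"
  shows "continuous_on UNIV (\<lambda>p::real \<times> real \<times> real. h (fst p))"
    "continuous_on UNIV (\<lambda>p::real \<times> real \<times> real. h (fst (snd p)))"
    "continuous_on UNIV (\<lambda>p::real \<times> real \<times> real. h (snd (snd p)))"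
  by (rule continuous_on_compose2[OF assms]; intro continuous_intros subset_UNIV)+

lemma Re_mult_vector_derivative:
  assumes "(f has_vector_derivative f') (at t)"
  shows "((\<lambda>t. Re (a * f t * b)) has_real_derivative Re (a * f' * b)) (at t)"
  using has_vector_derivative_mult_left[OF has_vector_derivative_mult_right[OF assms], of a b]
  by (simp add: has_vector_derivative_complex_iff)

text \<open>The weak formulation admits real test functions only. The real part of the identity
  comes from the test function Re (f g q), the imaginary part from replacing f by - i f. The
  interval for \<open>q\<close> is half-open so that \<open>q\<close> vanishes at \<open>d\<close>
  itself.\<close>

lemma linearized_Prandtl_weak_product:
  fixes f g q P :: "real \<Rightarrow> complex"
  assumes L: "linearized_Prandtl us T u" and u: "u \<in> Linf_L2 T" and us: "smooth us"
    and cs: "csmooth f" "csmooth g" "csmooth q" and P: "continuous_on UNIV P"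
    and f': "\<And>t. (f has_vector_derivative f' t) (at t)"
    and g': "\<And>x. (g has_vector_derivative g' x) (at x)"
    and q': "\<And>y. (q has_vector_derivative q' y) (at y)"
    and q'': "\<And>y. (q' has_vector_derivative q'' y) (at y)"
    and P': "\<And>y. (P has_vector_derivative of_real (deriv us y) * q y) (at y)"
    and f0: "0 < a" "b < T" "\<And>t. t \<notin> {a..b} \<Longrightarrow> f t = 0"
    and gper: "\<And>x. g (x + 2*pi) = g x"
    and q0: "0 < c" "\<And>y. y \<notin> {c..<d} \<Longrightarrow> q y = 0" and P0: "\<And>y. y \<ge> d \<Longrightarrow> P y = 0" and "d > 0"
  shows "(\<integral>(t, x, y). u (t, x, y) *\<^sub>R (f' t * g x * q y
      + f t * g' x * (of_real (us y) * q y + P y) + f t * g x * q'' y) \<partial>space_time T) = 0"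
proof -
  have cs': "csmooth f'" "csmooth g'" "csmooth q'" "csmooth q''"
    using csmooth_vector_derivative cs f' g' q' q'' by blast+
  define W where "W f f' = (\<lambda>(t, x, y). f' t * g x * q y
      + f t * g' x * (of_real (us y) * q y + P y) + f t * g x * q'' y)" for f f' :: "real \<Rightarrow> complex"
  \<comment> \<open>Derivatives of a function that vanishes on an open set vanish there; this bounds
    the support of the integrand in y.\<close>
  have q''0: "q'' y = 0" if "y > d" for y
  proof -
    have z: "(h has_vector_derivative h') (at y) \<Longrightarrow> h' = 0"
      if "\<And>y. y > d \<Longrightarrow> h y = 0" "y > d" for h :: "real \<Rightarrow> complex" and h' y
    proof -
      assume h: "(h has_vector_derivative h') (at y)"
      have "(h has_vector_derivative 0) (at y)"
        by (rule has_vector_derivative_transform_within_open[of "\<lambda>_. 0" _ _ "{d<..}"])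
          (use that in auto)
      then show "h' = 0" using h vector_derivative_unique_at by blast
    qed
    have "q' y = 0" if "y > d" for y by (rule z[OF _ that q']) (use q0 in auto)
    then show ?thesis using z[OF _ that q''] by auto
  qed
  have int: "integrable (space_time T) (\<lambda>p. u p *\<^sub>R W f f' p)"
    if "csmooth f" "csmooth f'" for f f'
  proof (rule integrable_Linf_L2_mult[OF u, of _ d])
    have [continuous_intros]: "continuous_on UNIV f" "continuous_on UNIV f'" "continuous_on UNIV g"
      "continuous_on UNIV g'" "continuous_on UNIV q" "continuous_on UNIV q''" "continuous_on UNIV us"
      using that cs cs' us csmooth_continuous_on smooth_continuous_on by blast+
    note [continuous_intros] = P
    note [continuous_intros] = continuous_on_coordinates
    show "continuous_on UNIV (W f f')"
      unfolding W_def split_beta' by (intro continuous_intros)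
    show "W f f' (t, x, y) = 0" if "y > d" for t x y
      using that q0 P0 q''0 by (auto simp: W_def)
  qed
  have Re0: "Re (\<integral>p. u p *\<^sub>R W f f' p \<partial>space_time T) = 0"
    if f: "csmooth f" "\<And>t. (f has_vector_derivative f' t) (at t)" "\<And>t. t \<notin> {a..b} \<Longrightarrow> f t = 0"
    for f f'
  proof -
    define \<phi> where "\<phi> = (\<lambda>(t, x, y). Re (f t * g x * q y))"
    define G where "G = (\<lambda>(t, x, y). Re (f t * g' x * P y))"
    have s: "smooth \<phi>"
      unfolding \<phi>_def split_beta' using f(1) cs
      by (auto simp: csmooth_def intro!: smooth_intros smooth_coordinates)
    have \<phi>: "\<phi> \<in> test_txy T"
      unfolding test_txy_def
    proof (intro CollectI conjI exI)
      show "\<forall>t x y. \<phi> (t, x, y) \<noteq> 0 \<longrightarrow> t \<in> {a..b} \<and> y \<in> {c..d}"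
        using f(3) q0(2) by (fastforce simp: \<phi>_def)
    qed (use s f0 q0 in \<open>auto simp: \<phi>_def gper\<close>)
    have dt: "dir_deriv (1, 0, 0) \<phi> (t, x, y) = Re (f' t * g x * q y)"
      and dx: "dir_deriv (0, 1, 0) \<phi> (t, x, y) = Re (f t * g' x * q y)"
      and dy: "dir_deriv (0, 0, 1) \<phi> (t, x, y) = Re (f t * g x * q' y)" for t x y
      using Re_mult_vector_derivative[OF f(2)[of t], where a=1 and b="g x * q y"]
        Re_mult_vector_derivative[OF g'[of x], where a="f t" and b="q y"]
        Re_mult_vector_derivative[OF q'[of y], where a="f t * g x" and b=1]
      by (intro dir_deriv_txy[OF s];
          simp only: \<phi>_def split_conv mult.assoc mult_1_left mult_1_right)+
    have dyy: "dir_deriv (0, 0, 1) (dir_deriv (0, 0, 1) \<phi>) (t, x, y) = Re (f t * g x * q'' y)" for t x y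
      using Re_mult_vector_derivative[OF q''[of y], where a="f t * g x" and b=1]
      by (intro dir_deriv_txy(3)[OF smooth_dir_deriv[OF s]]) (simp add: dy)
    have "(\<integral>(t, x, y). u (t, x, y) * (dir_deriv (1, 0, 0) \<phi> (t, x, y)
      + us y * dir_deriv (0, 1, 0) \<phi> (t, x, y) + G (t, x, y)
      + dir_deriv (0, 0, 1) (dir_deriv (0, 0, 1) \<phi>) (t, x, y)) \<partial>space_time T) = 0"
    proof (rule linearized_Prandtl_weak[OF L u us \<phi> _ \<open>d > 0\<close>])
      show "\<phi> (t, x, y) = 0" if "y \<ge> d" for t x y using q0(2) that by (simp add: \<phi>_def)
      show "G (t, x, y) = 0" if "y \<ge> d" for t x y using P0 that by (simp add: G_def)
      have "continuous_on UNIV f" "continuous_on UNIV g'"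
        using f(1) cs' csmooth_continuous_on by blast+
      then show "continuous_on UNIV G"
        unfolding G_def split_beta'
        by (intro continuous_on_Re continuous_on_mult continuous_on_coordinates P)
      show "((\<lambda>y. G (t, x, y)) has_real_derivative deriv us y * dir_deriv (0, 1, 0) \<phi> (t, x, y)) (at y)"
        for t x y
        using Re_mult_vector_derivative[OF P'[of y], where a="f t * g' x" and b=1]
        by (simp add: G_def dx algebra_simps)
    qed
    moreover have "(\<lambda>(t, x, y). u (t, x, y) * (dir_deriv (1, 0, 0) \<phi> (t, x, y)
      + us y * dir_deriv (0, 1, 0) \<phi> (t, x, y) + G (t, x, y)
      + dir_deriv (0, 0, 1) (dir_deriv (0, 0, 1) \<phi>) (t, x, y))) = (\<lambda>p. u p * Re (W f f' p))"
      by (auto simp: fun_eq_iff dt dx dyy G_def W_def algebra_simps)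
    ultimately have "(\<integral>p. u p * Re (W f f' p) \<partial>space_time T) = 0" by simp
    moreover have "csmooth f'" using csmooth_vector_derivative f by blast
    then have "Re (\<integral>p. u p *\<^sub>R W f f' p \<partial>space_time T) = (\<integral>p. u p * Re (W f f' p) \<partial>space_time T)"
      using int[OF f(1)] by (subst integral_Re[symmetric]) auto
    ultimately show ?thesis by simp
  qed
  let ?I = "\<integral>p. u p *\<^sub>R W f f' p \<partial>space_time T"
  have "Re ?I = 0" using Re0 cs(1) f' f0(3) by blast
  moreover have "Im ?I = 0"
  proof -
    have "W (\<lambda>t. - \<i> * f t) (\<lambda>t. - \<i> * f' t) p = - \<i> * W f f' p" for p
      by (simp add: W_def split_beta' algebra_simps)
    then have "(\<integral>p. u p *\<^sub>R W (\<lambda>t. - \<i> * f t) (\<lambda>t. - \<i> * f' t) p \<partial>space_time T) = - \<i> * ?I"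
      by (simp flip: mult_scaleR_right)
    moreover have "Re (\<integral>p. u p *\<^sub>R W (\<lambda>t. - \<i> * f t) (\<lambda>t. - \<i> * f' t) p \<partial>space_time T) = 0"
    proof (rule Re0)
      show "csmooth (\<lambda>t. - \<i> * f t)" by (rule csmooth_mult[OF csmooth_const cs(1)])
      show "((\<lambda>t. - \<i> * f t) has_vector_derivative - \<i> * f' t) (at t)" for t
        by (rule has_vector_derivative_mult_right[OF f'])
    qed (use f0 in auto)
    ultimately show ?thesis by simp
  qed
  ultimately show ?thesis by (simp add: W_def split_beta' complex_eq_iff)
qed

section \<open>From a weak equation in time to a bound on the initial value\<close>

lemma integral_time_FTC:
  assumes "\<And>t. (G has_real_derivative g t) (at t)" "continuous_on UNIV g"
    and "\<And>t. t > b \<Longrightarrow> g t = 0" "0 \<le> b" "b < T"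
  shows "(\<integral>t. g t \<partial>time T) = G b - G 0"
  unfolding time_def by (rule integral_restrict_space_FTC[OF assms(1,2)]) (use assms in auto)

lemma DERIV_cutoff_scaled:
  "((\<lambda>t. cutoff (t / a)) has_real_derivative deriv cutoff (t / a) / a) (at t)"
proof -
  have "((\<lambda>t. t / a) has_real_derivative 1 / a) (at t)" by (rule DERIV_cdivide[OF DERIV_ident])
  from DERIV_chain2[OF smooth_DERIV[OF smooth_cutoff] this] show ?thesis by simp
qed

text \<open>The second cutoff produces a rise on {\<eta>/4..\<eta>}, the first a descent on
  {\<tau>/4..\<tau>}. The two intervals may overlap, and then 1 need not be attained, but a
  difference of two numbers in [0, 1] has modulus at most 1.\<close>

lemma smooth_test_time:
  assumes "0 < \<eta>" "\<eta> < \<tau>"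
  defines "\<theta> \<equiv> \<lambda>t. cutoff (t / \<tau>) - cutoff (t / \<eta>)"
  shows "smooth \<theta>"
    and "(\<theta> has_real_derivative deriv cutoff (t / \<tau>) / \<tau> - deriv cutoff (t / \<eta>) / \<eta>) (at t)"
    and "t \<notin> {\<eta>/4..\<tau>} \<Longrightarrow> \<theta> t = 0" and "\<bar>\<theta> t\<bar> \<le> 1"
proof -
  show "smooth \<theta>"
    unfolding \<theta>_def by (intro smooth_intros smooth_compose[OF smooth_cutoff])
  show "(\<theta> has_real_derivative deriv cutoff (t / \<tau>) / \<tau> - deriv cutoff (t / \<eta>) / \<eta>) (at t)"
    unfolding \<theta>_def by (intro DERIV_diff DERIV_cutoff_scaled)
  show "\<bar>\<theta> t\<bar> \<le> 1"
    using cutoff_nonneg[of "t/\<tau>"] cutoff_nonneg[of "t/\<eta>"] cutoff_le_1[of "t/\<tau>"] cutoff_le_1[of "t/\<eta>"]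
    by (simp add: \<theta>_def abs_le_iff)
  show "\<theta> t = 0" if "t \<notin> {\<eta>/4..\<tau>}"
  proof (cases "t < \<eta>/4")
    case True
    then have "t / \<tau> \<le> 1/4" "t / \<eta> \<le> 1/4" using assms(1,2) by (simp_all add: field_simps)
    then show ?thesis by (simp add: \<theta>_def cutoff_eq_1)
  next
    case False
    then have "t / \<tau> \<ge> 1" "t / \<eta> \<ge> 1" using that assms(1,2) by (simp_all add: field_simps)
    then show ?thesis by (simp add: \<theta>_def cutoff_eq_0)
  qed
qed

lemma deriv_cutoff_eq_0: "s < 1/4 \<or> s > 1 \<Longrightarrow> deriv cutoff s = 0"
  using deriv_iter_cutoff_eq_0[of s 0] by simp

lemma continuous_on_deriv_cutoff: "continuous_on S (deriv cutoff)"
  by (intro smooth_continuous_on smooth_deriv smooth_cutoff)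

lemma measure_time: "T > 0 \<Longrightarrow> measure (time T) (space (time T)) = T"
  by (simp add: measure_def emeasure_time)

text \<open>
  The test functions in time rise near \<open>0\<close>, where the rise tends to a Dirac mass and produces \<open>\<xi>\<^sub>0\<close>,
  and descend on \<open>{T/8..T/2}\<close>, where \<open>\<xi>\<close> is already exponentially small.
\<close>

lemma initial_value_bound:
  fixes \<xi> \<nu> :: "real \<Rightarrow> complex"
  assumes T: "T > 0"
    and meas: "\<xi> \<in> borel_measurable (time T)" "\<nu> \<in> borel_measurable (time T)"
    and \<xi>: "AE t in time T. norm (\<xi> t) \<le> A * exp (- r * t)" and \<nu>: "AE t in time T. norm (\<nu> t) \<le> B"
    and A: "A \<ge> 0" "r \<ge> 0"
    and weak: "\<And>\<theta> \<theta>' a b. \<lbrakk>smooth \<theta>; \<And>t. (\<theta> has_real_derivative \<theta>' t) (at t); 0 < a; b < T;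
        \<And>t. t \<notin> {a..b} \<Longrightarrow> \<theta> t = 0\<rbrakk>
      \<Longrightarrow> (\<integral>t. \<theta>' t *\<^sub>R \<xi> t + \<theta> t *\<^sub>R \<nu> t \<partial>time T) = 0"
    and lim: "\<And>\<epsilon>. \<epsilon> > 0 \<Longrightarrow> \<exists>\<delta>>0. AE t in time T. t < \<delta> \<longrightarrow> norm (\<xi> t - \<xi>\<^sub>0) \<le> \<epsilon>"
    and c1: "\<And>s. \<bar>deriv cutoff s\<bar> \<le> c1"
  shows "norm \<xi>\<^sub>0 \<le> 2 * c1 * A * exp (- r * T / 8) + T * B"
proof -
  have c1_nn: "c1 \<ge> 0" using c1[of 0] by linarith
  have D [measurable]: "(\<lambda>t. deriv cutoff (t / a)) \<in> borel_measurable (time T)" for a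
  proof -
    have "continuous_on UNIV (\<lambda>t. deriv cutoff (t * inverse a))"
      by (rule continuous_on_compose2[OF continuous_on_deriv_cutoff[of UNIV]])
        (auto intro!: continuous_intros)
    from measurable_compose[OF id_measurable_interval(3) borel_measurable_continuous_onI[OF this]]
    show ?thesis by (simp add: divide_inverse)
  qed
  note [measurable] = meas
  define \<tau> where "\<tau> = T / 2"
  have est: "norm \<xi>\<^sub>0 \<le> c1 * \<epsilon> + (2 * c1 * A * exp (- r * T / 8) + T * B)" if "\<epsilon> > 0" for \<epsilon>
  proof -
    obtain \<delta> where \<delta>: "\<delta> > 0" "AE t in time T. t < \<delta> \<longrightarrow> norm (\<xi> t - \<xi>\<^sub>0) \<le> \<epsilon>"
      using lim[OF \<open>\<epsilon> > 0\<close>] by blast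
    \<comment> \<open>The bound \<delta> / 2 confines the rise to times at which \<xi> is close to
      its limit, T / 4 keeps \<eta> below \<tau>.\<close>
    define \<eta> where "\<eta> = min (\<delta> / 2) (T / 4)"
    have \<eta>: "0 < \<eta>" "\<eta> < \<delta>" "\<eta> < \<tau>" "\<tau> < T" "\<tau> > 0" using \<delta> T by (auto simp: \<eta>_def \<tau>_def min_def)
    define \<theta> where "\<theta> t = cutoff (t / \<tau>) - cutoff (t / \<eta>)" for t
    note \<theta> = smooth_test_time[OF \<eta>(1,3), folded \<theta>_def]
    have [measurable]: "\<theta> \<in> borel_measurable (time T)"
      using measurable_compose[OF id_measurable_interval(3)
          borel_measurable_continuous_onI[OF smooth_continuous_on[OF \<theta>(1)]]] by simp
    \<comment> \<open>\<open>I1\<close> comes from the descent and \<open>I2\<close> from the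
      residual. The rise is split into the deviation \<open>I3\<close> from the limit and the main
      part \<open>I4\<close>, whose integral is exactly \<open>- \<xi>\<^sub>0\<close>.\<close>
    define I1 where "I1 t = (deriv cutoff (t / \<tau>) / \<tau>) *\<^sub>R \<xi> t" for t
    define I2 where "I2 t = \<theta> t *\<^sub>R \<nu> t" for t
    define I3 where "I3 t = (deriv cutoff (t / \<eta>) / \<eta>) *\<^sub>R (\<xi> t - \<xi>\<^sub>0)" for t
    define I4 where "I4 t = (deriv cutoff (t / \<eta>) / \<eta>) *\<^sub>R \<xi>\<^sub>0" for t
    have b1: "AE t in time T. norm (I1 t) \<le> c1 / \<tau> * (A * exp (- r * T / 8))"
      using \<xi> AE_space
    proof eventually_elim
      case (elim t)
      show ?case
      \<comment> \<open>The descent starts at \<tau> / 4 = T / 8, and by then the decay factor is at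
        most exp (- r T / 8).\<close>
      proof (cases "t / \<tau> < 1/4")
        case True
        then show ?thesis using deriv_cutoff_eq_0[of "t/\<tau>"] c1_nn A \<eta> by (simp add: I1_def)
      next
        case False
        then have "t \<ge> T / 8" using T by (simp add: \<tau>_def field_simps)
        then have "exp (- r * t) \<le> exp (- r * T / 8)"
          using mult_left_mono[OF _ A(2), of "T/8" t] by simp
        then have "norm (\<xi> t) \<le> A * exp (- r * T / 8)"
          using elim(1) mult_left_mono[OF _ A(1)] by (meson order_trans)
        moreover have "\<bar>deriv cutoff (t / \<tau>) / \<tau>\<bar> \<le> c1 / \<tau>"
          using c1[of "t/\<tau>"] \<eta> by (simp add: abs_divide divide_right_mono)
        ultimately show ?thesis unfolding I1_def norm_scaleR using c1_nn \<eta> by (intro mult_mono) auto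
      qed
    qed
    have b2: "AE t in time T. norm (I2 t) \<le> B"
      using \<nu>
    proof eventually_elim
      case (elim t)
      then show ?case using mult_mono[OF \<theta>(4)[of t] elim] by (simp add: I2_def)
    qed
    have b3: "AE t in time T. norm (I3 t) \<le> indicator {..\<eta>} t * (c1 / \<eta> * \<epsilon>)"
      using \<delta>(2)
    proof eventually_elim
      case (elim t)
      show ?case
      proof (cases "t \<le> \<eta>")
        case True
        have "\<bar>deriv cutoff (t / \<eta>) / \<eta>\<bar> \<le> c1 / \<eta>"
          using c1[of "t/\<eta>"] \<eta> by (simp add: abs_divide divide_right_mono)
        then have "\<bar>deriv cutoff (t / \<eta>) / \<eta>\<bar> * norm (\<xi> t - \<xi>\<^sub>0) \<le> c1 / \<eta> * \<epsilon>"
          by (rule mult_mono) (use True c1_nn \<eta> elim in auto)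
        then show ?thesis unfolding I3_def norm_scaleR using True by simp
      next
        case False
        then show ?thesis using deriv_cutoff_eq_0[of "t/\<eta>"] \<eta> by (simp add: I3_def field_simps)
      qed
    qed
    have i1: "integrable (time T) I1" and i2: "integrable (time T) I2"
      by (rule time.integrable_const_bound[OF b1], simp add: I1_def)
        (rule time.integrable_const_bound[OF b2], simp add: I2_def)
    have [measurable]: "(\<lambda>t. indicator {..\<eta>} t :: real) \<in> borel_measurable (time T)"
      using measurable_compose[OF id_measurable_interval(3), of "indicator {..\<eta>}" borel] by simp
    have iind: "integrable (time T) (\<lambda>t. indicator {..\<eta>} t * (c1 / \<eta> * \<epsilon>))"
    proof (rule time.integrable_const_bound[where B="c1 / \<eta> * \<epsilon>"])
      show "(\<lambda>t. indicator {..\<eta>} t * (c1 / \<eta> * \<epsilon>)) \<in> borel_measurable (time T)" by measurable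
    qed (use c1_nn \<eta> that in \<open>auto simp: indicator_def\<close>)
    have i3: "integrable (time T) I3"
    proof (rule Bochner_Integration.integrable_bound[OF iind])
      show "I3 \<in> borel_measurable (time T)" unfolding I3_def by measurable
      show "AE t in time T. norm (I3 t) \<le> norm (indicator {..\<eta>} t * (c1 / \<eta> * \<epsilon>))"
        using b3 by eventually_elim (use c1_nn \<eta> that in auto)
    qed
    have i4: "integrable (time T) I4"
    proof (rule time.integrable_const_bound[where B="c1 / \<eta> * norm \<xi>\<^sub>0"])
      show "I4 \<in> borel_measurable (time T)" unfolding I4_def by measurable
      show "AE t in time T. norm (I4 t) \<le> c1 / \<eta> * norm \<xi>\<^sub>0"
        unfolding I4_def norm_scaleR using c1 \<eta>
        by (intro AE_I2 mult_right_mono) (auto simp: divide_right_mono)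
    qed
    have "(\<integral>t. I1 t + I2 t - I3 t - I4 t \<partial>time T) = 0"
    proof -
      have "(\<integral>t. (deriv cutoff (t / \<tau>) / \<tau> - deriv cutoff (t / \<eta>) / \<eta>) *\<^sub>R \<xi> t + \<theta> t *\<^sub>R \<nu> t \<partial>time T) = 0"
        by (rule weak[where a="\<eta>/4" and b=\<tau>, OF \<theta>(1,2) _ \<eta>(4) \<theta>(3)]) (use \<eta> in auto)
      then show ?thesis
        by (simp add: I1_def I2_def I3_def I4_def algebra_simps)
    qed
    then have "(\<integral>t. I4 t \<partial>time T) = (\<integral>t. I1 t \<partial>time T) + (\<integral>t. I2 t \<partial>time T) - (\<integral>t. I3 t \<partial>time T)"
      using i1 i2 i3 i4 by simp
    moreover have "(\<integral>t. I4 t \<partial>time T) = - \<xi>\<^sub>0"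
    proof -
      have "((\<lambda>t. cutoff (t / \<eta>)) has_real_derivative deriv cutoff (t / \<eta>) / \<eta>) (at t)" for t
        by (rule DERIV_cutoff_scaled)
      then have "(\<integral>t. deriv cutoff (t / \<eta>) / \<eta> \<partial>time T) = cutoff (\<eta> / \<eta>) - cutoff (0 / \<eta>)"
      proof (rule integral_time_FTC)
        show "continuous_on UNIV (\<lambda>t. deriv cutoff (t / \<eta>) / \<eta>)"
          using \<eta> by (intro continuous_intros continuous_on_compose2[OF continuous_on_deriv_cutoff[of UNIV]]) auto
        show "deriv cutoff (t / \<eta>) / \<eta> = 0" if "t > \<eta>" for t
          using that \<eta> deriv_cutoff_eq_0[of "t/\<eta>"] by (simp add: field_simps)
      qed (use \<eta> in auto)
      also have "\<dots> = -1" using \<eta> cutoff_eq_0[of 1] cutoff_eq_1[of 0] by simp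
      finally have I: "(\<integral>t. deriv cutoff (t / \<eta>) / \<eta> \<partial>time T) = -1" .
      \<comment> \<open>An integral whose value is not the default 0 belongs to an integrable
        function.\<close>
      then have "integrable (time T) (\<lambda>t. deriv cutoff (t / \<eta>) / \<eta>)"
        using not_integrable_integral_eq by fastforce
      then show ?thesis unfolding I4_def using I by (subst integral_scaleR_left) simp_all
    qed
    ultimately have "\<xi>\<^sub>0 = (\<integral>t. I3 t \<partial>time T) - ((\<integral>t. I1 t \<partial>time T) + (\<integral>t. I2 t \<partial>time T))"
      by (simp add: algebra_simps)
    then have "norm \<xi>\<^sub>0 \<le> norm (\<integral>t. I1 t \<partial>time T) + norm (\<integral>t. I2 t \<partial>time T) + norm (\<integral>t. I3 t \<partial>time T)"
      using norm_triangle_ineq4[of "\<integral>t. I3 t \<partial>time T" "(\<integral>t. I1 t \<partial>time T) + (\<integral>t. I2 t \<partial>time T)"]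
        norm_triangle_ineq[of "\<integral>t. I1 t \<partial>time T" "\<integral>t. I2 t \<partial>time T"] by simp
    moreover have n1: "norm (\<integral>t. I1 t \<partial>time T) \<le> T * (c1 / \<tau> * (A * exp (- r * T / 8)))"
    proof -
      have "norm (\<integral>t. I1 t \<partial>time T) \<le> (\<integral>t. norm (I1 t) \<partial>time T)" by simp
      also have "\<dots> \<le> (\<integral>t. c1 / \<tau> * (A * exp (- r * T / 8)) \<partial>time T)"
        by (rule integral_mono_AE) (use i1 b1 in auto)
      finally show ?thesis using measure_time[OF T] by simp
    qed
    moreover have "norm (\<integral>t. I2 t \<partial>time T) \<le> T * B"
    proof -
      have "norm (\<integral>t. I2 t \<partial>time T) \<le> (\<integral>t. norm (I2 t) \<partial>time T)" by simp
      also have "\<dots> \<le> (\<integral>t. B \<partial>time T)"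
        by (rule integral_mono_AE) (use i2 b2 in auto)
      finally show ?thesis using measure_time[OF T] by simp
    qed
    moreover have "norm (\<integral>t. I3 t \<partial>time T) \<le> c1 * \<epsilon>"
    proof -
      have "norm (\<integral>t. I3 t \<partial>time T) \<le> (\<integral>t. norm (I3 t) \<partial>time T)" by simp
      also have "\<dots> \<le> (\<integral>t. indicator {..\<eta>} t * (c1 / \<eta> * \<epsilon>) \<partial>time T)"
        by (rule integral_mono_AE) (use i3 iind b3 in auto)
      also have "\<dots> = measure (time T) ({..\<eta>} \<inter> space (time T)) * (c1 / \<eta> * \<epsilon>)" by simp
      also have "measure (time T) ({..\<eta>} \<inter> space (time T)) = \<eta>"
      proof -
        have "{..\<eta>} \<inter> space (time T) = {0<..\<eta>}" using \<eta> by (auto simp: space_time_interval)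
        then show ?thesis using \<eta>
          by (simp add: time_def measure_restrict_space subset_iff)
      qed
      finally show ?thesis using \<eta> by simp
    qed
    \<comment> \<open>The factor 2 of the final bound is T / \<tau>.\<close>
    moreover have "T * (c1 / \<tau> * (A * exp (- r * T / 8))) = 2 * c1 * A * exp (- r * T / 8)"
      using T by (simp add: \<tau>_def)
    ultimately show ?thesis by linarith
  qed
  show ?thesis
  proof (rule field_le_epsilon)
    fix e :: real assume "e > 0"
    \<comment> \<open>The \<open>+ 1\<close> covers the case that \<open>c1\<close> is 0.\<close>
    then have "c1 * (e / (c1 + 1)) \<le> e"
      using c1_nn by (simp add: field_simps)
    then show "norm \<xi>\<^sub>0 \<le> 2 * c1 * A * exp (- r * T / 8) + T * B + e"
      using est[of "e / (c1 + 1)"] \<open>e > 0\<close> c1_nn by simp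
  qed
qed

section \<open>The shear flow and the adjoint quasimode\<close>

text \<open>
  The squared term is switched off at \<open>y = 0\<close>, where \<open>(y - 3)\<^sup>2 / 8 = 9/8 > 1\<close>, and both cutoffs are
  still constant for \<open>\<bar>y - 3\<bar> < 5/4\<close>, a neighbourhood of the support of the quasimode.
\<close>

definition shear :: "real \<Rightarrow> real \<Rightarrow> real" where
  "shear U y = U * (1 - cutoff ((y - 3) / 8)) - (y - 3)\<^sup>2 * cutoff ((y - 3)\<^sup>2 / 8)"

lemma smooth_shear: "smooth (shear U)"
  unfolding shear_def by (intro smooth_intros smooth_compose[OF smooth_cutoff])

lemma shear_0: "shear U 0 = 0"
  by (simp add: shear_def cutoff_eq_0 cutoff_eq_1)

lemma shear_far:
  assumes "y \<ge> 11"
  shows "shear U y = U"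
proof -
  have "(y - 3)\<^sup>2 \<ge> 8\<^sup>2" using assms by (intro power_mono) auto
  then show ?thesis using assms by (simp add: shear_def cutoff_eq_0)
qed

lemma shear_near:
  assumes "\<bar>y - 3\<bar> < 5/4"
  shows "shear U y = - (y - 3)\<^sup>2"
proof -
  have "\<bar>y - 3\<bar>\<^sup>2 \<le> (5/4)\<^sup>2" using assms by (intro power_mono) auto
  then have "(y - 3)\<^sup>2 / 8 \<le> 1/4" by (simp add: power2_eq_square)
  moreover have "y - 3 < 5/4" using le_less_trans[OF abs_ge_self assms] .
  then have "(y - 3) / 8 \<le> 1/4" by simp
  ultimately show ?thesis by (simp add: shear_def cutoff_eq_1)
qed

lemma deriv_shear_near:
  assumes "\<bar>y - 3\<bar> < 5/4"
  shows "deriv (shear U) y = - 2 * (y - 3)"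
proof -
  have "((\<lambda>y. - (y - 3)\<^sup>2) has_real_derivative - 2 * (y - 3)) (at y)"
    by (auto intro!: derivative_eq_intros)
  then have "(shear U has_real_derivative - 2 * (y - 3)) (at y)"
    by (rule has_field_derivative_transform_within_open[of _ _ _ "ball 3 (5/4)"])
      (use assms in \<open>auto simp: shear_near dist_real_def abs_minus_commute\<close>)
  then show ?thesis by (rule DERIV_imp_deriv)
qed

lemma smooth_Cc_inf_halfline:
  fixes f :: "real \<Rightarrow> real"
  assumes "smooth f" "\<And>y. y \<ge> R \<Longrightarrow> f y = 0"
  shows "f \<in> Cc_inf_halfline"
proof -
  have "((deriv ^^ n) f has_real_derivative (deriv ^^ Suc n) f y) (at y within {0..})" for n y
    using smooth_DERIV[OF smooth_deriv_iter[OF assms(1)], of n y] has_field_derivative_at_within by auto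
  then show ?thesis
    using assms(2) unfolding Cc_inf_halfline_def
    by (intro CollectI conjI exI[of _ "\<lambda>n. (deriv ^^ n) f"]) auto
qed

lemma shear_tendsto: "(shear U \<longlongrightarrow> U) at_top"
  by (rule tendsto_eventually) (auto simp: eventually_at_top_linorder shear_far intro!: exI[of _ 11])

lemma shear_Cc: "(\<lambda>y. shear U y - U) \<in> Cc_inf_halfline"
  by (rule smooth_Cc_inf_halfline[where R=11]) (auto intro!: smooth_intros smooth_shear simp: shear_far)

text \<open>
  The frequency is \<open>k = 2 r\<^sup>2\<close>, so that \<open>\<mu>\<^sup>2 = - \<i> k\<close>.  The quasimode is \<open>Q\<close>; the function \<open>P\<close> is
  \<open>- \<integral>\<^sub>y\<^sup>\<infinity> us' Q\<close>, which is explicit because \<open>Q\<close> is minus the derivative of \<open>P\<close> with respect to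
  \<open>(y - 3)\<^sup>2\<close>.
\<close>

locale quasimode =
  fixes r :: real
  assumes r: "r \<ge> 1"
begin

definition \<mu> :: complex where "\<mu> = Complex r (- r)"

definition gauss :: "real \<Rightarrow> complex" where "gauss y = exp (- \<mu> / 2 * of_real ((y - 3)\<^sup>2))"

text \<open>Derivatives of the cutoff in s = (y - 3)^2, not in y: differentiation in y raises
  \<open>j\<close> and brings out a factor 2 (y - 3).\<close>

definition h :: "nat \<Rightarrow> real \<Rightarrow> complex" where
  "h j y = of_real ((deriv ^^ j) cutoff ((y - 3)\<^sup>2))"

definition P :: "real \<Rightarrow> complex" where "P y = h 0 y * gauss y"

definition Q :: "real \<Rightarrow> complex" where "Q y = (\<mu> / 2 * h 0 y - h 1 y) * gauss y"

definition Q' :: "real \<Rightarrow> complex" where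
  "Q' y = of_real (y - 3) * ((2 * \<mu> * h 1 y - 2 * h 2 y - \<mu>\<^sup>2 / 2 * h 0 y) * gauss y)"

definition Q'' :: "real \<Rightarrow> complex" where
  "Q'' y = ((1 - \<mu> * of_real ((y - 3)\<^sup>2)) * (2 * \<mu> * h 1 y - 2 * h 2 y - \<mu>\<^sup>2 / 2 * h 0 y)
    + of_real ((y - 3)\<^sup>2) * (4 * \<mu> * h 2 y - 4 * h 3 y - \<mu>\<^sup>2 * h 1 y)) * gauss y"

definition R :: "real \<Rightarrow> complex" where
  "R y = (3 * \<mu> * h 1 y - 2 * h 2 y - 2 * \<mu>\<^sup>2 * of_real ((y - 3)\<^sup>2) * h 1 y
    + 6 * \<mu> * of_real ((y - 3)\<^sup>2) * h 2 y - 4 * of_real ((y - 3)\<^sup>2) * h 3 y) * gauss y"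

lemma gauss_derivative: "(gauss has_vector_derivative - \<mu> * of_real (y - 3) * gauss y) (at y)"
proof -
  have "((\<lambda>y. - \<mu> / 2 * of_real ((y - 3)\<^sup>2)) has_vector_derivative - \<mu> / 2 * of_real (2 * (y - 3))) (at y)"
    by (intro has_vector_derivative_mult_right has_vector_derivative_of_real)
      (auto intro!: derivative_eq_intros)
  also have "- \<mu> / 2 * of_real (2 * (y - 3)) = - \<mu> * of_real (y - 3)"
    by (simp add: field_simps)
  finally show ?thesis
    unfolding gauss_def[abs_def] using field_vector_diff_chain_at[OF _ DERIV_exp] by (force simp: o_def)
qed

lemma h_derivative: "(h j has_vector_derivative 2 * of_real (y - 3) * h (Suc j) y) (at y)"
proof -
  have "((\<lambda>y. (y - 3)\<^sup>2) has_real_derivative 2 * (y - 3)) (at y)"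
    by (auto intro!: derivative_eq_intros)
  from DERIV_chain2[OF smooth_DERIV[OF smooth_deriv_iter[OF smooth_cutoff, of j]] this]
  have "((\<lambda>y. (deriv ^^ j) cutoff ((y - 3)\<^sup>2)) has_real_derivative
      (deriv ^^ Suc j) cutoff ((y - 3)\<^sup>2) * (2 * (y - 3))) (at y)" by simp
  from has_vector_derivative_of_real[OF this] show ?thesis by (simp add: h_def[abs_def] mult_ac)
qed

lemma csmooth_gauss: "csmooth gauss"
  unfolding gauss_def[abs_def] by (intro csmooth_exp csmooth_mult csmooth_const csmooth_of_real smooth_intros)

lemma csmooth_h: "csmooth (h j)"
  unfolding h_def[abs_def]
  by (intro csmooth_of_real smooth_compose[OF smooth_deriv_iter[OF smooth_cutoff]] smooth_intros)

lemma csmooth_P: "csmooth P" and csmooth_Q: "csmooth Q" and csmooth_R: "csmooth R"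
  unfolding P_def[abs_def] Q_def[abs_def] R_def[abs_def]
  by (intro csmooth_mult csmooth_add csmooth_diff csmooth_const csmooth_gauss csmooth_h
      csmooth_of_real smooth_intros)+

lemma P_derivative: "(P has_vector_derivative - 2 * of_real (y - 3) * Q y) (at y)"
  unfolding P_def[abs_def]
  by (rule gauss_derivative h_derivative refl derivative_eq_intros)+
    (simp add: Q_def field_simps)

lemma Q_derivative: "(Q has_vector_derivative Q' y) (at y)"
  unfolding Q_def[abs_def]
  by (rule gauss_derivative h_derivative refl derivative_eq_intros)+
    (simp add: Q'_def field_simps power2_eq_square numeral_2_eq_2)

lemma Q'_derivative: "(Q' has_vector_derivative Q'' y) (at y)"
  unfolding Q'_def[abs_def]
  by (rule gauss_derivative h_derivative refl derivative_eq_intros)+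
    (simp add: Q''_def field_simps power2_eq_square numeral_2_eq_2 numeral_3_eq_3)

text \<open>
  All terms without a derivative of the cutoff cancel: the uncut Gaussian is an exact adjoint
  eigenfunction.
\<close>

lemma residual:
  "- \<mu> * Q y + \<mu>\<^sup>2 * (- of_real ((y - 3)\<^sup>2) * Q y + P y) + Q'' y = R y"
proof -
  \<comment> \<open>After the common factor \<open>gauss y\<close> is taken out, a polynomial
    identity in \<mu>, \<open>s\<close> and the four values of the cutoff remains.\<close>
  define s H0 H1 H2 H3 where "s = complex_of_real ((y - 3)\<^sup>2)" and "H0 = h 0 y"
    and "H1 = h 1 y" and "H2 = h 2 y" and "H3 = h 3 y"
  have "- \<mu> * (\<mu> / 2 * H0 - H1) + \<mu>\<^sup>2 * (- s * (\<mu> / 2 * H0 - H1) + H0)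
      + ((1 - \<mu> * s) * (2 * \<mu> * H1 - 2 * H2 - \<mu>\<^sup>2 / 2 * H0) + s * (4 * \<mu> * H2 - 4 * H3 - \<mu>\<^sup>2 * H1))
    = 3 * \<mu> * H1 - 2 * H2 - 2 * \<mu>\<^sup>2 * s * H1 + 6 * \<mu> * s * H2 - 4 * s * H3"
    by (simp add: field_simps power2_eq_square)
  moreover have "- \<mu> * (a * g) + \<mu>\<^sup>2 * (- s * (a * g) + H0 * g) + b * g
    = (- \<mu> * a + \<mu>\<^sup>2 * (- s * a + H0) + b) * g" for a b g
    by (simp add: algebra_simps)
  ultimately show ?thesis
    unfolding Q_def P_def Q''_def R_def s_def H0_def H1_def H2_def H3_def by (simp only:)
qed

lemma norm_gauss: "norm (gauss y) = exp (- r * (y - 3)\<^sup>2 / 2)"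
  by (simp add: gauss_def norm_exp_eq_Re \<mu>_def)

lemma norm_\<mu>: "norm \<mu> \<le> 2 * r"
proof -
  have "norm \<mu> \<le> \<bar>Re \<mu>\<bar> + \<bar>Im \<mu>\<bar>" by (rule cmod_le)
  then show ?thesis using r by (simp add: \<mu>_def)
qed

lemma h_eq_0: "\<bar>y - 3\<bar> > 1 \<Longrightarrow> h j y = 0"
proof -
  assume "\<bar>y - 3\<bar> > 1"
  then have "(y - 3)\<^sup>2 > 1" using one_less_power[of "\<bar>y - 3\<bar>" 2] by simp
  then show "h j y = 0"
    using deriv_iter_cutoff_eq_0[of "(y - 3)\<^sup>2" "j - 1"] cutoff_eq_0 by (cases j) (auto simp: h_def)
qed

lemma P_Q_R_eq_0: "\<bar>y - 3\<bar> > 1 \<Longrightarrow> P y = 0 \<and> Q y = 0 \<and> R y = 0"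
  by (simp add: P_def Q_def R_def h_eq_0)

lemma norm_h_0: "norm (h 0 y) \<le> 1"
  using cutoff_nonneg cutoff_le_1 by (simp add: h_def)

lemma norm_gauss_le_1: "norm (gauss y) \<le> 1"
  using r by (simp add: norm_gauss)

lemma norm_Q:
  assumes B: "\<And>s. \<bar>deriv cutoff s\<bar> \<le> B"
  shows "norm (Q y) \<le> r + B"
proof -
  have "norm (\<mu> / 2 * h 0 y - h 1 y) \<le> norm (\<mu> / 2) * norm (h 0 y) + norm (h 1 y)"
    by (metis norm_mult norm_triangle_ineq4)
  also have "\<dots> \<le> r * 1 + B"
    using norm_h_0[of y] norm_\<mu> B[of "(y - 3)\<^sup>2"] r
    by (intro add_mono mult_mono) (auto simp: norm_divide h_def)
  finally have "norm (Q y) \<le> (r + B) * 1"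
    unfolding Q_def norm_mult using norm_gauss_le_1 r B[of 0] by (intro mult_mono) auto
  then show ?thesis by simp
qed

text \<open>The residual lives where the cutoff varies, and there the Gaussian is exponentially small.\<close>

lemma norm_R:
  assumes B: "\<And>j s. j \<in> {1, 2, 3} \<Longrightarrow> \<bar>(deriv ^^ j) cutoff s\<bar> \<le> B"
  shows "norm (R y) \<le> 32 * B * r\<^sup>2 * exp (- r / 8)"
proof (cases "1/4 \<le> (y - 3)\<^sup>2 \<and> (y - 3)\<^sup>2 \<le> 1")
  case True
  define s where "s = complex_of_real ((y - 3)\<^sup>2)"
  have s: "norm s \<le> 1" unfolding s_def norm_of_real using True by simp
  have h: "norm (h j y) \<le> B" if "j \<in> {1, 2, 3}" for j
    using B[OF that] by (simp add: h_def)
  have B0: "B \<ge> 0" using B[of 1 0] by simp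
  have r2: "r \<le> r\<^sup>2" "1 \<le> r\<^sup>2" using r by (auto simp: power2_eq_square intro: order_trans[OF r] mult_mono[of 1 r 1 r, simplified])
  have m2: "norm (\<mu>\<^sup>2) \<le> 4 * r\<^sup>2"
    using power_mono[OF norm_\<mu>, of 2] by (simp add: norm_power power_mult_distrib)
  have b: "norm (a * z * w) \<le> K * B" if "norm a \<le> K" "norm z \<le> 1" "norm w \<le> B" for a z w :: complex and K
  proof -
    have K: "K \<ge> 0" using that(1) norm_ge_zero[of a] by linarith
    then have "norm a * norm z \<le> K * 1" using that by (intro mult_mono) auto
    then show ?thesis unfolding norm_mult using that K by (intro mult_mono) auto
  qed
  have "norm (3 * \<mu> * h 1 y - 2 * h 2 y - 2 * \<mu>\<^sup>2 * s * h 1 y + 6 * \<mu> * s * h 2 y - 4 * s * h 3 y)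
      \<le> norm (3 * \<mu> * 1 * h 1 y) + norm (2 * 1 * h 2 y) + norm (2 * \<mu>\<^sup>2 * s * h 1 y)
        + norm (6 * \<mu> * s * h 2 y) + norm (4 * s * h 3 y)"
    by (simp only: mult_1_right) (intro order_trans[OF norm_triangle_ineq4] order_trans[OF norm_triangle_ineq]
        add_mono order_refl)
  also have "\<dots> \<le> (6 * r) * B + 2 * B + (8 * r\<^sup>2) * B + (12 * r) * B + 4 * B"
    using norm_\<mu> m2 s h by (intro add_mono b) (auto simp: norm_mult)
  \<comment> \<open>The coefficients add up to 6 + 2 + 8 + 12 + 4 = 32; both r and 1 are at most
    r^2.\<close>
  also have "\<dots> \<le> (32 * r\<^sup>2) * B"
    using mult_right_mono[OF r2(1) B0] mult_right_mono[OF r2(2) B0] by (simp add: algebra_simps)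
  finally have *: "norm (3 * \<mu> * h 1 y - 2 * h 2 y - 2 * \<mu>\<^sup>2 * s * h 1 y + 6 * \<mu> * s * h 2 y - 4 * s * h 3 y)
      \<le> (32 * r\<^sup>2) * B" .
  \<comment> \<open>The rate r / 8 is r / 2 times the smallest value 1/4 of (y - 3)^2 where the
    cutoff varies.\<close>
  have "norm (gauss y) \<le> exp (- r / 8)"
    using mult_left_mono[of "1/4" "(y - 3)\<^sup>2" r] True r by (simp add: norm_gauss)
  then have "norm (R y) \<le> (32 * r\<^sup>2) * B * exp (- r / 8)"
    unfolding R_def s_def[symmetric] norm_mult[of _ "gauss y"]
    using * B0 by (intro mult_mono) auto
  then show ?thesis by (simp add: mult_ac)
next
  case False
  then have "h 1 y = 0 \<and> h 2 y = 0 \<and> h 3 y = 0"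
    using deriv_iter_cutoff_eq_0[of "(y - 3)\<^sup>2" 0] deriv_iter_cutoff_eq_0[of "(y - 3)\<^sup>2" 1]
      deriv_iter_cutoff_eq_0[of "(y - 3)\<^sup>2" 2]
    by (auto simp: h_def numeral_2_eq_2 numeral_3_eq_3 not_le simp del: funpow.simps)
  moreover have "B \<ge> 0" using B[of 1 0] by simp
  ultimately show ?thesis by (simp add: R_def)
qed

text \<open>The distance 1 / r is well inside the width r^(-1/2) of the Gaussian: the phase is at
  most 1/6 and \<open>Q\<close> is close to \<mu> / 2, whose real part is r / 2. The lower bounds
  1/2 for the modulus of the Gaussian and for the cosine lose a factor 4.\<close>

lemma Re_Q:
  assumes "r * \<bar>y - 3\<bar> \<le> 1" "r \<ge> 3"
  shows "Re (Q y) \<ge> r / 8"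
proof -
  have "\<bar>y - 3\<bar> \<le> 1 / r" using assms r by (simp add: field_simps)
  then have "\<bar>y - 3\<bar>\<^sup>2 \<le> (1 / r)\<^sup>2" by (intro power_mono) auto
  then have s: "(y - 3)\<^sup>2 \<le> 1 / r\<^sup>2" by (simp add: power_divide)
  \<comment> \<open>From r >= 3; it places y on the plateau of the cutoff, where \<open>h 0\<close>
    is 1 and \<open>h 1\<close> is 0.\<close>
  also have "1 / r\<^sup>2 < 1/4" using power_mono[OF assms(2), of 2] frac_le[of 1 1 9 "r\<^sup>2"] by simp
  finally have s4: "(y - 3)\<^sup>2 < 1/4" .
  have h: "h 0 y = 1" "h 1 y = 0"
    using s4 cutoff_eq_1 deriv_cutoff_eq_0 by (auto simp: h_def)
  define \<theta> where "\<theta> = r * (y - 3)\<^sup>2 / 2"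
  have "r * (y - 3)\<^sup>2 \<le> r * (1 / r\<^sup>2)" using s r by (intro mult_left_mono) auto
  also have "\<dots> = 1 / r" using r by (simp add: power2_eq_square)
  also have "\<dots> \<le> 1/3" using assms(2) by (simp add: field_simps)
  finally have \<theta>: "0 \<le> \<theta>" "\<theta> \<le> 1/6" using r by (auto simp: \<theta>_def)
  have g: "gauss y = exp (Complex (- \<theta>) \<theta>)"
    unfolding gauss_def by (rule arg_cong[of _ _ exp]) (simp add: \<mu>_def \<theta>_def complex_eq_iff)
  \<comment> \<open>The real part of (1 - i) exp (i \<theta>) is cos \<theta> + sin
    \<theta>.\<close>
  have Re: "Re (Q y) = r / 2 * (exp (- \<theta>) * (cos \<theta> + sin \<theta>))"
    by (simp add: Q_def h h(2)[unfolded One_nat_def] g Re_exp Im_exp \<mu>_def algebra_simps)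
  have "exp (- \<theta>) \<ge> 1/2" using exp_ge_add_one_self[of "- \<theta>"] \<theta> by linarith
  moreover have "sin \<theta> \<ge> 0" using \<theta> pi_gt3 by (intro sin_ge_zero) auto
  moreover have "cos \<theta> \<ge> 1/2"
  proof -
    have "cos (pi / 3) \<le> cos \<theta>" using \<theta> pi_gt3 by (intro cos_monotone_0_pi_le) auto
    then show ?thesis by (simp add: cos_60)
  qed
  ultimately have "1/2 * (1/2) \<le> exp (- \<theta>) * (cos \<theta> + sin \<theta>)" by (intro mult_mono) auto
  then have "r / 2 * (1/4) \<le> r / 2 * (exp (- \<theta>) * (cos \<theta> + sin \<theta>))"
    using r by (intro mult_left_mono) auto
  with Re show ?thesis by linarith
qed

end

section \<open>Pairing a solution with the quasimode\<close>

lemma L2_pairing: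
  fixes \<phi> :: "real \<times> real \<Rightarrow> complex"
  assumes f: "f \<in> L2 half_cylinder" and \<phi>: "continuous_on UNIV \<phi>" "\<And>z. norm (\<phi> z) \<le> S"
    and supp: "\<And>x y. y > d \<Longrightarrow> \<phi> (x, y) = 0"
  shows "integrable half_cylinder (\<lambda>z. f z *\<^sub>R \<phi> z)"
    and "norm (\<integral>z. f z *\<^sub>R \<phi> z \<partial>half_cylinder)
      \<le> S * (\<integral>z. \<bar>indicator (strip d) z * f z\<bar> \<partial>half_cylinder)"
proof -
  note i = L2_strip(1)[OF f, of d]
  have [measurable]: "f \<in> borel_measurable half_cylinder" "\<phi> \<in> borel_measurable half_cylinder"
    using f \<phi>(1) by (auto simp: L2_def intro: continuous_borel_measurable)
  have le: "norm (f z *\<^sub>R \<phi> z) \<le> S * \<bar>indicator (strip d) z * f z\<bar>"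
    if "z \<in> space half_cylinder" for z
  proof (cases z)
    case (Pair x y)
    show ?thesis
    proof (cases "y \<le> d")
      case True
      then have "z \<in> strip d"
        using that Pair
        by (auto simp: strip_def half_cylinder_def space_pair_measure space_torus space_halfline)
      then show ?thesis using mult_right_mono[OF \<phi>(2)[of z], of "\<bar>f z\<bar>"] by (simp add: mult.commute)
    next
      case False
      then have "\<phi> z = 0" using supp Pair by auto
      moreover have "S \<ge> 0" using order_trans[OF norm_ge_zero \<phi>(2)] .
      ultimately show ?thesis by simp
    qed
  qed
  show int: "integrable half_cylinder (\<lambda>z. f z *\<^sub>R \<phi> z)"
    by (rule Bochner_Integration.integrable_bound[OF integrable_mult_right[OF integrable_abs[OF i], of S]])
      (use le in \<open>auto intro!: AE_I2 intro: order_trans[OF _ abs_ge_self]\<close>)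
  have "norm (\<integral>z. f z *\<^sub>R \<phi> z \<partial>half_cylinder) \<le> (\<integral>z. norm (f z *\<^sub>R \<phi> z) \<partial>half_cylinder)"
    by (rule integral_norm_bound)
  also have "\<dots> \<le> (\<integral>z. S * \<bar>indicator (strip d) z * f z\<bar> \<partial>half_cylinder)"
    using integrable_norm[OF int] i le by (intro integral_mono) auto
  finally show "norm (\<integral>z. f z *\<^sub>R \<phi> z \<partial>half_cylinder)
      \<le> S * (\<integral>z. \<bar>indicator (strip d) z * f z\<bar> \<partial>half_cylinder)" by simp
qed

text \<open>\<open>initial_value\<close> provides weak continuity against real functions in
  \<open>L2\<close>, so the complex mode has to be split.\<close>

lemma Re_Im_L2:
  fixes \<phi> :: "real \<times> real \<Rightarrow> complex"
  assumes \<phi>: "continuous_on UNIV \<phi>" "\<And>z. norm (\<phi> z) \<le> S" and supp: "\<And>x y. y > d \<Longrightarrow> \<phi> (x, y) = 0"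
  shows "(\<lambda>z. Re (\<phi> z)) \<in> L2 half_cylinder" "(\<lambda>z. Im (\<phi> z)) \<in> L2 half_cylinder"
proof -
  have [measurable]: "\<phi> \<in> borel_measurable half_cylinder"
    by (rule continuous_borel_measurable[OF \<phi>(1)])
  have "(Re (\<phi> z))\<^sup>2 \<le> S\<^sup>2" "(Im (\<phi> z))\<^sup>2 \<le> S\<^sup>2" for z
    using power_mono[OF order_trans[OF abs_Re_le_cmod \<phi>(2)[of z]], of 2]
      power_mono[OF order_trans[OF abs_Im_le_cmod \<phi>(2)[of z]], of 2] by auto
  then have "integrable half_cylinder (\<lambda>z. (Re (\<phi> z))\<^sup>2)" "integrable half_cylinder (\<lambda>z. (Im (\<phi> z))\<^sup>2)"
    by (auto intro!: integrable_strip[where B="S\<^sup>2" and d=d] simp: supp)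
  then show "(\<lambda>z. Re (\<phi> z)) \<in> L2 half_cylinder" "(\<lambda>z. Im (\<phi> z)) \<in> L2 half_cylinder"
    by (auto simp: L2_def)
qed

context quasimode
begin

text \<open>This is exp (- i k x) with k = 2 r^2, written so that its derivative carries the factor
  \<open>\<mu>\<^sup>2\<close> that appears in \<open>residual\<close>.\<close>

definition wave :: "real \<Rightarrow> complex" where "wave x = exp (\<mu>\<^sup>2 * of_real x)"

lemma \<mu>_square: "\<mu>\<^sup>2 = Complex 0 (- 2 * r\<^sup>2)"
  by (simp add: \<mu>_def complex_eq_iff power2_eq_square)

lemma wave_eq: "wave x = cis (- 2 * r\<^sup>2 * x)"
  unfolding wave_def cis_conv_exp
  by (rule arg_cong[of _ _ exp]) (simp add: \<mu>_square complex_eq_iff)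

lemma norm_wave: "norm (wave x) = 1"
  by (simp add: wave_eq)

lemma wave_periodic:
  assumes "r = real n"
  shows "wave (x + 2*pi) = wave x"
proof -
  have "cis (- 2 * r\<^sup>2 * (x + 2*pi)) = cis (- 2 * r\<^sup>2 * x) * cis (2 * pi * of_int (- 2 * int n ^ 2))"
    by (simp add: cis_mult assms algebra_simps)
  also have "cis (2 * pi * of_int (- 2 * int n ^ 2)) = 1" by (rule cis_multiple_2pi) simp
  finally show ?thesis by (simp add: wave_eq)
qed

lemma exp_of_real_derivative:
  "((\<lambda>t. exp (c * of_real t)) has_vector_derivative c * exp (c * of_real t)) (at t)" for c :: complex
proof -
  have "((\<lambda>t. c * of_real t) has_vector_derivative c * of_real 1) (at t)"
    by (intro has_vector_derivative_mult_right has_vector_derivative_of_real) simp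
  from field_vector_diff_chain_at[OF this DERIV_exp] show ?thesis by (simp add: o_def)
qed

lemma csmooth_exp_of_real: "csmooth (\<lambda>t::real. exp (c * of_real t))"
  by (intro csmooth_exp csmooth_mult csmooth_const csmooth_of_real smooth_ident)

text \<open>\<open>Q\<close> vanishes for |y - 3| > 1 and the flow is exactly the parabola for |y -
  3| < 5/4. The two regions cover the line, so the local formula is global, for every
  \<open>U\<close>.\<close>

lemma P_derivative_shear: "(P has_vector_derivative of_real (deriv (shear U) y) * Q y) (at y)"
proof -
  have eq: "- 2 * of_real (y - 3) * Q y = of_real (deriv (shear U) y) * Q y"
    using deriv_shear_near[of y U] P_Q_R_eq_0[of y] by (cases "\<bar>y - 3\<bar> < 5/4") auto
  show ?thesis using P_derivative[of y] by (simp only: eq)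
qed

lemma shear_mult_Q: "of_real (shear U y) * Q y = - of_real ((y - 3)\<^sup>2) * Q y"
  using shear_near[of y U] P_Q_R_eq_0[of y] by (cases "\<bar>y - 3\<bar> < 5/4") auto

definition mode_Q :: "real \<times> real \<Rightarrow> complex" where "mode_Q z = wave (fst z) * Q (snd z)"
definition mode_R :: "real \<times> real \<Rightarrow> complex" where "mode_R z = wave (fst z) * R (snd z)"

lemma continuous_on_mode: "continuous_on UNIV mode_Q" "continuous_on UNIV mode_R"
proof -
  have "continuous_on UNIV wave" "continuous_on UNIV Q" "continuous_on UNIV R"
    using csmooth_exp_of_real csmooth_Q csmooth_R csmooth_continuous_on
    by (auto simp: wave_def[abs_def])
  then show "continuous_on UNIV mode_Q" "continuous_on UNIV mode_R"
    unfolding mode_Q_def[abs_def] mode_R_def[abs_def]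
    by (auto intro!: continuous_intros intro: continuous_on_compose2[of UNIV])
qed

lemma mode_support: "y > 4 \<Longrightarrow> mode_Q (x, y) = 0" "y > 4 \<Longrightarrow> mode_R (x, y) = 0"
  using P_Q_R_eq_0[of y] by (auto simp: mode_Q_def mode_R_def)

text \<open>The time factor exp (- \<mu> t) cancels the eigenvalue and leaves the residual. With
  \<xi> and \<nu> the pairings of u with \<open>mode_Q\<close> and \<open>mode_R\<close>, each times
  this factor, the identity says that \<xi>' = \<nu> in the sense of distributions.\<close>

lemma weak_mode:
  assumes L: "linearized_Prandtl (shear U) T u" and u: "u \<in> Linf_L2 T" and n: "r = real n"
    and \<theta>: "smooth \<theta>" "\<And>t. (\<theta> has_real_derivative \<theta>' t) (at t)" "0 < a" "b < T"
      "\<And>t. t \<notin> {a..b} \<Longrightarrow> \<theta> t = 0"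
  shows "(\<integral>t. \<theta>' t *\<^sub>R (exp (- \<mu> * t) * (\<integral>z. u (t, z) *\<^sub>R mode_Q z \<partial>half_cylinder))
      + \<theta> t *\<^sub>R (exp (- \<mu> * t) * (\<integral>z. u (t, z) *\<^sub>R mode_R z \<partial>half_cylinder)) \<partial>time T) = 0"
proof -
  define f where "f t = of_real (\<theta> t) * exp (- \<mu> * of_real t)" for t
  define f' where "f' t = of_real (\<theta> t) * (- \<mu> * exp (- \<mu> * of_real t)) + of_real (\<theta>' t) * exp (- \<mu> * of_real t)" for t
  have f: "(f has_vector_derivative f' t) (at t)" for t
    unfolding f_def[abs_def] f'_def
    by (intro has_vector_derivative_mult has_vector_derivative_of_real \<theta>(2) exp_of_real_derivative)
  have cf: "csmooth f"
    unfolding f_def[abs_def] by (intro csmooth_mult csmooth_of_real \<theta>(1) csmooth_exp_of_real)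
  have cf': "csmooth f'" using csmooth_vector_derivative[OF cf f] .
  \<comment> \<open>\<open>Q\<close> lives in {2..4}; the wider interval makes the half-open
    condition hold with a margin.\<close>
  have Q0: "Q y = 0" if "y \<notin> {1..<5}" for y
    using P_Q_R_eq_0[of y] that by auto
  have P0: "P y = 0" if "y \<ge> 5" for y
    using P_Q_R_eq_0[of y] that by auto
  have "(\<integral>(t, x, y). u (t, x, y) *\<^sub>R (f' t * wave x * Q y
      + f t * (\<mu>\<^sup>2 * wave x) * (of_real (shear U y) * Q y + P y) + f t * wave x * Q'' y) \<partial>space_time T) = 0"
  proof (rule linearized_Prandtl_weak_product[where us="shear U" and a=a and b=b and c=1 and d=5
        and f=f and f'=f' and g=wave and q=Q and q'=Q' and q''=Q'' and P=P])
    show "csmooth wave" "(wave has_vector_derivative \<mu>\<^sup>2 * wave x) (at x)" for x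
      unfolding wave_def[abs_def] by (rule csmooth_exp_of_real exp_of_real_derivative)+
    show "f t = 0" if "t \<notin> {a..b}" for t
      using \<theta>(5)[OF that] by (simp add: f_def)
    show "continuous_on UNIV P" by (rule csmooth_continuous_on[OF csmooth_P])
  qed (use L u smooth_shear cf csmooth_Q f Q_derivative Q'_derivative P_derivative_shear \<theta>(3,4)
      wave_periodic[OF n] Q0 P0 in auto)
  moreover have "f' t * wave x * Q y + f t * (\<mu>\<^sup>2 * wave x) * (of_real (shear U y) * Q y + P y)
      + f t * wave x * Q'' y
    = \<theta>' t *\<^sub>R (exp (- \<mu> * of_real t) * mode_Q (x, y)) + \<theta> t *\<^sub>R (exp (- \<mu> * of_real t) * mode_R (x, y))" for t x y
  proof -
    define e where "e = exp (- \<mu> * of_real t)"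
    have "(c * (- \<mu> * e) + d * e) * w * q + c * e * (\<mu>\<^sup>2 * w) * p + c * e * w * q2
        = d * (e * (w * q)) + c * (e * (w * (- \<mu> * q + \<mu>\<^sup>2 * p + q2)))" for c d w q p q2 :: complex
      by (simp add: algebra_simps)
    from this[of "of_real (\<theta> t)" "of_real (\<theta>' t)" "wave x" "Q y" "of_real (shear U y) * Q y + P y" "Q'' y"]
    show ?thesis
      using residual[of y]
      by (simp only: f_def f'_def mode_Q_def mode_R_def shear_mult_Q fst_conv snd_conv
          scaleR_conv_of_real e_def)
  qed
  ultimately have *: "(\<integral>p. u p *\<^sub>R (\<theta>' (fst p) *\<^sub>R (exp (- \<mu> * of_real (fst p)) * mode_Q (snd p))
      + \<theta> (fst p) *\<^sub>R (exp (- \<mu> * of_real (fst p)) * mode_R (snd p))) \<partial>space_time T) = 0"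
    by (simp only: split_beta' prod.collapse)
  have "csmooth (\<lambda>t. of_real (\<theta>' t))"
    by (rule csmooth_vector_derivative[OF csmooth_of_real[OF \<theta>(1)]])
      (rule has_vector_derivative_of_real[OF \<theta>(2)])
  then have "continuous_on UNIV (\<lambda>t. Re (of_real (\<theta>' t)))"
    by (intro continuous_on_Re csmooth_continuous_on)
  then have ct: "continuous_on UNIV \<theta>'" "continuous_on UNIV \<theta>"
    using smooth_continuous_on[OF \<theta>(1)] by auto
  have int: "integrable (space_time T) (\<lambda>p. u p *\<^sub>R (\<theta>' (fst p) *\<^sub>R (exp (- \<mu> * of_real (fst p)) * mode_Q (snd p))
      + \<theta> (fst p) *\<^sub>R (exp (- \<mu> * of_real (fst p)) * mode_R (snd p))))"
    by (rule integrable_Linf_L2_mult[OF u, where d=4])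
      (auto intro!: continuous_intros continuous_on_compose2[OF ct(1)] continuous_on_compose2[OF ct(2)]
        continuous_on_compose2[OF continuous_on_mode(1)] continuous_on_compose2[OF continuous_on_mode(2)]
        simp: mode_support)
  have iQ: "integrable (space_time T) (\<lambda>p. u p *\<^sub>R mode_Q (snd p))"
    and iR: "integrable (space_time T) (\<lambda>p. u p *\<^sub>R mode_R (snd p))"
    by (rule integrable_Linf_L2_mult[OF u, where d=4];
        auto intro!: continuous_intros continuous_on_compose2[OF continuous_on_mode(1)]
          continuous_on_compose2[OF continuous_on_mode(2)] simp: mode_support)+
  have m [measurable]: "(\<lambda>t. t) \<in> borel_measurable (time T)" by (rule id_measurable_interval)
  have [measurable]: "\<theta> \<in> borel_measurable (time T)" "\<theta>' \<in> borel_measurable (time T)"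
    using measurable_compose[OF m borel_measurable_continuous_onI[OF ct(1)]]
      measurable_compose[OF m borel_measurable_continuous_onI[OF ct(2)]] by auto
  have "continuous_on UNIV (\<lambda>t::real. exp (- \<mu> * of_real t))" by (intro continuous_intros)
  from measurable_compose[OF m borel_measurable_continuous_onI[OF this]]
  have [measurable]: "(\<lambda>t. exp (- \<mu> * of_real t)) \<in> borel_measurable (time T)" .
  have "0 = (\<integral>t. \<integral>z. u (t, z) *\<^sub>R (\<theta>' t *\<^sub>R (exp (- \<mu> * of_real t) * mode_Q z)
      + \<theta> t *\<^sub>R (exp (- \<mu> * of_real t) * mode_R z)) \<partial>half_cylinder \<partial>time T)"
    using * integral_space_time(1)[OF int] by simp
  also have "\<dots> = (\<integral>t. \<theta>' t *\<^sub>R (exp (- \<mu> * t) * (\<integral>z. u (t, z) *\<^sub>R mode_Q z \<partial>half_cylinder))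
      + \<theta> t *\<^sub>R (exp (- \<mu> * t) * (\<integral>z. u (t, z) *\<^sub>R mode_R z \<partial>half_cylinder)) \<partial>time T)"
  proof (rule integral_cong_AE)
    show "(\<lambda>t. \<integral>z. u (t, z) *\<^sub>R (\<theta>' t *\<^sub>R (exp (- \<mu> * of_real t) * mode_Q z)
      + \<theta> t *\<^sub>R (exp (- \<mu> * of_real t) * mode_R z)) \<partial>half_cylinder) \<in> borel_measurable (time T)"
      using integral_space_time(3)[OF int] by simp
    have [measurable]: "(\<lambda>t. \<integral>z. u (t, z) *\<^sub>R mode_Q z \<partial>half_cylinder) \<in> borel_measurable (time T)"
      "(\<lambda>t. \<integral>z. u (t, z) *\<^sub>R mode_R z \<partial>half_cylinder) \<in> borel_measurable (time T)"
      using integral_space_time(3)[OF iQ] integral_space_time(3)[OF iR] by simp_all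
    show "(\<lambda>t. \<theta>' t *\<^sub>R (exp (- \<mu> * t) * (\<integral>z. u (t, z) *\<^sub>R mode_Q z \<partial>half_cylinder))
      + \<theta> t *\<^sub>R (exp (- \<mu> * t) * (\<integral>z. u (t, z) *\<^sub>R mode_R z \<partial>half_cylinder))) \<in> borel_measurable (time T)"
      by measurable
    show "AE t in time T. (\<integral>z. u (t, z) *\<^sub>R (\<theta>' t *\<^sub>R (exp (- \<mu> * of_real t) * mode_Q z)
        + \<theta> t *\<^sub>R (exp (- \<mu> * of_real t) * mode_R z)) \<partial>half_cylinder)
      = \<theta>' t *\<^sub>R (exp (- \<mu> * t) * (\<integral>z. u (t, z) *\<^sub>R mode_Q z \<partial>half_cylinder))
        + \<theta> t *\<^sub>R (exp (- \<mu> * t) * (\<integral>z. u (t, z) *\<^sub>R mode_R z \<partial>half_cylinder))"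
      using integral_space_time(2)[OF iQ] integral_space_time(2)[OF iR]
    proof eventually_elim
      case (elim t)
      have "(\<lambda>z. u (t, z) *\<^sub>R (\<theta>' t *\<^sub>R (e * mode_Q z) + \<theta> t *\<^sub>R (e * mode_R z)))
        = (\<lambda>z. (of_real (\<theta>' t) * e) * (u (t, z) *\<^sub>R mode_Q z) + (of_real (\<theta> t) * e) * (u (t, z) *\<^sub>R mode_R z))" for e
        by (auto simp: scaleR_conv_of_real algebra_simps)
      then show ?case
        using elim by (simp add: scaleR_conv_of_real mult.assoc)
    qed
  qed
  finally show ?thesis by simp
qed

text \<open>The pairing with \<open>mode_Q\<close> is bounded in time, so multiplied by exp (- \<mu>
  t) it decays like exp (- r t), while the residual is small uniformly in time: these are the two
  inputs of \<open>initial_value_bound\<close>.\<close>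

lemma quasimode_estimate:
  assumes T: "T > 0" and L: "linearized_Prandtl (shear U) T u" and u: "u \<in> Linf_L2 T" and n: "r = real n"
    and init: "initial_value T u u0" and u0: "u0 \<in> borel_measurable half_cylinder"
    and K: "K \<ge> 0" "AE t in time T. (\<lambda>z. u (t, z)) \<in> L2 half_cylinder \<and>
      (\<integral>z. \<bar>indicator (strip 4) z * u (t, z)\<bar> \<partial>half_cylinder) \<le> K"
    and B: "\<And>j s. j \<in> {1, 2, 3} \<Longrightarrow> \<bar>(deriv ^^ j) cutoff s\<bar> \<le> B"
  shows "norm (\<integral>z. u0 z *\<^sub>R mode_Q z \<partial>half_cylinder)
    \<le> 2 * B * ((r + B) * K) * exp (- r * T / 8) + T * (32 * B * r\<^sup>2 * exp (- r / 8) * K)"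
proof -
  have B1: "\<bar>deriv cutoff s\<bar> \<le> B" for s using B[of 1 s] by simp
  have B0: "B \<ge> 0" using B1[of 0] by linarith
  have nQ: "norm (mode_Q z) \<le> r + B" and nR: "norm (mode_R z) \<le> 32 * B * r\<^sup>2 * exp (- r / 8)" for z
    using norm_Q[OF B1] norm_R[OF B] by (simp_all add: mode_Q_def mode_R_def norm_mult norm_wave)
  note pQ = L2_pairing[OF _ continuous_on_mode(1) nQ mode_support(1)]
    and pR = L2_pairing[OF _ continuous_on_mode(2) nR mode_support(2)]
  define \<xi> where "\<xi> t = exp (- \<mu> * of_real t) * (\<integral>z. u (t, z) *\<^sub>R mode_Q z \<partial>half_cylinder)" for t
  define \<nu> where "\<nu> t = exp (- \<mu> * of_real t) * (\<integral>z. u (t, z) *\<^sub>R mode_R z \<partial>half_cylinder)" for t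
  have ne: "norm (exp (- \<mu> * of_real t)) = exp (- r * t)" for t
    by (simp add: norm_exp_eq_Re \<mu>_def)
  have iQ: "integrable (space_time T) (\<lambda>p. u p *\<^sub>R mode_Q (snd p))"
    and iR: "integrable (space_time T) (\<lambda>p. u p *\<^sub>R mode_R (snd p))"
    by (rule integrable_Linf_L2_mult[OF u, where d=4];
        auto intro!: continuous_intros continuous_on_compose2[OF continuous_on_mode(1)]
          continuous_on_compose2[OF continuous_on_mode(2)] simp: mode_support)+
  have ce: "continuous_on UNIV (\<lambda>t::real. exp (- \<mu> * of_real t))" by (intro continuous_intros)
  from measurable_compose[OF id_measurable_interval(3) borel_measurable_continuous_onI[OF this]]
  have [measurable]: "(\<lambda>t. exp (- \<mu> * of_real t)) \<in> borel_measurable (time T)" .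
  obtain w where w: "\<And>t. t \<in> {0..T} \<Longrightarrow> w t \<in> L2 half_cylinder"
    "\<And>\<psi>. \<psi> \<in> L2 half_cylinder \<Longrightarrow> continuous_on {0..T} (\<lambda>t. \<integral>z. w t z * \<psi> z \<partial>half_cylinder)"
    "AE t in time T. AE z in half_cylinder. u (t, z) = w t z"
    "AE z in half_cylinder. w 0 z = u0 z"
    using init unfolding initial_value_def by blast
  \<comment> \<open>\<open>u\<close> is only a class in time. The weakly continuous representative
    \<open>w\<close> gives a function that is continuous down to t = 0, agrees with \<xi> almost
    everywhere and at 0 is the pairing with the datum.\<close>
  define \<omega> where "\<omega> t = exp (- \<mu> * of_real t) * (\<integral>z. w t z *\<^sub>R mode_Q z \<partial>half_cylinder)" for t
  have mQ: "mode_Q \<in> borel_measurable half_cylinder"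
    by (rule continuous_borel_measurable[OF continuous_on_mode(1)])
  have c\<omega>: "continuous_on {0..T} \<omega>"
  proof -
    have eq: "(\<integral>z. w t z *\<^sub>R mode_Q z \<partial>half_cylinder)
        = of_real (\<integral>z. w t z * Re (mode_Q z) \<partial>half_cylinder)
          + \<i> * of_real (\<integral>z. w t z * Im (mode_Q z) \<partial>half_cylinder)" if "t \<in> {0..T}" for t
      using pQ(1)[OF w(1)[OF that], THEN integral_Re] pQ(1)[OF w(1)[OF that], THEN integral_Im]
      by (auto simp: complex_eq_iff)
    have "continuous_on {0..T} (\<lambda>t. exp (- \<mu> * of_real t)
        * (of_real (\<integral>z. w t z * Re (mode_Q z) \<partial>half_cylinder)
          + \<i> * of_real (\<integral>z. w t z * Im (mode_Q z) \<partial>half_cylinder)))"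
      by (intro continuous_on_mult continuous_on_add continuous_on_const continuous_on_of_real
          continuous_on_subset[OF ce] w(2) Re_Im_L2[OF continuous_on_mode(1) nQ mode_support(1)]) auto
    then show ?thesis by (rule continuous_on_eq) (simp add: \<omega>_def eq)
  qed
  have \<omega>0: "\<omega> 0 = (\<integral>z. u0 z *\<^sub>R mode_Q z \<partial>half_cylinder)"
    using w(4) w(1)[of 0] T u0 mQ
    by (auto simp: \<omega>_def L2_def intro!: integral_cong_AE elim!: eventually_mono)
  have "AE t in time T. AE z in half_cylinder. u (t, z) = w t z" by (rule w(3))
  then have \<omega>\<xi>: "AE t in time T. \<xi> t = \<omega> t"
    using K(2) AE_space
  proof eventually_elim
    case (elim t)
    have "(\<integral>z. u (t, z) *\<^sub>R mode_Q z \<partial>half_cylinder) = (\<integral>z. w t z *\<^sub>R mode_Q z \<partial>half_cylinder)"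
      using elim w(1)[of t] mQ
      by (intro integral_cong_AE) (auto simp: L2_def space_time_interval elim!: eventually_mono)
    then show ?case by (simp add: \<xi>_def \<omega>_def)
  qed
  have "norm (\<integral>z. u0 z *\<^sub>R mode_Q z \<partial>half_cylinder)
    \<le> 2 * B * ((r + B) * K) * exp (- r * T / 8) + T * (32 * B * r\<^sup>2 * exp (- r / 8) * K)"
  proof (rule initial_value_bound[OF T, of \<xi> \<nu>])
    have [measurable]: "(\<lambda>t. \<integral>z. u (t, z) *\<^sub>R mode_Q z \<partial>half_cylinder) \<in> borel_measurable (time T)"
      "(\<lambda>t. \<integral>z. u (t, z) *\<^sub>R mode_R z \<partial>half_cylinder) \<in> borel_measurable (time T)"
      using integral_space_time(3)[OF iQ] integral_space_time(3)[OF iR] by simp_all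
    show "\<xi> \<in> borel_measurable (time T)" "\<nu> \<in> borel_measurable (time T)"
      unfolding \<xi>_def \<nu>_def by measurable
    show "AE t in time T. norm (\<xi> t) \<le> (r + B) * K * exp (- r * t)"
      using K(2)
    proof eventually_elim
      case (elim t)
      then have "norm (\<integral>z. u (t, z) *\<^sub>R mode_Q z \<partial>half_cylinder) \<le> (r + B) * K"
        using pQ(2)[of "\<lambda>z. u (t, z)"] r B0 by (meson add_nonneg_nonneg mult_left_mono order_trans zero_le_one)
      then have "exp (- r * t) * norm (\<integral>z. u (t, z) *\<^sub>R mode_Q z \<partial>half_cylinder)
          \<le> exp (- r * t) * ((r + B) * K)"
        by (intro mult_left_mono) auto
      then show ?case unfolding \<xi>_def norm_mult ne by (simp only: mult.commute)
    qed
    show "AE t in time T. norm (\<nu> t) \<le> 32 * B * r\<^sup>2 * exp (- r / 8) * K"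
      using K(2) AE_space
    proof eventually_elim
      case (elim t)
      have "0 \<le> 32 * B * r\<^sup>2 * exp (- r / 8)" using B0 by simp
      with elim have "norm (\<integral>z. u (t, z) *\<^sub>R mode_R z \<partial>half_cylinder) \<le> 32 * B * r\<^sup>2 * exp (- r / 8) * K"
        using pR(2)[of "\<lambda>z. u (t, z)"] by (meson mult_left_mono order_trans)
      moreover have "exp (- r * t) \<le> 1" using elim(2) r by (simp add: space_time_interval)
      ultimately have "exp (- r * t) * norm (\<integral>z. u (t, z) *\<^sub>R mode_R z \<partial>half_cylinder)
          \<le> 1 * (32 * B * r\<^sup>2 * exp (- r / 8) * K)"
        by (intro mult_mono) auto
      then show ?case by (simp only: \<nu>_def norm_mult ne mult_1_left)
    qed
    show "(\<integral>t. \<theta>' t *\<^sub>R \<xi> t + \<theta> t *\<^sub>R \<nu> t \<partial>time T) = 0"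
      if "smooth \<theta>" "\<And>t. (\<theta> has_real_derivative \<theta>' t) (at t)" "0 < a" "b < T"
        "\<And>t. t \<notin> {a..b} \<Longrightarrow> \<theta> t = 0" for \<theta> \<theta>' a b
      unfolding \<xi>_def \<nu>_def by (rule weak_mode[OF L u n that])
    show "\<exists>\<delta>>0. AE t in time T. t < \<delta> \<longrightarrow> norm (\<xi> t - (\<integral>z. u0 z *\<^sub>R mode_Q z \<partial>half_cylinder)) \<le> \<epsilon>"
      if eps: "\<epsilon> > 0" for \<epsilon>
    proof -
      obtain \<delta> where \<delta>: "\<delta> > 0" "\<And>t. t \<in> {0..T} \<Longrightarrow> dist t 0 < \<delta> \<Longrightarrow> dist (\<omega> t) (\<omega> 0) \<le> \<epsilon>"
      proof -
        have "\<exists>\<delta>>0. \<forall>t\<in>{0..T}. dist t 0 < \<delta> \<longrightarrow> dist (\<omega> t) (\<omega> 0) < \<epsilon>"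
          by (rule bspec[OF c\<omega>[unfolded continuous_on_iff], of 0, rule_format]) (use eps T in auto)
        then show thesis using that[OF _ less_imp_le] by blast
      qed
      have "AE t in time T. t < \<delta> \<longrightarrow> norm (\<xi> t - \<omega> 0) \<le> \<epsilon>"
        using \<omega>\<xi> AE_space
        by eventually_elim (use \<delta>(2) in \<open>auto simp: space_time_interval dist_norm\<close>)
      then show ?thesis using \<delta>(1) \<omega>0 by auto
    qed
  qed (use r B0 B1 K(1) in auto)
  then show ?thesis .
qed

end

section \<open>The initial datum\<close>

lemma deriv_iter_affine:
  fixes f :: "real \<Rightarrow> real"
  assumes "smooth f"
  shows "(deriv ^^ i) (\<lambda>x. c * f (a * x + b)) = (\<lambda>x. c * a ^ i * (deriv ^^ i) f (a * x + b))"
proof (induction i)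
  case (Suc i)
  have "((\<lambda>x. c * a ^ i * (deriv ^^ i) f (a * x + b)) has_real_derivative
      c * a ^ i * ((deriv ^^ Suc i) f (a * x + b) * a)) (at x)" for x
  proof -
    have "((\<lambda>x. a * x + b) has_real_derivative a) (at x)" by (auto intro!: derivative_eq_intros)
    from DERIV_cmult[OF DERIV_chain2[OF smooth_DERIV[OF smooth_deriv_iter[OF assms, of i]] this]]
    show ?thesis by simp
  qed
  from DERIV_imp_deriv[OF this] show ?case by (auto simp: Suc)
qed simp

lemma deriv_iter_cos_bounded: "\<bar>(deriv ^^ i) cos (x::real)\<bar> \<le> 1"
proof -
  let ?F = "{sin, cos, \<lambda>y. - sin y, \<lambda>y. - cos y} :: (real \<Rightarrow> real) set"
  have "deriv f \<in> ?F" if "f \<in> ?F" for f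
  proof -
    have "deriv sin = (cos :: real \<Rightarrow> real)" "deriv cos = (\<lambda>y::real. - sin y)"
      "deriv (\<lambda>y. - sin y) = (\<lambda>y::real. - cos y)" "deriv (\<lambda>y. - cos y) = (sin :: real \<Rightarrow> real)"
      by (auto intro!: DERIV_imp_deriv derivative_eq_intros)
    then show ?thesis using that by auto
  qed
  then have "(deriv ^^ i) cos \<in> ?F" by (induction i) auto
  then show ?thesis by auto
qed

definition bump :: "real \<Rightarrow> real" where "bump z = cutoff (z\<^sup>2)"

lemma smooth_bump: "smooth bump"
  unfolding bump_def by (intro smooth_compose[OF smooth_cutoff] smooth_intros)

lemma deriv_iter_bump_eq_0:
  assumes "\<bar>z\<bar> > 1"
  shows "(deriv ^^ j) bump z = 0"
proof (rule deriv_iter_eq_0_open)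
  show "open (- {-1..1::real})" by auto
  show "bump z = 0" if "z \<in> - {-1..1}" for z
  proof -
    have "\<bar>z\<bar> > 1" using that by auto
    then have "z\<^sup>2 > 1" using one_less_power[of "\<bar>z\<bar>" 2] by simp
    then show ?thesis by (simp add: bump_def cutoff_eq_0)
  qed
qed (use assms in auto)

lemma deriv_iter_bump_bounded: "\<exists>C\<ge>0. \<forall>z. \<bar>(deriv ^^ j) bump z\<bar> \<le> C"
proof -
  have "z \<in> {-1..1}" if "(deriv ^^ j) bump z \<noteq> 0" for z
    using deriv_iter_bump_eq_0[of z j] that by (cases "\<bar>z\<bar> > 1") auto
  then show ?thesis
    using continuous_bounded_of_support[OF smooth_continuous_on[OF smooth_deriv_iter[OF smooth_bump]]]
    by metis
qed

lemma power_le_fact_exp: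
  assumes "x \<ge> (0::real)"
  shows "x ^ k \<le> fact k * exp x"
proof -
  have "x ^ k /\<^sub>R fact k \<le> (\<Sum>n. x ^ n /\<^sub>R fact n)"
    using sum_le_suminf[OF summable_exp_generic[of x], of "{k}"] assms by simp
  then show ?thesis by (simp add: exp_def divide_simps mult.commute)
qed

text \<open>For x = sqrt N and exponent 2 (p + 2), \<open>power_le_fact_exp\<close> bounds N^(p + 2)
  by a constant times exp (sqrt N), which leaves a multiple of 1 / N^2 as majorant.\<close>

lemma summable_power_exp_sqrt: "summable (\<lambda>m. real (Suc m) ^ p * exp (- sqrt (real (Suc m))))"
proof (rule summable_comparison_test'[where N=0])
  have "summable (\<lambda>n. inverse (real n ^ 2))" by (rule inverse_power_summable) simp
  then have "summable (\<lambda>m. inverse (real (Suc m) ^ 2))" by (subst summable_Suc_iff)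
  then show "summable (\<lambda>m. fact (2 * (p + 2)) * inverse (real (Suc m) ^ 2))" by (rule summable_mult)
  show "norm (real (Suc m) ^ p * exp (- sqrt (real (Suc m)))) \<le> fact (2 * (p + 2)) * inverse (real (Suc m) ^ 2)" for m
  proof -
    define N where "N = real (Suc m)"
    have "N > 0" by (simp add: N_def)
    have "N ^ (p + 2) = sqrt N ^ (2 * (p + 2))"
      using \<open>N > 0\<close> by (simp add: power_mult)
    also have "\<dots> \<le> fact (2 * (p + 2)) * exp (sqrt N)"
      using \<open>N > 0\<close> by (intro power_le_fact_exp) simp
    finally have "N ^ p * N\<^sup>2 \<le> fact (2 * (p + 2)) * exp (sqrt N)" by (simp only: power_add)
    then have "N ^ p * exp (- sqrt N) \<le> fact (2 * (p + 2)) * inverse (N\<^sup>2)"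
      using \<open>N > 0\<close> by (simp add: exp_minus field_simps)
    then show ?thesis using \<open>N > 0\<close> by (simp add: N_def[symmetric] abs_mult del: of_nat_Suc)
  qed
qed

text \<open>The frequency 2 r^2 of the quasimode with r = m + 1; the shift keeps r >= 1.\<close>

definition freq :: "nat \<Rightarrow> real" where "freq m = real (2 * Suc m ^ 2)"

text \<open>Decays faster than every power of \<open>m\<close> but more slowly than every \<open>exp (- c m)\<close>.\<close>

definition amp :: "nat \<Rightarrow> real" where "amp m = exp (- sqrt (real (Suc m)))"

text \<open>The redundant \<open>+ 0\<close> and \<open>1 *\<close> match the shape of \<open>deriv_iter_affine\<close>.\<close>

definition term_x :: "nat \<Rightarrow> real \<Rightarrow> real" where "term_x m x = amp m * cos (freq m * x + 0)"

definition term_y :: "nat \<Rightarrow> real \<Rightarrow> real" where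
  "term_y m y = 1 * bump (real (Suc m) * y + (- real (Suc m) * 3))"

text \<open>The profile in y is a bump of half-width 1 / (m + 1). On it \<open>Re_Q\<close> with r =
  m + 1 >= 3 keeps the real part of \<open>Q\<close> positive, which rules out cancellation in the
  pairing.\<close>

definition datum_term :: "nat \<Rightarrow> real \<times> real \<Rightarrow> real" where
  "datum_term m = (\<lambda>(x, y). term_x m x * term_y m y)"

text \<open>The factor exp (- y) is undone by the weight, so only the bare series has to be smooth.
  In the pairing it costs no more than exp (- 4), because the terms live in y <= 4.\<close>

definition datum :: "real \<times> real \<Rightarrow> real" where
  "datum z = exp (- snd z) * (\<Sum>m. datum_term m z)"

lemma smooth_term: "smooth (term_x m)" "smooth (term_y m)"
  unfolding term_x_def[abs_def] term_y_def[abs_def]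
  by (intro smooth_intros smooth_compose[OF smooth_bump])+

lemma smooth_product_xy:
  assumes "smooth f" "smooth g"
  shows "smooth (\<lambda>(x::real, y::real). f x * g y)"
  unfolding split_beta'
  by (intro smooth_mult smooth_compose[OF assms(1)] smooth_compose[OF assms(2)]
      smooth_bounded_linear bounded_linear_fst bounded_linear_snd)

lemma dir_deriv_iter_product:
  assumes "smooth f" "smooth g"
  shows "(dir_deriv (1, 0) ^^ i) ((dir_deriv (0, 1) ^^ j) (\<lambda>(x, y). f x * g y))
    = (\<lambda>(x, y). (deriv ^^ i) f x * (deriv ^^ j) g y)"
proof -
  have x: "dir_deriv (1, 0) (\<lambda>(x, y). f x * g y) = (\<lambda>(x, y). deriv f x * g y)"
    and y: "dir_deriv (0, 1) (\<lambda>(x, y). f x * g y) = (\<lambda>(x, y). f x * deriv g y)"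
    if "smooth f" "smooth g" for f g
  proof -
    note s = smooth_product_xy[OF that]
    show "dir_deriv (1, 0) (\<lambda>(x, y). f x * g y) = (\<lambda>(x, y). deriv f x * g y)"
    proof
      fix z :: "real \<times> real"
      obtain x y where z: "z = (x, y)" by (cases z)
      have "((\<lambda>x. f x * g y) has_real_derivative deriv f x * g y) (at x)"
        by (rule DERIV_cmult_right[OF smooth_DERIV[OF that(1)]])
      then show "dir_deriv (1, 0) (\<lambda>(x, y). f x * g y) z = (case z of (x, y) \<Rightarrow> deriv f x * g y)"
        using DERIV_fst_xy[OF s, of y x] DERIV_unique by (auto simp: z)
    qed
    show "dir_deriv (0, 1) (\<lambda>(x, y). f x * g y) = (\<lambda>(x, y). f x * deriv g y)"
    proof
      fix z :: "real \<times> real"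
      obtain x y where z: "z = (x, y)" by (cases z)
      have "((\<lambda>y. f x * g y) has_real_derivative f x * deriv g y) (at y)"
        by (rule DERIV_cmult[OF smooth_DERIV[OF that(2)]])
      then show "dir_deriv (0, 1) (\<lambda>(x, y). f x * g y) z = (case z of (x, y) \<Rightarrow> f x * deriv g y)"
        using DERIV_snd_xy[OF s, of x y] DERIV_unique by (auto simp: z)
    qed
  qed
  have "(dir_deriv (0, 1) ^^ j) (\<lambda>(x, y). f x * g y) = (\<lambda>(x, y). f x * (deriv ^^ j) g y)"
    by (induction j) (simp_all add: y assms smooth_deriv_iter)
  moreover have "(dir_deriv (1, 0) ^^ i) (\<lambda>(x, y). f x * (deriv ^^ j) g y)
      = (\<lambda>(x, y). (deriv ^^ i) f x * (deriv ^^ j) g y)"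
    by (induction i) (simp_all add: x assms smooth_deriv_iter)
  ultimately show ?thesis by simp
qed

lemma datum_term_derivs:
  "(dir_deriv (1, 0) ^^ i) ((dir_deriv (0, 1) ^^ j) (datum_term m)) (x, y)
    = amp m * freq m ^ i * (deriv ^^ i) cos (freq m * x)
      * (real (Suc m) ^ j * (deriv ^^ j) bump (real (Suc m) * (y - 3)))"
proof -
  have "(deriv ^^ i) (term_x m) = (\<lambda>x. amp m * freq m ^ i * (deriv ^^ i) cos (freq m * x + 0))"
    unfolding term_x_def[abs_def] by (rule deriv_iter_affine[OF smooth_cos])
  moreover have "(deriv ^^ j) (term_y m)
      = (\<lambda>y. 1 * real (Suc m) ^ j * (deriv ^^ j) bump (real (Suc m) * y + (- real (Suc m) * 3)))"
    unfolding term_y_def[abs_def] by (rule deriv_iter_affine[OF smooth_bump])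
  moreover have "real (Suc m) * y + (- real (Suc m) * 3) = real (Suc m) * (y - 3)"
    by (simp add: right_diff_distrib)
  ultimately show ?thesis
    unfolding datum_term_def dir_deriv_iter_product[OF smooth_term] by (simp del: of_nat_Suc)
qed

lemma datum_term_eq:
  "datum_term m (x, y) = amp m * cos (freq m * x) * bump (real (Suc m) * (y - 3))"
  using datum_term_derivs[of 0 0 m x y] by simp

text \<open>Each x-derivative costs a frequency 2 (m + 1)^2 and each y-derivative a factor m + 1, in
  total the power 2 i + j of m + 1, which the amplitude makes summable.\<close>

lemma datum_term_bounds:
  obtains B where "\<And>i j. summable (B i j)"
    "\<And>i j m z. \<bar>(dir_deriv (1, 0) ^^ i) ((dir_deriv (0, 1) ^^ j) (datum_term m)) z\<bar> \<le> B i j m"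
proof -
  obtain C where C: "\<And>j z. \<bar>(deriv ^^ j) bump z\<bar> \<le> C j" "\<And>j. C j \<ge> 0"
    using deriv_iter_bump_bounded by metis
  define B where "B i j m = 2 ^ i * C j * (real (Suc m) ^ (2 * i + j) * exp (- sqrt (real (Suc m))))" for i j m
  show thesis
  proof (rule that[of B])
    show "summable (B i j)" for i j
      unfolding B_def[abs_def] by (intro summable_mult summable_power_exp_sqrt)
    show "\<bar>(dir_deriv (1, 0) ^^ i) ((dir_deriv (0, 1) ^^ j) (datum_term m)) z\<bar> \<le> B i j m" for i j m z
    proof -
      obtain x y where z: "z = (x, y)" by (cases z)
      have "\<bar>amp m * freq m ^ i * (deriv ^^ i) cos (freq m * x)
          * (real (Suc m) ^ j * (deriv ^^ j) bump (real (Suc m) * (y - 3)))\<bar>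
        \<le> (amp m * freq m ^ i * 1) * (real (Suc m) ^ j * C j)"
        unfolding abs_mult
        by (intro mult_mono deriv_iter_cos_bounded C) (auto simp: amp_def freq_def C)
      also have "\<dots> = B i j m"
        by (simp add: amp_def freq_def B_def power_mult_distrib power_add mult_ac flip: power_mult del: of_nat_Suc)
      finally show ?thesis unfolding z datum_term_derivs .
    qed
  qed
qed

lemma cos_freq_periodic: "cos (freq m * (x + 2*pi)) = cos (freq m * x)"
proof -
  have "cis (freq m * (x + 2*pi)) = cis (freq m * x) * cis (2 * pi * of_nat (2 * Suc m ^ 2))"
    by (simp add: cis_mult freq_def algebra_simps)
  also have "cis (2 * pi * of_nat (2 * Suc m ^ 2)) = 1" by (rule cis_multiple_2pi) simp
  finally show ?thesis by (metis cis.sel(1) mult.right_neutral)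
qed

lemma x_periodic_datum_term: "x_periodic (datum_term m)"
  unfolding x_periodic_def
proof (intro conjI allI)
  show "smooth (datum_term m)"
    unfolding datum_term_def by (rule smooth_product_xy[OF smooth_term])
qed (simp only: datum_term_eq cos_freq_periodic)

lemma datum_Sobolev_inf: "(\<lambda>(x, y). exp y * datum (x, y)) \<in> Sobolev_inf"
proof -
  obtain B where B: "\<And>i j. summable (B i j)"
    "\<And>i j m z. \<bar>(dir_deriv (1, 0) ^^ i) ((dir_deriv (0, 1) ^^ j) (datum_term m)) z\<bar> \<le> B i j m"
    using datum_term_bounds by blast
  have "(\<lambda>z. \<Sum>m. datum_term m z) \<in> Sobolev_inf"
  proof (rule Sobolev_inf_series[OF x_periodic_datum_term _ B, where d=4])
    fix m i j and x y :: real assume "y > 4"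
    then have "real (Suc m) * (y - 3) > 1 * 1" by (intro mult_le_less_imp_less) auto
    then have "(deriv ^^ j) bump (real (Suc m) * (y - 3)) = 0"
      by (intro deriv_iter_bump_eq_0) simp
    then show "(dir_deriv (1, 0) ^^ i) ((dir_deriv (0, 1) ^^ j) (datum_term m)) (x, y) = 0"
      by (simp add: datum_term_derivs del: of_nat_Suc)
  qed
  moreover have "(\<lambda>(x, y). exp y * datum (x, y)) = (\<lambda>z. \<Sum>m. datum_term m z)"
    by (auto simp: fun_eq_iff datum_def exp_minus)
  ultimately show ?thesis by simp
qed

lemma datum_measurable: "datum \<in> borel_measurable half_cylinder"
proof -
  have "datum_term m \<in> borel_measurable half_cylinder" for m
    using x_periodic_datum_term smooth_continuous_on continuous_borel_measurable
    unfolding x_periodic_def by blast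
  moreover have "(\<lambda>z::real \<times> real. exp (- snd z)) \<in> borel_measurable half_cylinder"
    by (intro continuous_borel_measurable continuous_intros)
  ultimately show ?thesis
    unfolding datum_def[abs_def] by (intro borel_measurable_times borel_measurable_suminf)
qed

section \<open>Fourier orthogonality and the size of the datum along the quasimodes\<close>

lemma integral_torus_cis:
  assumes "l \<in> \<int>"
  shows "(\<integral>x. cis (l * x) \<partial>torus) = (if l = 0 then 2 * pi else 0)"
proof (cases "l = 0")
  case True
  then show ?thesis by (simp add: measure_def emeasure_torus scaleR_conv_of_real)
next
  case False
  have c: "continuous_on UNIV (\<lambda>x. cis (l * x))" "continuous_on UNIV (\<lambda>x. cos (l * x))" "continuous_on UNIV (\<lambda>x. sin (l * x))"
    by (intro continuous_intros)+
  have "(\<lambda>x. cis (l * x)) \<in> borel_measurable torus"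
    using measurable_compose[OF id_measurable_interval(1) borel_measurable_continuous_onI[OF c(1)]] by simp
  then have i: "integrable torus (\<lambda>x. cis (l * x))"
    by (intro torus.integrable_const_bound[where B=1]) auto
  obtain k where k: "l = of_int k" using assms by (auto elim: Ints_cases)
  have "cis (2 * pi * l) = 1" using assms by (rule cis_multiple_2pi)
  then have p: "cos (l * (2 * pi)) = 1" "sin (l * (2 * pi)) = 0"
    by (auto simp: complex_eq_iff mult_ac)
  have "(\<integral>x. cos (l * x) \<partial>torus) = sin (l * (2 * pi)) / l - sin (l * 0) / l"
    by (rule integral_torus_FTC[OF _ c(2)]) (use False in \<open>auto intro!: derivative_eq_intros\<close>)
  moreover have "(\<integral>x. sin (l * x) \<partial>torus) = - cos (l * (2 * pi)) / l - - cos (l * 0) / l"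
    by (rule integral_torus_FTC[OF _ c(3)]) (use False in \<open>auto intro!: derivative_eq_intros\<close>)
  ultimately show ?thesis
    using integral_Re[OF i] integral_Im[OF i] p False by (simp add: complex_eq_iff)
qed

text \<open>The cosine is half the sum of two exponentials. As a + b > 0, only the difference
  frequency can vanish, and it contributes half of 2 pi.\<close>

lemma integral_torus_cos_cis:
  assumes "a \<in> \<int>" "b \<in> \<int>" "a > 0" "b > 0"
  shows "(\<integral>x. of_real (cos (a * x)) * cis (- b * x) \<partial>torus) = (if a = b then pi else 0)"
proof -
  have i: "integrable torus (\<lambda>x. cis (l * x))" for l
  proof -
    have "continuous_on UNIV (\<lambda>x. cis (l * x))" by (intro continuous_intros)
    then have "(\<lambda>x. cis (l * x)) \<in> borel_measurable torus"
      using measurable_compose[OF id_measurable_interval(1) borel_measurable_continuous_onI] by simp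
    then show ?thesis by (intro torus.integrable_const_bound[where B=1]) auto
  qed
  have eq: "of_real (cos (a * x)) * cis (- b * x) = (cis ((a - b) * x) + cis ((- a - b) * x)) / 2" for x
  proof -
    have "of_real (cos (a * x)) = (cis (a * x) + cis (- a * x)) / 2"
      by (simp add: complex_eq_iff)
    then show ?thesis by (simp add: cis_mult distrib_right left_diff_distrib add_divide_distrib)
  qed
  have "(\<integral>x. of_real (cos (a * x)) * cis (- b * x) \<partial>torus)
      = ((\<integral>x. cis ((a - b) * x) \<partial>torus) + (\<integral>x. cis ((- a - b) * x) \<partial>torus)) / 2"
    unfolding eq using Bochner_Integration.integral_add[OF i i, of "a - b" "- a - b"] by simp
  from this[unfolded integral_torus_cis[OF Ints_diff[OF assms(1,2)]]
      integral_torus_cis[OF Ints_diff[OF Ints_minus[OF assms(1)] assms(2)]]]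
  show ?thesis using assms(3,4) by (cases "a = b") simp_all
qed

lemma integrable_halfline:
  fixes f :: "real \<Rightarrow> 'b::{banach, second_countable_topology}"
  assumes "continuous_on UNIV f" "\<And>y. norm (f y) \<le> B" "\<And>y. y > d \<Longrightarrow> f y = 0" "d > 0"
  shows "integrable halfline f"
proof (rule integrableI_bounded_set[where A="{0<..d}" and B=B])
  show "{0<..d} \<in> sets halfline" by (auto simp: halfline_def sets_restrict_space_iff)
  show "emeasure halfline {0<..d} < \<infinity>"
    using \<open>d > 0\<close> by (auto simp: halfline_def emeasure_restrict_space subset_iff)
  show "f \<in> borel_measurable halfline" by (rule continuous_measurable_halfline[OF assms(1)])
qed (use assms in \<open>auto intro!: AE_I2 simp: space_halfline not_le\<close>)

lemma integral_half_cylinder_product: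
  fixes f g :: "real \<Rightarrow> complex"
  assumes "integrable half_cylinder (\<lambda>z. f (fst z) * g (snd z))"
  shows "(\<integral>z. f (fst z) * g (snd z) \<partial>half_cylinder) = (\<integral>x. f x \<partial>torus) * (\<integral>y. g y \<partial>halfline)"
  using integral_half_cylinder(1)[OF assms] by simp

context quasimode
begin

text \<open>Orthogonality in x leaves the single term of frequency 2 r^2. Its bump confines the
  y-integral to r |y - 3| <= 1, where the integrand has nonnegative real part, and the middle half
  of that interval gives length 1 / r times r / 8 times exp (- 4).\<close>

lemma datum_pairing_lower_bound:
  assumes n: "r = real n" and "n \<ge> 3"
  shows "norm (\<integral>z. datum z *\<^sub>R mode_Q z \<partial>half_cylinder) \<ge> exp (- sqrt r) * pi * exp (- 4) / 8"
proof -
  obtain m0 where m0: "n = Suc m0" using \<open>n \<ge> 3\<close> by (cases n) auto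
  obtain S where S: "\<And>z. norm (mode_Q z) \<le> S" and SQ: "\<And>y. norm (Q y) \<le> S"
  proof -
    obtain B where B: "\<And>s. \<bar>deriv cutoff s\<bar> \<le> B"
      using deriv_iter_cutoff_bounded[of 0] by auto
    show thesis
      by (rule that[of "r + B"]) (use norm_Q[OF B] in \<open>simp_all add: mode_Q_def norm_mult norm_wave\<close>)
  qed
  have S0: "S \<ge> 0" using order_trans[OF norm_ge_zero SQ] .
  define \<psi> where "\<psi> z = exp (- snd z) *\<^sub>R mode_Q z" for z
  have c\<psi>: "continuous_on UNIV \<psi>"
    unfolding \<psi>_def[abs_def] by (intro continuous_intros continuous_on_mode(1))
  have \<psi>: "integrable half_cylinder \<psi>"
  proof (rule integrable_strip[where B=S and d=4])
    show "norm (\<psi> (x, y)) \<le> S" if "y > 0" for x y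
    proof -
      have "exp (- y) * norm (mode_Q (x, y)) \<le> 1 * S" using that S by (intro mult_mono) auto
      then show ?thesis by (simp add: \<psi>_def)
    qed
    show "\<psi> \<in> borel_measurable half_cylinder" by (rule continuous_borel_measurable[OF c\<psi>])
  qed (simp add: \<psi>_def mode_support)
  obtain B where B: "\<And>i j. summable (B i j)"
    "\<And>i j m z. \<bar>(dir_deriv (1, 0) ^^ i) ((dir_deriv (0, 1) ^^ j) (datum_term m)) z\<bar> \<le> B i j m"
    using datum_term_bounds by blast
  have B00: "\<bar>datum_term m z\<bar> \<le> B 0 0 m" for m z using B(2)[of 0 0] by simp
  have mt: "datum_term m \<in> borel_measurable half_cylinder" for m
    using x_periodic_datum_term smooth_continuous_on continuous_borel_measurable
    unfolding x_periodic_def by blast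
  define J where "J m = (\<integral>y. of_real (exp (- y) * bump (real (Suc m) * (y - 3))) * Q y \<partial>halfline)" for m
  have terms: "(\<integral>z. datum_term m z *\<^sub>R \<psi> z \<partial>half_cylinder) = (if m = m0 then of_real (amp m * pi) * J m else 0)" for m
  proof -
    define f where "f x = of_real (cos (freq m * x)) * cis (- freq m0 * x)" for x
    define g where "g y = of_real (amp m) * (of_real (exp (- y) * bump (real (Suc m) * (y - 3))) * Q y)" for y
    have w: "wave x = cis (- freq m0 * x)" for x
      unfolding wave_eq by (simp add: n m0 freq_def)
    have eq: "datum_term m z *\<^sub>R \<psi> z = f (fst z) * g (snd z)" for z
      by (cases z) (simp add: datum_term_eq \<psi>_def mode_Q_def f_def g_def w scaleR_conv_of_real mult_ac)
    have "integrable half_cylinder (\<lambda>z. datum_term m z *\<^sub>R \<psi> z)"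
    proof (rule Bochner_Integration.integrable_bound[OF integrable_scaleR_right[OF \<psi>, of "B 0 0 m"]])
      show "(\<lambda>z. datum_term m z *\<^sub>R \<psi> z) \<in> borel_measurable half_cylinder"
        using mt \<psi> by simp
      show "AE z in half_cylinder. norm (datum_term m z *\<^sub>R \<psi> z) \<le> norm (B 0 0 m *\<^sub>R \<psi> z)"
        using order_trans[OF B00 abs_ge_self] by (intro AE_I2) (simp add: mult_right_mono)
    qed
    then have "(\<integral>z. datum_term m z *\<^sub>R \<psi> z \<partial>half_cylinder) = (\<integral>x. f x \<partial>torus) * (\<integral>y. g y \<partial>halfline)"
      unfolding eq by (rule integral_half_cylinder_product)
    also have "(\<integral>x. f x \<partial>torus) = (if freq m = freq m0 then pi else 0)"
      unfolding f_def by (rule integral_torus_cos_cis) (simp_all add: freq_def del: of_nat_Suc)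
    also have "freq m = freq m0 \<longleftrightarrow> m = m0"
      by (simp add: freq_def power2_eq_iff_nonneg del: of_nat_Suc of_nat_mult of_nat_power)
    also have "(\<integral>y. g y \<partial>halfline) = of_real (amp m) * J m"
      unfolding g_def J_def by simp
    finally show ?thesis by simp
  qed
  have "(\<lambda>m. \<integral>z. datum_term m z *\<^sub>R \<psi> z \<partial>half_cylinder)
      sums (\<integral>z. (\<Sum>m. datum_term m z) *\<^sub>R \<psi> z \<partial>half_cylinder)"
    by (rule sums_integral_bounded[OF mt \<psi> B(1) B00])
  moreover have "(\<lambda>m. \<integral>z. datum_term m z *\<^sub>R \<psi> z \<partial>half_cylinder) sums (of_real (amp m0 * pi) * J m0)"
    unfolding terms by (rule sums_single)
  ultimately have "(\<integral>z. (\<Sum>m. datum_term m z) *\<^sub>R \<psi> z \<partial>half_cylinder) = of_real (amp m0 * pi) * J m0"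
    using sums_unique2 by blast
  moreover have "datum z *\<^sub>R mode_Q z = (\<Sum>m. datum_term m z) *\<^sub>R \<psi> z" for z
    by (simp add: datum_def \<psi>_def mult.commute)
  ultimately have main: "(\<integral>z. datum z *\<^sub>R mode_Q z \<partial>half_cylinder) = of_real (amp m0 * pi) * J m0"
    by simp
  have J: "Re (J m0) \<ge> exp (- 4) / 8"
  proof -
    define q where "q y = of_real (exp (- y) * bump (r * (y - 3))) * Q y" for y
    have b: "0 \<le> bump z" "bump z \<le> 1" for z
      using cutoff_nonneg cutoff_le_1 by (auto simp: bump_def)
    have cq: "continuous_on UNIV q"
      unfolding q_def[abs_def]
      by (intro continuous_intros csmooth_continuous_on[OF csmooth_Q]
          continuous_on_compose2[OF smooth_continuous_on[OF smooth_bump, of UNIV]]) auto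
    have iq: "integrable halfline q"
    proof (rule integrable_halfline[where d=4])
      show "continuous_on UNIV q" by (rule cq)
      show "norm (q y) \<le> exp (- 2) * S" for y
      proof (cases "\<bar>y - 3\<bar> > 1")
        case True
        then show ?thesis using P_Q_R_eq_0[of y] S0 by (simp add: q_def)
      next
        case False
        then have "exp (- y) * bump (r * (y - 3)) \<le> exp (- 2) * 1"
          using b by (intro mult_mono) auto
        then have "exp (- y) * bump (r * (y - 3)) * norm (Q y) \<le> exp (- 2) * S"
          using SQ b by (intro mult_mono) auto
        then show ?thesis using b by (simp add: q_def norm_mult abs_mult)
      qed
    qed (use P_Q_R_eq_0 in \<open>auto simp: q_def\<close>)
    \<comment> \<open>On \<open>A\<close> the square of r (y - 3) is at most 1/4, the threshold
      below which \<open>cutoff\<close> is 1. The length 1 / r compensates the growth of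
      \<open>Q\<close>.\<close>
    define A where "A = {3 - 1 / (2 * r)..3 + 1 / (2 * r)}"
    have r3: "r \<ge> 3" using n \<open>n \<ge> 3\<close> by simp
    then have A0: "A \<subseteq> {2..4}" by (auto simp: A_def field_simps)
    have As: "A \<in> sets halfline"
      using A0 by (auto simp: halfline_def sets_restrict_space_iff A_def)
    have Am: "measure halfline A = 1 / r"
    proof -
      have "A \<subseteq> {0<..}" using A0 by force
      then have "measure halfline A = measure lborel A"
        unfolding halfline_def by (intro measure_restrict_space) auto
      also have "\<dots> = (3 + 1 / (2 * r)) - (3 - 1 / (2 * r))"
        unfolding A_def using r3 by (intro measure_lborel_Icc) simp
      finally show ?thesis using r3 by simp
    qed
    have "emeasure halfline A \<noteq> top"
      using Am r3 by (auto simp: measure_def)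
    then have "emeasure halfline A < \<infinity>" by (simp add: less_top)
    then have iA: "integrable halfline (\<lambda>y. indicator A y * (exp (- 4) * (r / 8)))"
      using As by (intro integrable_mult_left) auto
    have "exp (- 4) / 8 = measure halfline A * (exp (- 4) * (r / 8))" using Am r3 by simp
    also have "\<dots> = (\<integral>y. indicator A y * (exp (- 4) * (r / 8)) \<partial>halfline)"
      using As by (simp add: Int_absorb2 sets.sets_into_space)
    also have "\<dots> \<le> (\<integral>y. Re (q y) \<partial>halfline)"
    proof (rule integral_mono[OF iA])
      show "integrable halfline (\<lambda>y. Re (q y))" using iq by simp
      \<comment> \<open>Off \<open>A\<close> only the sign matters: the integrand is 0 where the
        bump is, and \<open>Re_Q\<close> makes it nonnegative elsewhere.\<close>
      show "indicator A y * (exp (- 4) * (r / 8)) \<le> Re (q y)" for y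
      proof (cases "bump (r * (y - 3)) = 0")
        case True
        have "y \<notin> A"
        proof
          assume "y \<in> A"
          then have "\<bar>y - 3\<bar> \<le> 1 / (2 * r)" by (auto simp: A_def abs_le_iff)
          from mult_left_mono[OF this, of r] r3 have "\<bar>r * (y - 3)\<bar> \<le> 1/2" by (simp add: abs_mult)
          from power_mono[OF this, of 2] have "(r * (y - 3))\<^sup>2 \<le> 1/4" by (simp add: power2_eq_square)
          with True show False by (simp add: bump_def cutoff_eq_1)
        qed
        with True show ?thesis by (simp add: q_def)
      next
        case False
        then have "\<bar>r * (y - 3)\<bar> \<le> 1" using deriv_iter_bump_eq_0[of "r * (y - 3)" 0] by force
        then have le: "r * \<bar>y - 3\<bar> \<le> 1" using r3 by (simp add: abs_mult)
        note RQ = Re_Q[OF le r3]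
        show ?thesis
        proof (cases "y \<in> A")
          case True
          then have "\<bar>y - 3\<bar> \<le> 1 / (2 * r)" by (auto simp: A_def abs_le_iff)
          from mult_left_mono[OF this, of r] r3 have "\<bar>r * (y - 3)\<bar> \<le> 1/2" by (simp add: abs_mult)
          from power_mono[OF this, of 2] have "(r * (y - 3))\<^sup>2 \<le> 1/4" by (simp add: power2_eq_square)
          then have "bump (r * (y - 3)) = 1" by (simp add: bump_def cutoff_eq_1)
          moreover have "exp (- 4) * (r / 8) \<le> exp (- y) * Re (Q y)"
            using RQ r3 True A0 by (intro mult_mono) auto
          ultimately show ?thesis using True by (simp add: q_def)
        next
          case False
          then show ?thesis using RQ r3 b by (simp add: q_def)
        qed
      qed
    qed
    also have "\<dots> = Re (J m0)"
    proof -
      have "real (Suc m0) = r" by (simp add: n m0)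
      then have "J m0 = (\<integral>y. q y \<partial>halfline)" by (simp only: J_def q_def)
      then show ?thesis using integral_Re[OF iq] by simp
    qed
    finally show ?thesis .
  qed
  have "exp (- sqrt r) * pi * exp (- 4) / 8 = amp m0 * pi * (exp (- 4) / 8)"
    by (simp add: amp_def n m0)
  also have "\<dots> \<le> amp m0 * pi * norm (J m0)"
    using J complex_Re_le_cmod[of "J m0"] by (intro mult_left_mono) (auto simp: amp_def)
  also have "\<dots> = norm (\<integral>z. datum z *\<^sub>R mode_Q z \<partial>half_cylinder)"
    unfolding main norm_mult norm_of_real by (simp add: amp_def)
  finally show ?thesis .
qed

end

section \<open>Contradiction at high frequency\<close>

lemma no_solution:
  assumes T: "T > 0"
  shows "\<not> (\<exists>u. u \<in> Linf_L2 T \<and> dy_in_L2 T u \<and> Prandtl_solution (shear U) T datum u)"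
proof
  assume "\<exists>u. u \<in> Linf_L2 T \<and> dy_in_L2 T u \<and> Prandtl_solution (shear U) T datum u"
  then obtain u where u: "u \<in> Linf_L2 T" and L: "linearized_Prandtl (shear U) T u"
    and init: "initial_value T u datum"
    by (auto simp: Prandtl_solution_def)
  obtain K where K: "K \<ge> 0" "AE t in time T. (\<lambda>z. u (t, z)) \<in> L2 half_cylinder \<and>
      (\<integral>z. \<bar>indicator (strip 4) z * u (t, z)\<bar> \<partial>half_cylinder) \<le> K"
    by (rule Linf_L2_strip_bound[OF u])
  obtain B where B: "\<And>j s. j \<in> {1, 2, 3} \<Longrightarrow> \<bar>(deriv ^^ j) cutoff s\<bar> \<le> B"
  proof -
    have "\<exists>b. \<forall>s. \<bar>(deriv ^^ Suc j) cutoff s\<bar> \<le> b" for j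
      using deriv_iter_cutoff_bounded[of j] by metis
    then obtain b where b: "\<And>j s. \<bar>(deriv ^^ Suc j) cutoff s\<bar> \<le> b j" by metis
    show thesis
    proof (rule that[of "max (b 0) (max (b 1) (b 2))"])
      show "\<bar>(deriv ^^ j) cutoff s\<bar> \<le> max (b 0) (max (b 1) (b 2))" if "j \<in> {1, 2, 3}" for j s
        using that b[of 0 s] b[of 1 s] b[of 2 s] by (auto simp: numeral_2_eq_2 numeral_3_eq_3 le_max_iff_disj)
    qed
  qed
  \<comment> \<open>The upper bound of \<open>quasimode_estimate\<close> divided by the amplitude
    exp (- sqrt r), with the factor r + B expanded so that each summand is a constant times a
    function tending to 0.\<close>
  define G where "G r = 2 * B * K * (r * (exp (sqrt r) * exp (- r * T / 8)))
    + 2 * B * B * K * (exp (sqrt r) * exp (- r * T / 8))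
    + T * 32 * B * K * (r\<^sup>2 * (exp (sqrt r) * exp (- r / 8)))" for r
  have le: "pi * exp (- 4) / 8 \<le> G (real n)" if "n \<ge> 3" for n
  proof -
    interpret quasimode "real n" using that by unfold_locales simp
    have "exp (- sqrt (real n)) * pi * exp (- 4) / 8
        \<le> 2 * B * ((real n + B) * K) * exp (- real n * T / 8) + T * (32 * B * (real n)\<^sup>2 * exp (- real n / 8) * K)"
      by (rule order_trans[OF datum_pairing_lower_bound[OF refl that]
            quasimode_estimate[OF T L u refl init datum_measurable K B]])
    from mult_left_mono[OF this, of "exp (sqrt (real n))"]
    show ?thesis by (simp add: G_def exp_minus field_simps)
  qed
  have "(G \<longlongrightarrow> 2 * B * K * 0 + 2 * B * B * K * 0 + T * 32 * B * K * 0) at_top"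
    unfolding G_def[abs_def]
  proof (intro tendsto_intros)
    show "((\<lambda>r. r * (exp (sqrt r) * exp (- r * T / 8))) \<longlongrightarrow> 0) at_top"
      "((\<lambda>r. exp (sqrt r) * exp (- r * T / 8)) \<longlongrightarrow> 0) at_top"
      "((\<lambda>r::real. r\<^sup>2 * (exp (sqrt r) * exp (- r / 8))) \<longlongrightarrow> 0) at_top"
      using T by real_asymp+
  qed
  then have "(\<lambda>n. G (real n)) \<longlonglongrightarrow> 0"
    using filterlim_compose[OF _ filterlim_real_sequentially] by simp
  then have "pi * exp (- 4) / 8 \<le> (0::real)"
    by (rule tendsto_lowerbound) (use le in \<open>auto simp: eventually_sequentially\<close>)
  then show False
    using mult_pos_pos[OF pi_gt_zero exp_gt_zero[of "-4 :: real"]] by linarith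
qed

text \<open>One \<open>datum\<close> serves every \<open>T\<close> and every \<open>U\<close>; the
  flow alone depends on \<open>U\<close>.\<close>

theorem theorem1p1:
  fixes U :: real
  assumes "U \<ge> 0"
  shows "\<exists>us :: real \<Rightarrow> real.
    us 0 = 0 \<and> (us \<longlongrightarrow> U) at_top \<and> (\<lambda>y. us y - U) \<in> Cc_inf_halfline \<and>
    (\<forall>T>0. \<exists>u0 :: real \<times> real \<Rightarrow> real.
       (\<lambda>(x, y). exp y * u0 (x, y)) \<in> Sobolev_inf \<and>
       \<not> (\<exists>u. u \<in> Linf_L2 T \<and> dy_in_L2 T u \<and> Prandtl_solution us T u0 u))"
  using shear_0 shear_tendsto shear_Cc datum_Sobolev_inf no_solution by blast

end
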